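(* Let $G$ be a hyperbolic group. Then the bounded knapsack problem $\mathbf{BKP}(G)$ is in $\mathbf{P}$.
   Context: Fix a finite generating set $X$ of $G$ (the complexity of the problem does not depend on this choice up to polynomial-time equivalence). Elements of $G$ are given as words over $X\cup X^{-1}$; sizes of words are their lengths, and natural numbers $m$ are given in unary as $1^m$. The bounded knapsack problem $\mathbf{BKP}(G)$: given $g_1,\ldots,g_k,g\in G$ and $1^m$, decide whether $g=g_1^{\varepsilon_1}\cdots g_k^{\varepsilon_k}$ in $G$ for some $\varepsilon_1,\ldots,\varepsilon_k\in\{0,1,\ldots,m\}$. The group $G$ is fixed (not part of the input). *)

theory Defs
  imports "HOL-Algebra.Generated_Groups" "HOL-Computational_Algebra.Polynomial"
begin

section \<open>Words over a generating set\<close>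

definition finite_generating_set :: "('a, 'b) monoid_scheme \<Rightarrow> 'a set \<Rightarrow> bool" where
  "finite_generating_set G X \<longleftrightarrow> finite X \<and> X \<subseteq> carrier G \<and> generate G X = carrier G"

text \<open>The letter \<open>(x, True)\<close> is the formal generator \<open>x\<close>, and \<open>(x, False)\<close> is its formal inverse.\<close>

type_synonym 'a letter = "'a \<times> bool"

definition letters :: "'a set \<Rightarrow> 'a letter set" where
  "letters X = X \<times> UNIV"

fun letter_val :: "('a, 'b) monoid_scheme \<Rightarrow> 'a letter \<Rightarrow> 'a" where
  "letter_val G (x, b) = (if b then x else inv\<^bsub>G\<^esub> x)"

definition group_prod :: "('a, 'b) monoid_scheme \<Rightarrow> 'a list \<Rightarrow> 'a" where
  "group_prod G xs = foldr (\<otimes>\<^bsub>G\<^esub>) xs \<one>\<^bsub>G\<^esub>"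

definition word_val :: "('a, 'b) monoid_scheme \<Rightarrow> 'a letter list \<Rightarrow> 'a" where
  "word_val G w = group_prod G (map (letter_val G) w)"

section \<open>Hyperbolic groups\<close>

definition word_length :: "('a, 'b) monoid_scheme \<Rightarrow> 'a set \<Rightarrow> 'a \<Rightarrow> nat" where
  "word_length G X g = (LEAST n. \<exists>w \<in> lists (letters X). word_val G w = g \<and> length w = n)"

definition word_dist :: "('a, 'b) monoid_scheme \<Rightarrow> 'a set \<Rightarrow> 'a \<Rightarrow> 'a \<Rightarrow> real" where
  "word_dist G X g h = real (word_length G X (inv\<^bsub>G\<^esub> g \<otimes>\<^bsub>G\<^esub> h))"

definition gromov_product :: "('a \<Rightarrow> 'a \<Rightarrow> real) \<Rightarrow> 'a \<Rightarrow> 'a \<Rightarrow> 'a \<Rightarrow> real" where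
  "gromov_product d x y w = (d x w + d y w - d x y) / 2"

text \<open>Gromov's definition of a hyperbolic metric space. It makes sense for spaces that are not
  geodesic, so it applies to the group itself with its word metric.\<close>

definition gromov_hyperbolic :: "'a set \<Rightarrow> ('a \<Rightarrow> 'a \<Rightarrow> real) \<Rightarrow> bool" where
  "gromov_hyperbolic S d \<longleftrightarrow>
    (\<exists>\<delta>\<ge>0. \<forall>x\<in>S. \<forall>y\<in>S. \<forall>z\<in>S. \<forall>w\<in>S.
      gromov_product d x y w \<ge> min (gromov_product d x z w) (gromov_product d z y w) - \<delta>)"

definition hyperbolic_group :: "('a, 'b) monoid_scheme \<Rightarrow> bool" where
  "hyperbolic_group G \<longleftrightarrow>
    group G \<and> (\<exists>S. finite_generating_set G S \<and> gromov_hyperbolic (carrier G) (word_dist G S))"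

section \<open>Deterministic multitape Turing machines and the class P\<close>

text \<open>Tapes are infinite in both directions. The symbols \<open>Work i\<close> are auxiliary tape symbols; each
  machine uses only a finite set of symbols (\<open>tm_alphabet\<close>) and states (\<open>tm_states\<close>).\<close>

datatype 'c tape_symbol = Blank | Input 'c | Work nat

datatype direction = Go_Left | Stay | Go_Right

fun move_head :: "direction \<Rightarrow> int \<Rightarrow> int" where
  "move_head Go_Left i = i - 1"
| "move_head Stay i = i"
| "move_head Go_Right i = i + 1"

record 'c turing_machine =
  tm_tapes :: nat
  tm_states :: "nat set"
  tm_alphabet :: "'c tape_symbol set"
  tm_start :: nat
  tm_accept :: nat
  tm_reject :: nat
  tm_delta :: "nat \<Rightarrow> 'c tape_symbol list \<Rightarrow> nat \<times> ('c tape_symbol \<times> direction) list"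

definition turing_machine_over :: "'c set \<Rightarrow> 'c turing_machine \<Rightarrow> bool" where
  "turing_machine_over \<Sigma> M \<longleftrightarrow>
    tm_tapes M \<ge> 1 \<and> finite (tm_states M) \<and> finite (tm_alphabet M) \<and>
    Blank \<in> tm_alphabet M \<and> Input ` \<Sigma> \<subseteq> tm_alphabet M \<and>
    tm_start M \<in> tm_states M \<and> tm_accept M \<in> tm_states M \<and> tm_reject M \<in> tm_states M \<and>
    tm_accept M \<noteq> tm_reject M \<and>
    (\<forall>q \<in> tm_states M. \<forall>ss \<in> lists (tm_alphabet M). length ss = tm_tapes M \<longrightarrow>
      (case tm_delta M q ss of (q', as) \<Rightarrow>
        q' \<in> tm_states M \<and> length as = tm_tapes M \<and> fst ` set as \<subseteq> tm_alphabet M))"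

text \<open>A tape is its contents together with the position of its head.\<close>

type_synonym 'c tape = "(int \<Rightarrow> 'c tape_symbol) \<times> int"

type_synonym 'c config = "nat \<times> 'c tape list"

fun read_tape :: "'c tape \<Rightarrow> 'c tape_symbol" where
  "read_tape (f, i) = f i"

fun act_tape :: "'c tape_symbol \<times> direction \<Rightarrow> 'c tape \<Rightarrow> 'c tape" where
  "act_tape (s, a) (f, i) = (f(i := s), move_head a i)"

definition tm_halted :: "'c turing_machine \<Rightarrow> 'c config \<Rightarrow> bool" where
  "tm_halted M c \<longleftrightarrow> fst c \<in> {tm_accept M, tm_reject M}"

definition tm_step :: "'c turing_machine \<Rightarrow> 'c config \<Rightarrow> 'c config" where
  "tm_step M c =
    (if tm_halted M c then c
     else case tm_delta M (fst c) (map read_tape (snd c)) of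
       (q, as) \<Rightarrow> (q, map2 act_tape as (snd c)))"

definition blank_tape :: "'c tape" where
  "blank_tape = ((\<lambda>i. Blank), 0)"

definition input_tape :: "'c list \<Rightarrow> 'c tape" where
  "input_tape w =
    ((\<lambda>i. if 0 \<le> i \<and> i < int (length w) then Input (w ! nat i) else Blank), 0)"

definition tm_init :: "'c turing_machine \<Rightarrow> 'c list \<Rightarrow> 'c config" where
  "tm_init M w = (tm_start M, input_tape w # replicate (tm_tapes M - 1) blank_tape)"

definition tm_decides_in_time ::
  "'c set \<Rightarrow> 'c turing_machine \<Rightarrow> 'c list set \<Rightarrow> (nat \<Rightarrow> nat) \<Rightarrow> bool" where
  "tm_decides_in_time \<Sigma> M L T \<longleftrightarrow>
    (\<forall>w \<in> lists \<Sigma>. \<exists>t \<le> T (length w).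
      fst ((tm_step M ^^ t) (tm_init M w)) = (if w \<in> L then tm_accept M else tm_reject M))"

definition in_class_P :: "'c set \<Rightarrow> 'c list set \<Rightarrow> bool" where
  "in_class_P \<Sigma> L \<longleftrightarrow>
    L \<subseteq> lists \<Sigma> \<and>
    (\<exists>M (p :: nat poly). turing_machine_over \<Sigma> M \<and> tm_decides_in_time \<Sigma> M L (poly p))"

section \<open>The bounded knapsack problem\<close>

definition bkp_solvable ::
  "('a, 'b) monoid_scheme \<Rightarrow> 'a letter list list \<Rightarrow> 'a letter list \<Rightarrow> nat \<Rightarrow> bool" where
  "bkp_solvable G gs g m \<longleftrightarrow>
    (\<exists>es. length es = length gs \<and> set es \<subseteq> {0..m} \<and>
      word_val G g = group_prod G (map2 (\<lambda>u e. word_val G u [^]\<^bsub>G\<^esub> (e::nat)) gs es))"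

datatype 'a bkp_symbol = Letter "'a letter" | Sep | One

definition bkp_alphabet :: "'a set \<Rightarrow> 'a bkp_symbol set" where
  "bkp_alphabet X = Letter ` letters X \<union> {Sep, One}"

text \<open>An instance is written as \<open>g\<^sub>1 Sep \<dots> g\<^sub>k Sep g Sep One\<^sup>m\<close>.\<close>

definition bkp_encode ::
  "'a letter list list \<Rightarrow> 'a letter list \<Rightarrow> nat \<Rightarrow> 'a bkp_symbol list" where
  "bkp_encode gs g m = concat (map (\<lambda>u. map Letter u @ [Sep]) (gs @ [g])) @ replicate m One"

definition BKP :: "('a, 'b) monoid_scheme \<Rightarrow> 'a set \<Rightarrow> 'a bkp_symbol list set" where
  "BKP G X =
    {bkp_encode gs g m | gs g m.
      gs \<in> lists (lists (letters X)) \<and> g \<in> lists (letters X) \<and> bkp_solvable G gs g m}"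

lemma bkp_block_inject:
  "map Letter u @ Sep # r = map Letter v @ Sep # s \<longleftrightarrow> u = v \<and> r = s"
proof (induction u arbitrary: v)
  case Nil
  then show ?case by (cases v) auto
next
  case (Cons a u)
  then show ?case by (cases v) auto
qed

lemma bkp_blocks_inject:
  "concat (map (\<lambda>u. map Letter u @ [Sep]) us) @ replicate m One =
   concat (map (\<lambda>u. map Letter u @ [Sep]) vs) @ replicate n One \<Longrightarrow> us = vs \<and> m = n"
proof (induction us arbitrary: vs)
  case Nil
  have "Sep \<notin> set (concat (map (\<lambda>u. map Letter u @ [Sep]) vs) @ replicate n One)"
    unfolding Nil[symmetric] by simp
  then have "vs = []" by (cases vs) auto
  with Nil show ?case by (metis append_Nil concat.simps(1) length_replicate list.simps(8))
next
  case (Cons a us)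
  show ?case
  proof (cases vs)
    case Nil
    with Cons.prems have
      "replicate n One = concat (map (\<lambda>u. map Letter u @ [Sep]) (a # us)) @ replicate m One"
      by simp
    then have "Sep \<in> set (replicate n (One :: 'a bkp_symbol))"
      by (simp only: set_append) simp
    then show ?thesis by simp
  next
    case vs: (Cons b vs')
    from Cons.prems show ?thesis
      using Cons.IH[of vs'] by (simp add: vs bkp_block_inject)
  qed
qed

lemma bkp_encode_inject:
  "bkp_encode gs g m = bkp_encode hs h n \<longleftrightarrow> gs = hs \<and> g = h \<and> m = n"
proof
  assume "bkp_encode gs g m = bkp_encode hs h n"
  then show "gs = hs \<and> g = h \<and> m = n"
    using bkp_blocks_inject[of "gs @ [g]" m "hs @ [h]" n] unfolding bkp_encode_def by simp
qed simp

lemma bkp_encode_mem_BKP: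
  "bkp_encode gs g m \<in> BKP G X \<longleftrightarrow>
    gs \<in> lists (lists (letters X)) \<and> g \<in> lists (letters X) \<and> bkp_solvable G gs g m"
  unfolding BKP_def by (auto simp: bkp_encode_inject)

end

theory Submission imports Defs begin

text \<open>An instance of the problem is a path problem in a polynomial-size graph labelled by group
  elements: is there a path from a start node to an end node with trivial label? The label sequence
  of such a path is a closed path in the Cayley graph. A closed path of length \<open>T\<close> in a
  \<open>\<delta>\<close>-hyperbolic space has a triangulation whose chords have length \<open>O(log T)\<close>: split an interval at
  an interior point that is closest to the base point, and bound Gromov products along the interval
  by bisection. It therefore suffices to compute, by dynamic programming, all triples \<open>(v, v', u)\<close>
  where \<open>u\<close> is a word of logarithmic length that represents the label of some path from \<open>v\<close> to \<open>v'\<close>.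
  The words are kept short by Dehn's algorithm: a word that represents the identity and is geodesic
  on a bounded scale is empty, and in general a word that is geodesic on that scale is at most a
  constant factor, up to an additive constant, longer than the element that it represents.

  Short words are encoded as polynomially bounded numbers, so the dynamic program becomes a fixed
  Datalog program over an initial segment of the natural numbers. Its least fixpoint is computed
  in polynomial time by a Turing machine whose tapes are unary counters and truth tables.\<close>

section \<open>Structured tape programs\<close>

text \<open>The logarithm is the crux: over a finite alphabet there are only polynomially many words
  of length O(log n), so they fit into an initial segment of polynomial size, whereas the label of a
  path may be as long as the path. Short chords need not be spelled by geodesics. Local geodesics
  suffice, because they are reached by finitely many rewriting rules, which a fixed program can
  contain, and they cost only a constant factor in length. Unary exponents enter twice: the tail of
  the input serves as a counter of copies, and a solution gives a path of at most quadratic length.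
  Two generating sets occur. Instances are written over \<open>X\<close>, but hyperbolicity is given
  for some \<open>S\<close>; every input letter is therefore translated into a fixed geodesic word
  over \<open>S\<close>. The two directions are asymmetric. Every derivable fact is true by plain
  group theory, for any length of the segment; hyperbolicity is what guarantees that a solvable
  instance has a derivation in which all words stay short.\<close>

datatype 'c prog =
    Skip
  | Write nat "'c tape_symbol"
  | Copy nat nat
  | Move nat direction
  | Seq "'c prog" "'c prog" (infixr ";;" 65)
  | Branch nat "'c tape_symbol set" "'c prog" "'c prog"
  | Loop nat "'c tape_symbol set" "'c prog"

text \<open>Indexing by all naturals frees updates from side conditions; \<open>prog_wf K\<close>
  later confines a program to the \<open>K\<close> tapes that the machine has.\<close>

type_synonym 'c tapes = "nat \<Rightarrow> 'c tape"

definition write_tape :: "'c tape_symbol \<Rightarrow> 'c tape \<Rightarrow> 'c tape" where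
  "write_tape a x = ((fst x)(snd x := a), snd x)"

definition move_tape :: "direction \<Rightarrow> 'c tape \<Rightarrow> 'c tape" where
  "move_tape d x = (fst x, move_head d (snd x))"

text \<open>The time is the exact number of machine steps. Sequencing, tests and loop exits cost one
  step each, which the machine spends on rearranging its stack of continuations.\<close>

inductive run :: "'c prog \<Rightarrow> 'c tapes \<Rightarrow> nat \<Rightarrow> 'c tapes \<Rightarrow> bool" where
  Skip: "run Skip s 1 s"
| Write: "run (Write i a) s 1 (s(i := write_tape a (s i)))"
| Copy: "run (Copy i j) s 1 (s(i := write_tape (read_tape (s j)) (s i)))"
| Move: "run (Move i d) s 1 (s(i := move_tape d (s i)))"
| Seq: "run a s t s' \<Longrightarrow> run b s' t' s'' \<Longrightarrow> run (a ;; b) s (Suc (t + t')) s''"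
| BranchT: "read_tape (s i) \<in> P \<Longrightarrow> run a s t s' \<Longrightarrow> run (Branch i P a b) s (Suc t) s'"
| BranchF: "read_tape (s i) \<notin> P \<Longrightarrow> run b s t s' \<Longrightarrow> run (Branch i P a b) s (Suc t) s'"
| LoopT: "read_tape (s i) \<in> P \<Longrightarrow> run a s t s' \<Longrightarrow> run (Loop i P a) s' t' s'' \<Longrightarrow>
    run (Loop i P a) s (Suc (t + t')) s''"
| LoopF: "read_tape (s i) \<notin> P \<Longrightarrow> run (Loop i P a) s 1 s"

fun prog_wf :: "nat \<Rightarrow> 'c prog \<Rightarrow> bool" where
  "prog_wf K Skip = True"
| "prog_wf K (Write i a) = (i < K)"
| "prog_wf K (Copy i j) = (i < K \<and> j < K)"
| "prog_wf K (Move i d) = (i < K)"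
| "prog_wf K (a ;; b) = (prog_wf K a \<and> prog_wf K b)"
| "prog_wf K (Branch i P a b) = (i < K \<and> prog_wf K a \<and> prog_wf K b)"
| "prog_wf K (Loop i P a) = (i < K \<and> prog_wf K a)"

fun prog_syms :: "'c prog \<Rightarrow> 'c tape_symbol set" where
  "prog_syms (Write i a) = {a}"
| "prog_syms (a ;; b) = prog_syms a \<union> prog_syms b"
| "prog_syms (Branch i P a b) = prog_syms a \<union> prog_syms b"
| "prog_syms (Loop i P a) = prog_syms a"
| "prog_syms _ = {}"

text \<open>The control states of the machine are the possible continuations, i.e. stacks of programs that
  remain to be executed.\<close>

fun conts :: "'c prog \<Rightarrow> 'c prog list \<Rightarrow> 'c prog list set" where
  "conts (a ;; b) k = insert ((a ;; b) # k) (conts a (b # k) \<union> conts b k)"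
| "conts (Branch i P a b) k = insert (Branch i P a b # k) (conts a k \<union> conts b k)"
| "conts (Loop i P a) k = insert (Loop i P a # k) (conts a (Loop i P a # k))"
| "conts c k = {c # k}"

fun next_cont :: "'c prog \<Rightarrow> 'c prog list \<Rightarrow> (nat \<Rightarrow> 'c tape_symbol) \<Rightarrow> 'c prog list" where
  "next_cont (a ;; b) k r = a # b # k"
| "next_cont (Branch i P a b) k r = (if r i \<in> P then a # k else b # k)"
| "next_cont (Loop i P a) k r = (if r i \<in> P then a # Loop i P a # k else k)"
| "next_cont _ k r = k"

fun prog_acts ::
  "'c prog \<Rightarrow> (nat \<Rightarrow> 'c tape_symbol) \<Rightarrow> nat \<Rightarrow> 'c tape_symbol \<times> direction" where
  "prog_acts (Write i a) r = (\<lambda>j. (r j, Stay))(i := (a, Stay))"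
| "prog_acts (Copy i j) r = (\<lambda>j. (r j, Stay))(i := (r j, Stay))"
| "prog_acts (Move i d) r = (\<lambda>j. (r j, Stay))(i := (r i, d))"
| "prog_acts _ r = (\<lambda>j. (r j, Stay))"

lemma act_tape_stay: "act_tape (read_tape x, Stay) x = x"
  by (cases x) simp

lemma act_tape_write: "act_tape (a, Stay) x = write_tape a x"
  by (cases x) (simp add: write_tape_def)

lemma act_tape_move: "act_tape (read_tape x, d) x = move_tape d x"
  by (cases x) (simp add: move_tape_def)

lemma next_cont_cong:
  assumes "prog_wf K c" "\<And>i. i < K \<Longrightarrow> r i = r' i"
  shows "next_cont c k r = next_cont c k r'"
  using assms by (cases c) auto

lemma prog_acts_cong:
  assumes "prog_wf K c" "\<And>i. i < K \<Longrightarrow> r i = r' i" "i < K"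
  shows "prog_acts c r i = prog_acts c r' i"
  using assms by (cases c) auto

lemma conts_head: "c # k \<in> conts c k"
  by (cases c) auto

lemma finite_conts: "finite (conts c k)"
  by (induction c k rule: conts.induct) auto

lemma finite_prog_syms: "finite (prog_syms c)"
  by (induction c) auto

lemma conts_wf: "q \<in> conts c k \<Longrightarrow> prog_wf K c \<Longrightarrow> list_all (prog_wf K) k \<Longrightarrow>
    list_all (prog_wf K) q"
  by (induction c k rule: conts.induct) auto

lemma conts_syms: "q \<in> conts c k \<Longrightarrow> c' \<in> set q \<Longrightarrow>
    prog_syms c' \<subseteq> prog_syms c \<union> \<Union> (prog_syms ` set k)"
  by (induction c k rule: conts.induct) fastforce+

text \<open>A loop body is executed on top of the loop itself, so finishing the body returns to a
  stack already listed and stacks do not grow. This is why finitely many control states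
  suffice.\<close>

lemma conts_closed:
  "c' # k' \<in> conts c k \<Longrightarrow> next_cont c' k' r \<in> insert k (conts c k)"
proof (induction c k rule: conts.induct)
  case (1 a b k)
  then show ?case using conts_head[of a "b # k"] conts_head[of b k] by auto
next
  case (2 i P a b k)
  then show ?case using conts_head[of a k] conts_head[of b k] by auto
next
  case (3 i P a k)
  then show ?case using conts_head[of a "Loop i P a # k"] by (auto split: if_splits)
qed auto

section \<open>From programs to multitape Turing machines\<close>

locale prog_machine =
  fixes c :: "'c prog" and K :: nat and out :: nat and D :: "'c tape_symbol set"
    and A :: "'c tape_symbol set" and enc :: "'c prog list \<Rightarrow> nat"
  assumes wf: "prog_wf K c" and out: "out < K"
    and A: "finite A" "Blank \<in> A" "prog_syms c \<subseteq> A"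
    and enc: "inj_on enc (insert [] (conts c []))" "\<And>q. enc q > 1"
begin

abbreviation Q :: "'c prog list set" where "Q \<equiv> insert [] (conts c [])"

definition dec :: "nat \<Rightarrow> 'c prog list" where "dec = inv_into Q enc"

text \<open>States \<open>0\<close> and \<open>1\<close> are kept for acceptance and rejection,
  whence codes of continuations exceed \<open>1\<close>. The empty continuation means that the
  program has ended; the verdict is then read from tape \<open>out\<close>.\<close>

definition delta :: "nat \<Rightarrow> 'c tape_symbol list \<Rightarrow> nat \<times> ('c tape_symbol \<times> direction) list" where
  "delta q ss = (if q \<le> 1 then (q, map (\<lambda>a. (a, Stay)) ss) else
    (case dec q of
      [] \<Rightarrow> (if ss ! out \<in> D then 0 else 1, map (\<lambda>a. (a, Stay)) ss)
    | c' # k \<Rightarrow> (enc (next_cont c' k (\<lambda>i. ss ! i)), map (prog_acts c' (\<lambda>i. ss ! i)) [0..<K])))"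

definition machine :: "'c turing_machine" where
  "machine = \<lparr>tm_tapes = K, tm_states = {0, 1} \<union> enc ` Q, tm_alphabet = A,
    tm_start = enc [c], tm_accept = 0, tm_reject = 1, tm_delta = delta\<rparr>"

lemma dec_enc: "q \<in> Q \<Longrightarrow> dec (enc q) = q"
  unfolding dec_def by (rule inv_into_f_f[OF enc(1)])

lemma Q_next: "c' # k \<in> Q \<Longrightarrow> next_cont c' k r \<in> Q"
  using conts_closed by blast

lemma Q_wf: "q \<in> Q \<Longrightarrow> list_all (prog_wf K) q"
  using conts_wf[of q c "[]" K] wf by auto

lemma machine_over:
  assumes "Input ` \<Sigma> \<subseteq> A"
  shows "turing_machine_over \<Sigma> machine"
proof -
  have "case delta q ss of (q', as) \<Rightarrow>
      q' \<in> {0, 1} \<union> enc ` Q \<and> length as = K \<and> fst ` set as \<subseteq> A"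
    if q: "q \<in> {0, 1} \<union> enc ` Q" and ss: "ss \<in> lists A" "length ss = K" for q ss
  proof (cases "q \<le> 1")
    case True
    with that show ?thesis by (auto simp: delta_def)
  next
    case False
    then obtain x where x: "q = enc x" "x \<in> Q" using q by auto
    show ?thesis
    proof (cases x)
      case Nil
      with x ss False show ?thesis by (auto simp: delta_def dec_enc)
    next
      case (Cons c' k)
      then have "c' # k \<in> conts c []" using x by auto
      then have "prog_syms c' \<subseteq> A" "prog_wf K c'"
        using A conts_syms[of "c' # k" c "[]" c'] Q_wf[of x] x Cons by auto
      then have "fst (prog_acts c' (\<lambda>i. ss ! i) i) \<in> A" if "i < K" for i
        using that ss by (cases c') (auto simp: in_lists_conv_set)
      moreover have "enc (next_cont c' k r) \<in> enc ` Q" for r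
        using Q_next[of c' k] x Cons by blast
      ultimately show ?thesis using x ss False Cons
        by (auto simp: delta_def dec_enc simp del: insert_iff image_insert)
    qed
  qed
  moreover have "finite (enc ` Q)" using finite_conts by auto
  moreover have "enc [c] \<in> enc ` Q" using conts_head by auto
  moreover have "K \<ge> 1" using out by auto
  ultimately show ?thesis using assms A
    unfolding turing_machine_over_def machine_def by (auto simp del: insert_iff Un_iff)
qed

lemma map2_act: "map2 act_tape (map f [0..<K]) (map s [0..<K]) = map (\<lambda>i. act_tape (f i) (s i)) [0..<K]"
  by (simp add: map2_map_map)

lemma machine_step:
  assumes "c' # k \<in> Q"
  shows "tm_step machine (enc (c' # k), map s [0..<K]) =
    (enc (next_cont c' k (\<lambda>i. read_tape (s i))),
     map (\<lambda>i. act_tape (prog_acts c' (\<lambda>i. read_tape (s i)) i) (s i)) [0..<K])"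
proof -
  let ?r = "\<lambda>i. map read_tape (map s [0..<K]) ! i"
  have r: "?r i = read_tape (s i)" if "i < K" for i using that by simp
  have w: "prog_wf K c'" using Q_wf[OF assms] by simp
  have q: "\<not> enc (c' # k) \<le> 1" "enc (c' # k) \<noteq> 0" "enc (c' # k) \<noteq> Suc 0"
    using enc(2)[of "c' # k"] by auto
  have "tm_step machine (enc (c' # k), map s [0..<K]) =
    (enc (next_cont c' k ?r), map2 act_tape (map (prog_acts c' ?r) [0..<K]) (map s [0..<K]))"
    using q assms by (simp add: tm_step_def tm_halted_def machine_def delta_def dec_enc)
  also have "next_cont c' k ?r = next_cont c' k (\<lambda>i. read_tape (s i))"
    by (rule next_cont_cong[OF w r])
  also have "map2 act_tape (map (prog_acts c' ?r) [0..<K]) (map s [0..<K]) =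
      map (\<lambda>i. act_tape (prog_acts c' ?r i) (s i)) [0..<K]"
    by (rule map2_act)
  also have "\<dots> = map (\<lambda>i. act_tape (prog_acts c' (\<lambda>i. read_tape (s i)) i) (s i)) [0..<K]"
    using prog_acts_cong[OF w r] by simp
  finally show ?thesis .
qed

text \<open>The stack \<open>k\<close> is arbitrary because, in the induction on the run, a
  subprogram is executed on top of the work that remains.\<close>

lemma machine_run:
  "run c' s t s' \<Longrightarrow> conts c' k \<subseteq> Q \<Longrightarrow> k \<in> Q \<Longrightarrow>
    (tm_step machine ^^ t) (enc (c' # k), map s [0..<K]) = (enc k, map s' [0..<K])"
proof (induction arbitrary: k rule: run.induct)
  case (Skip s)
  then show ?case by (simp add: machine_step act_tape_stay del: insert_iff)
next
  case (Write i a s)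
  then show ?case
    by (simp add: machine_step del: insert_iff)
      (auto simp: act_tape_stay act_tape_write[of a])
next
  case (Copy i j s)
  then show ?case
    by (simp add: machine_step del: insert_iff)
      (auto simp: act_tape_stay act_tape_write[of "read_tape (s j)"])
next
  case (Move i d s)
  then show ?case
    by (simp add: machine_step del: insert_iff)
      (auto simp: act_tape_stay act_tape_move[of _ d])
next
  case (Seq a s t s' b t' s'')
  have bk: "b # k \<in> Q" using Seq.prems conts_head[of b k] by auto
  have 1: "(tm_step machine ^^ t) (enc (a # b # k), map s [0..<K]) = (enc (b # k), map s' [0..<K])"
    using Seq.IH(1)[of "b # k"] Seq.prems bk by simp
  have 2: "(tm_step machine ^^ t') (enc (b # k), map s' [0..<K]) = (enc k, map s'' [0..<K])"
    using Seq.IH(2)[of k] Seq.prems by simp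
  have "(a ;; b) # k \<in> Q" using Seq.prems by simp
  then have "tm_step machine (enc ((a ;; b) # k), map s [0..<K]) = (enc (a # b # k), map s [0..<K])"
    by (simp add: machine_step act_tape_stay del: insert_iff)
  then show ?case using 1 2
    by (simp add: add.commute[of t t'] funpow_Suc_right funpow_add del: funpow.simps(2))
next
  case (BranchT s i P a t s' b)
  have "Branch i P a b # k \<in> Q" using BranchT.prems by simp
  then show ?case using BranchT
    by (simp add: machine_step act_tape_stay funpow_Suc_right del: insert_iff funpow.simps(2))
next
  case (BranchF s i P b t s' a)
  have "Branch i P a b # k \<in> Q" using BranchF.prems by simp
  then show ?case using BranchF
    by (simp add: machine_step act_tape_stay funpow_Suc_right del: insert_iff funpow.simps(2))
next
  case (LoopT s i P a t s' t' s'')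
  let ?W = "Loop i P a"
  have q: "?W # k \<in> Q" using LoopT.prems by simp
  have 1: "(tm_step machine ^^ t) (enc (a # ?W # k), map s [0..<K]) = (enc (?W # k), map s' [0..<K])"
    using LoopT.IH(1)[of "?W # k"] LoopT.prems q by simp
  have 2: "(tm_step machine ^^ t') (enc (?W # k), map s' [0..<K]) = (enc k, map s'' [0..<K])"
    using LoopT.IH(2)[of k] LoopT.prems by simp
  have "tm_step machine (enc (?W # k), map s [0..<K]) = (enc (a # ?W # k), map s [0..<K])"
    using q LoopT.hyps by (simp add: machine_step act_tape_stay del: insert_iff)
  then show ?case using 1 2
    by (simp add: add.commute[of t t'] funpow_Suc_right funpow_add del: funpow.simps(2))
next
  case (LoopF s i P a)
  have "Loop i P a # k \<in> Q" using LoopF.prems by simp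
  then show ?case using LoopF by (simp add: machine_step act_tape_stay del: insert_iff)
qed

lemma machine_decides:
  assumes "run c s t s'"
  shows "fst ((tm_step machine ^^ Suc t) (enc [c], map s [0..<K])) =
    (if read_tape (s' out) \<in> D then 0 else 1)"
proof -
  have "(tm_step machine ^^ t) (enc [c], map s [0..<K]) = (enc [], map s' [0..<K])"
    by (rule machine_run[OF assms]) auto
  then have "(tm_step machine ^^ Suc t) (enc [c], map s [0..<K]) =
    tm_step machine (enc [], map s' [0..<K])" by simp
  moreover have "\<not> enc [] \<le> 1" "enc [] \<noteq> 0" "enc [] \<noteq> Suc 0" using enc(2)[of "[]"] by auto
  ultimately show ?thesis
    using out by (simp add: tm_step_def tm_halted_def machine_def delta_def dec_enc)
qed

end

definition init_tapes :: "'c list \<Rightarrow> 'c tapes" where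
  "init_tapes w i = (if i = 0 then input_tape w else blank_tape)"

lemma prog_in_class_P:
  fixes c :: "'c prog" and p :: "nat poly"
  assumes "finite \<Sigma>" "L \<subseteq> lists \<Sigma>" "prog_wf K c" "out < K"
    and "\<And>w. w \<in> lists \<Sigma> \<Longrightarrow> \<exists>t \<le> poly p (length w). \<exists>s. run c (init_tapes w) t s \<and>
      (read_tape (s out) \<in> D \<longleftrightarrow> w \<in> L)"
  shows "in_class_P \<Sigma> L"
proof -
  have "finite (insert [] (conts c []))" using finite_conts by auto
  then obtain f :: "'c prog list \<Rightarrow> nat" where f: "inj_on f (insert [] (conts c []))"
    using finite_imp_inj_to_nat_seg by blast
  interpret prog_machine c K out D "insert Blank (Input ` \<Sigma> \<union> prog_syms c)" "\<lambda>q. Suc (Suc (f q))"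
    using assms finite_prog_syms f by unfold_locales (auto simp: inj_on_def)
  have init: "tm_init machine w = (Suc (Suc (f [c])), map (init_tapes w) [0..<K])" for w
  proof -
    have "map (init_tapes w) [0..<K] = init_tapes w 0 # map (init_tapes w) [Suc 0..<K]"
      using out by (simp add: upt_conv_Cons)
    moreover have "map (init_tapes w) [Suc 0..<K] = replicate (K - 1) blank_tape"
      by (rule nth_equalityI) (auto simp: init_tapes_def)
    ultimately show ?thesis by (simp add: tm_init_def machine_def init_tapes_def)
  qed
  \<comment> \<open>The extra unit pays for the last step, from the empty continuation to a halting
    state.\<close>
  have "tm_decides_in_time \<Sigma> machine L (poly (p + 1))"
    unfolding tm_decides_in_time_def
  proof
    fix w assume "w \<in> lists \<Sigma>"
    then obtain t s where t: "t \<le> poly p (length w)" "run c (init_tapes w) t s"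
      and s: "read_tape (s out) \<in> D \<longleftrightarrow> w \<in> L" using assms(5) by blast
    have "fst ((tm_step machine ^^ Suc t) (tm_init machine w)) =
        (if w \<in> L then tm_accept machine else tm_reject machine)"
      using machine_decides[OF t(2)] s unfolding init by (simp add: machine_def del: funpow.simps)
    then show "\<exists>t\<le>poly (p + 1) (length w). fst ((tm_step machine ^^ t) (tm_init machine w)) =
        (if w \<in> L then tm_accept machine else tm_reject machine)"
      using t(1) by (intro exI[of _ "Suc t"]) simp
  qed
  moreover have "turing_machine_over \<Sigma> machine" by (rule machine_over) auto
  ultimately show ?thesis using assms(2) unfolding in_class_P_def by blast
qed

section \<open>Timed Hoare triples\<close>

text \<open>Total correctness with a time bound. Existence of a run is all that is asked, since
  \<open>machine_decides\<close> turns any run into a computation of the machine.\<close>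

definition hoare ::
  "nat \<Rightarrow> ('c tapes \<Rightarrow> bool) \<Rightarrow> 'c prog \<Rightarrow> ('c tapes \<Rightarrow> bool) \<Rightarrow> bool" where
  "hoare B P c Q \<longleftrightarrow> (\<forall>s. P s \<longrightarrow> (\<exists>t s'. t \<le> B \<and> run c s t s' \<and> Q s'))"

definition runs :: "nat \<Rightarrow> 'c prog \<Rightarrow> 'c tapes \<Rightarrow> 'c tapes \<Rightarrow> bool" where
  "runs B c s s' \<longleftrightarrow> (\<exists>t\<le>B. run c s t s')"

lemma hoareI: "(\<And>s. P s \<Longrightarrow> \<exists>s'. runs B c s s' \<and> Q s') \<Longrightarrow> hoare B P c Q"
  unfolding hoare_def runs_def by blast

lemma hoareD: "hoare B P c Q \<Longrightarrow> P s \<Longrightarrow> \<exists>s'. runs B c s s' \<and> Q s'"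
  unfolding hoare_def runs_def by blast

lemma hoare_conseq:
  "hoare B P c Q \<Longrightarrow> (\<And>s. P' s \<Longrightarrow> P s) \<Longrightarrow> (\<And>s. Q s \<Longrightarrow> Q' s) \<Longrightarrow> B \<le> B' \<Longrightarrow> hoare B' P' c Q'"
  unfolding hoare_def by (meson order_trans)

lemma hoare_seq:
  assumes "hoare B1 P a Q" "hoare B2 Q b R"
  shows "hoare (Suc (B1 + B2)) P (a ;; b) R"
  unfolding hoare_def
proof (intro allI impI)
  fix s assume "P s"
  then obtain t s' where 1: "t \<le> B1" "run a s t s'" "Q s'" using assms(1) unfolding hoare_def by blast
  then obtain t' s'' where 2: "t' \<le> B2" "run b s' t' s''" "R s''"
    using assms(2) unfolding hoare_def by blast
  from run.Seq[OF 1(2) 2(2)] 1 2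
  show "\<exists>t s'. t \<le> Suc (B1 + B2) \<and> run (a ;; b) s t s' \<and> R s'"
    by (intro exI[of _ "Suc (t + t')"] exI[of _ s'']) auto
qed

text \<open>The number of rounds is fixed in advance by the index of the invariant. The induction is
  on the rounds still to come, because a run of a loop is built from its first round
  onwards.\<close>

lemma hoare_loop:
  assumes body: "\<And>j. j < n \<Longrightarrow> hoare B (I j) a (I (Suc j))"
    and "\<And>j s. j < n \<Longrightarrow> I j s \<Longrightarrow> read_tape (s i) \<in> P"
    and "\<And>s. I n s \<Longrightarrow> read_tape (s i) \<notin> P"
  shows "hoare (n * Suc B + 1) (I 0) (Loop i P a) (I n)"
proof -
  have "k \<le> n \<Longrightarrow> hoare (k * Suc B + 1) (I (n - k)) (Loop i P a) (I n)" for k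
  proof (induction k)
    case 0
    then show ?case using assms(3) run.LoopF unfolding hoare_def by fastforce
  next
    case (Suc k)
    show ?case unfolding hoare_def
    proof (intro allI impI)
      fix s assume s: "I (n - Suc k) s"
      have lt: "n - Suc k < n" and eq: "Suc (n - Suc k) = n - k" using Suc.prems by auto
      obtain t s' where 1: "t \<le> B" "run a s t s'" "I (n - k) s'"
        using body[OF lt] s unfolding hoare_def eq by blast
      obtain t' s'' where 2: "t' \<le> k * Suc B + 1" "run (Loop i P a) s' t' s''" "I n s''"
        using Suc 1(3) unfolding hoare_def by fastforce
      from run.LoopT[OF assms(2)[OF lt s] 1(2) 2(2)] 1 2
      show "\<exists>t s'. t \<le> Suc k * Suc B + 1 \<and> run (Loop i P a) s t s' \<and> I n s'"
        by (intro exI[of _ "Suc (t + t')"] exI[of _ s'']) auto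
    qed
  qed
  from this[of n] show ?thesis by simp
qed

lemma runs_hoare: "runs B c s s' \<longleftrightarrow> hoare B ((=) s) c ((=) s')"
  unfolding hoare_def runs_def by blast

lemma runs_eq: "runs B c s s' \<Longrightarrow> s' = s'' \<Longrightarrow> runs B c s s''"
  by simp

lemma runs_mono: "runs B c s s' \<Longrightarrow> B \<le> B' \<Longrightarrow> runs B' c s s'"
  unfolding runs_def by (meson order_trans)

lemma runs_seq: "runs B1 a s s' \<Longrightarrow> runs B2 b s' s'' \<Longrightarrow> runs (Suc (B1 + B2)) (a ;; b) s s''"
  unfolding runs_hoare by (rule hoare_seq)

lemma runs_Skip: "runs 1 Skip s s"
  unfolding runs_def by (blast intro: run.Skip)

lemma runs_Write: "runs 1 (Write i a) s (s(i := write_tape a (s i)))"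
  unfolding runs_def by (blast intro: run.Write)

lemma runs_Copy: "runs 1 (Copy i j) s (s(i := write_tape (read_tape (s j)) (s i)))"
  unfolding runs_def by (blast intro: run.Copy)

lemma runs_Move: "runs 1 (Move i d) s (s(i := move_tape d (s i)))"
  unfolding runs_def by (blast intro: run.Move)

lemma runs_BranchT: "read_tape (s i) \<in> A \<Longrightarrow> runs B a s s' \<Longrightarrow> runs (Suc B) (Branch i A a b) s s'"
  unfolding runs_def by (meson Suc_le_mono run.BranchT)

lemma runs_BranchF: "read_tape (s i) \<notin> A \<Longrightarrow> runs B b s s' \<Longrightarrow> runs (Suc B) (Branch i A a b) s s'"
  unfolding runs_def by (meson Suc_le_mono run.BranchF)

lemma runs_loop:
  assumes "\<And>j. j < n \<Longrightarrow> runs B a (S j) (S (Suc j))"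
    and "\<And>j. j < n \<Longrightarrow> read_tape (S j i) \<in> P" and "read_tape (S n i) \<notin> P"
  shows "runs (n * Suc B + 1) (Loop i P a) (S 0) (S n)"
  unfolding runs_hoare
  by (rule hoare_loop[where I = "\<lambda>j. (=) (S j)"]) (use assms in \<open>auto simp flip: runs_hoare\<close>)

section \<open>Rulers and bounded loops\<close>

text \<open>A ruler is a tape with \<open>M\<close> nonblank cells, the first of which contain the input word; a
  number \<open>x < M\<close> is stored as the head position \<open>x\<close>, and an unused ruler has its head at \<open>-1\<close>.\<close>

definition content :: "'c list \<Rightarrow> nat \<Rightarrow> int \<Rightarrow> 'c tape_symbol" where
  "content w M i = (if 0 \<le> i \<and> i < int M then
     (if i < int (length w) then Input (w ! nat i) else Work 0) else Blank)"

definition ruler :: "'c list \<Rightarrow> nat \<Rightarrow> int \<Rightarrow> 'c tape" where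
  "ruler w M x = (content w M, x)"

definition shift :: "int \<Rightarrow> 'c tape \<Rightarrow> 'c tape" where
  "shift n x = (fst x, snd x + n)"

abbreviation nonblank :: "'c tape_symbol set" where "nonblank \<equiv> - {Blank}"

lemma read_ruler: "read_tape (ruler w M x) \<in> nonblank \<longleftrightarrow> 0 \<le> x \<and> x < int M"
  by (auto simp: ruler_def content_def)

lemma read_ruler_blank: "read_tape (ruler w M x) = Blank \<longleftrightarrow> \<not> (0 \<le> x \<and> x < int M)"
  by (auto simp: ruler_def content_def)

lemma move_ruler [simp]:
  "move_tape Go_Right (ruler w M x) = ruler w M (x + 1)"
  "move_tape Go_Left (ruler w M x) = ruler w M (x - 1)"
  by (auto simp: ruler_def move_tape_def)

lemma shift_ruler [simp]: "shift n (ruler w M x) = ruler w M (x + n)"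
  by (simp add: shift_def ruler_def)

lemma shift_shift [simp]: "shift m (shift n x) = shift (n + m) x"
  by (simp add: shift_def)

lemma shift_0 [simp]: "shift 0 x = x"
  by (simp add: shift_def)

fun dir_int :: "direction \<Rightarrow> int" where
  "dir_int Go_Left = -1"
| "dir_int Stay = 0"
| "dir_int Go_Right = 1"

lemma move_tape_shift: "move_tape d x = shift (dir_int d) x"
  by (cases d) (auto simp: move_tape_def shift_def)

definition rewind :: "nat \<Rightarrow> 'c prog" where
  "rewind i = Move i Go_Left ;; Loop i nonblank (Move i Go_Left)"

lemma runs_rewind:
  assumes "s x = ruler w M (int M)"
  shows "runs (2 * M + 3) (rewind x) s (s(x := ruler w M (-1)))"
proof -
  let ?S = "\<lambda>j. s(x := ruler w M (int M - 1 - int j))"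
  have 1: "runs 1 (Move x Go_Left) s (?S 0)"
    using runs_Move[of x Go_Left s] assms by simp
  have "runs (M * Suc 1 + 1) (Loop x nonblank (Move x Go_Left)) (?S 0) (?S M)"
  proof (rule runs_loop)
    fix j assume j: "j < M"
    show "runs 1 (Move x Go_Left) (?S j) (?S (Suc j))"
      using runs_Move[of x Go_Left "?S j"] by (simp add: algebra_simps)
  qed (auto simp: read_ruler read_ruler_blank)
  from runs_mono[OF runs_seq[OF 1 this], of "2 * M + 3"] show ?thesis
    unfolding rewind_def by simp
qed

text \<open>The head stands at \<open>-1\<close> both on entry and on exit, so an inner loop is
  ready for reuse in the next round of an outer one.\<close>

definition For :: "nat \<Rightarrow> 'c prog \<Rightarrow> 'c prog" where
  "For x c = Move x Go_Right ;; Loop x nonblank (c ;; Move x Go_Right) ;; rewind x"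

lemma hoare_Move:
  assumes "\<And>s. P s \<Longrightarrow> Q (s(i := move_tape d (s i)))"
  shows "hoare 1 P (Move i d) Q"
  by (rule hoareI) (use assms runs_Move in blast)

text \<open>By \<open>ins\<close> the invariant does not look at the loop ruler, whose head moves
  between rounds; the body must return that ruler to where it found it.\<close>

lemma hoare_For:
  assumes body: "\<And>j. j < M \<Longrightarrow> hoare B (\<lambda>s. s x = ruler w M (int j) \<and> I j s) c
      (\<lambda>s. s x = ruler w M (int j) \<and> I (Suc j) s)"
    and ins: "\<And>j s v. I j s \<Longrightarrow> I j (s(x := v))"
  shows "hoare (M * (B + 5) + 8) (\<lambda>s. s x = ruler w M (-1) \<and> I 0 s) (For x c)
     (\<lambda>s. s x = ruler w M (-1) \<and> I M s)"
proof -
  let ?J = "\<lambda>j s. s x = ruler w M (int j) \<and> I j s"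
  have 1: "hoare 1 (\<lambda>s. s x = ruler w M (-1) \<and> I 0 s) (Move x Go_Right) (?J 0)"
    by (rule hoare_Move) (auto intro: ins)
  have "hoare (M * Suc (Suc (B + 1)) + 1) (?J 0) (Loop x nonblank (c ;; Move x Go_Right)) (?J M)"
  proof (rule hoare_loop)
    fix j assume "j < M"
    show "hoare (Suc (B + 1)) (?J j) (c ;; Move x Go_Right) (?J (Suc j))"
      by (rule hoare_seq[OF body[OF \<open>j < M\<close>]], rule hoare_Move) (auto intro: ins simp: add.commute)
  qed (auto simp: read_ruler read_ruler_blank)
  moreover have "hoare (2 * M + 3) (?J M) (rewind x) (\<lambda>s. s x = ruler w M (-1) \<and> I M s)"
    by (rule hoareI, intro exI conjI, rule runs_rewind) (auto intro: ins)
  ultimately have "hoare (Suc (1 + Suc (M * Suc (Suc (B + 1)) + 1 + (2 * M + 3))))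
      (\<lambda>s. s x = ruler w M (-1) \<and> I 0 s) (For x c) (\<lambda>s. s x = ruler w M (-1) \<and> I M s)"
    unfolding For_def by (intro hoare_seq[OF 1] hoare_seq)
  then show ?thesis by (rule hoare_conseq) (auto simp: algebra_simps)
qed

fun nest :: "nat list \<Rightarrow> 'c prog \<Rightarrow> 'c prog" where
  "nest [] c = c"
| "nest (x # xs) c = For x (nest xs c)"

fun nestB :: "nat \<Rightarrow> nat \<Rightarrow> nat \<Rightarrow> nat" where
  "nestB M 0 B = B"
| "nestB M (Suc k) B = M * (nestB M k B + 5) + 8"

text \<open>Nested loops form an odometer, a device for counting to a power of \<open>M\<close>. The
  body is assumed correct for every \<open>f\<close>, because the heads of the outer rulers vary
  while the inner loops run.\<close>

lemma hoare_nest_count: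
  assumes body: "\<And>j f. hoare B (\<lambda>s. (\<forall>x\<in>X. s x = f x) \<and> I j s) c
      (\<lambda>s. (\<forall>x\<in>X. s x = f x) \<and> I (Suc j) s)"
    and ins: "\<And>j s v x. x \<in> X \<Longrightarrow> I j s \<Longrightarrow> I j (s(x := v))"
    and "distinct xs" "set xs \<subseteq> X" "\<And>x. x \<in> set xs \<Longrightarrow> f x = ruler w M (-1)"
  shows "hoare (nestB M (length xs) B) (\<lambda>s. (\<forall>x\<in>X. s x = f x) \<and> I j s) (nest xs c)
    (\<lambda>s. (\<forall>x\<in>X. s x = f x) \<and> I (j + M ^ length xs) s)"
  using assms(3-5)
proof (induction xs arbitrary: j f)
  case Nil
  then show ?case using body[of f j] by simp
next
  case (Cons x xs)
  let ?I = "\<lambda>i s. (\<forall>y\<in>X - {x}. s y = f y) \<and> I (j + i * M ^ length xs) s"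
  have X: "(\<forall>y\<in>X. s y = (f(x := v)) y) \<longleftrightarrow> s x = v \<and> (\<forall>y\<in>X - {x}. s y = f y)" for s v
    using Cons.prems by (auto split: if_splits)
  have X': "(\<forall>y\<in>X. s y = f y) \<longleftrightarrow> s x = ruler w M (-1) \<and> (\<forall>y\<in>X - {x}. s y = f y)" for s
    using Cons.prems(2,3) by auto
  have "hoare (M * (nestB M (length xs) B + 5) + 8) (\<lambda>s. s x = ruler w M (-1) \<and> ?I 0 s)
      (For x (nest xs c)) (\<lambda>s. s x = ruler w M (-1) \<and> ?I M s)"
  proof (rule hoare_For)
    fix i assume "i < M"
    show "hoare (nestB M (length xs) B) (\<lambda>s. s x = ruler w M (int i) \<and> ?I i s) (nest xs c)
        (\<lambda>s. s x = ruler w M (int i) \<and> ?I (Suc i) s)"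
    proof -
      have "\<And>y. y \<in> set xs \<Longrightarrow> (f(x := ruler w M (int i))) y = ruler w M (-1)"
        using Cons.prems by auto
      from Cons.IH[where f = "f(x := ruler w M (int i))" and j = "j + i * M ^ length xs",
        OF _ _ this] Cons.prems(1,2)
      show ?thesis unfolding X by (simp add: algebra_simps)
    qed
  next
    fix i s v assume "?I i s"
    then show "?I i (s(x := v))" using Cons.prems ins by auto
  qed
  then show ?case unfolding X' by simp
qed

text \<open>Here \<open>I D\<close> says that all assignments in \<open>D\<close> have been visited.\<close>

lemma hoare_nest_all:
  assumes body: "\<And>\<sigma> f D. (\<And>x. x \<in> X \<Longrightarrow> \<sigma> x < M) \<Longrightarrow>
      hoare B (\<lambda>s. (\<forall>x\<in>X. s x = ruler w M (int (\<sigma> x))) \<and> I D s) c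
      (\<lambda>s. (\<forall>x\<in>X. s x = ruler w M (int (\<sigma> x))) \<and> I (insert \<sigma> D) s)"
    and ins: "\<And>D s v x. x \<in> X \<Longrightarrow> I D s \<Longrightarrow> I D (s(x := v))"
    and mono: "\<And>D D' s. I D s \<Longrightarrow> D' \<subseteq> D \<Longrightarrow> I D' s"
    and "distinct xs" "set xs \<subseteq> X" "\<And>x. x \<in> X - set xs \<Longrightarrow> \<sigma> x < M"
  shows "hoare (nestB M (length xs) B)
    (\<lambda>s. (\<forall>x\<in>X. s x = ruler w M (if x \<in> set xs then -1 else int (\<sigma> x))) \<and> I D s) (nest xs c)
    (\<lambda>s. (\<forall>x\<in>X. s x = ruler w M (if x \<in> set xs then -1 else int (\<sigma> x))) \<and>
      I (D \<union> {\<tau>. (\<forall>x. x \<notin> set xs \<longrightarrow> \<tau> x = \<sigma> x) \<and> (\<forall>x\<in>set xs. \<tau> x < M)}) s)"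
  using assms(4-6)
proof (induction xs arbitrary: D \<sigma>)
  case Nil
  have "{\<tau>. \<forall>x. \<tau> x = \<sigma> x} = {\<sigma>}" by auto
  then show ?case using body[of \<sigma> D] Nil by simp
next
  case (Cons x xs)
  let ?f = "\<lambda>y. ruler w M (if y \<in> set (x # xs) then -1 else int (\<sigma> y))"
  \<comment> \<open>The assignments already visited when the outer loop enters round
    \<open>i\<close>: their value at \<open>x\<close> is below \<open>i\<close>.\<close>
  let ?A = "\<lambda>i. {\<tau>. (\<forall>y. y \<notin> set (x # xs) \<longrightarrow> \<tau> y = \<sigma> y) \<and> (\<forall>y\<in>set xs. \<tau> y < M) \<and> \<tau> x < i}"
  let ?I = "\<lambda>i s. (\<forall>y\<in>X - {x}. s y = ?f y) \<and> I (D \<union> ?A i) s"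
  have x: "x \<notin> set xs" "x \<in> X" using Cons.prems by auto
  have X: "(\<forall>y\<in>X. s y = ruler w M (if y \<in> set xs then -1 else int ((\<sigma>(x := i)) y))) \<longleftrightarrow>
      s x = ruler w M (int i) \<and> (\<forall>y\<in>X - {x}. s y = ?f y)" for s i
    using x by (auto split: if_splits)
  have X': "(\<forall>y\<in>X. s y = ?f y) \<longleftrightarrow> s x = ruler w M (-1) \<and> (\<forall>y\<in>X - {x}. s y = ?f y)" for s
    using x by auto
  have "hoare (M * (nestB M (length xs) B + 5) + 8) (\<lambda>s. s x = ruler w M (-1) \<and> ?I 0 s)
      (For x (nest xs c)) (\<lambda>s. s x = ruler w M (-1) \<and> ?I M s)"
  proof (rule hoare_For)
    fix i assume i: "i < M"
    let ?D = "{\<tau>. (\<forall>y. y \<notin> set xs \<longrightarrow> \<tau> y = (\<sigma>(x := i)) y) \<and> (\<forall>x\<in>set xs. \<tau> x < M)}"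
    have "?A (Suc i) \<subseteq> ?A i \<union> ?D" using x by (auto simp: less_Suc_eq)
    then have D: "I (D \<union> ?A (Suc i)) s" if "I (D \<union> ?A i \<union> ?D) s" for s
      by (intro mono[OF that]) blast
    have "hoare (nestB M (length xs) B)
      (\<lambda>s. (s x = ruler w M (int i) \<and> (\<forall>y\<in>X - {x}. s y = ?f y)) \<and> I (D \<union> ?A i) s) (nest xs c)
      (\<lambda>s. (s x = ruler w M (int i) \<and> (\<forall>y\<in>X - {x}. s y = ?f y)) \<and> I (D \<union> ?A i \<union> ?D) s)"
      unfolding X[symmetric] using Cons.prems i by (intro Cons.IH) auto
    then show "hoare (nestB M (length xs) B) (\<lambda>s. s x = ruler w M (int i) \<and> ?I i s) (nest xs c)
        (\<lambda>s. s x = ruler w M (int i) \<and> ?I (Suc i) s)"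
      by (rule hoare_conseq) (use D in blast)+
  next
    fix i s v assume "?I i s"
    then show "?I i (s(x := v))" using Cons.prems ins[of x _ s v] by auto
  qed
  moreover have "{\<tau>. (\<forall>y. y \<notin> set (x # xs) \<longrightarrow> \<tau> y = \<sigma> y) \<and> (\<forall>y\<in>set (x # xs). \<tau> y < M)} = ?A M"
    by auto
  moreover have "?A 0 = {}" by simp
  ultimately show ?case unfolding X' by simp
qed

section \<open>Counters and seeking\<close>

text \<open>Runs \<open>c\<close> as often as the number on ruler \<open>x\<close> says. Counting
  down destroys that number, so ruler \<open>d\<close> counts along and the second loop moves the
  value back. The initial move to the left leaves exactly \<open>k\<close> nonblank cells ahead of a
  head that stood at \<open>k\<close>.\<close>

definition walk :: "nat \<Rightarrow> nat \<Rightarrow> 'c prog \<Rightarrow> 'c prog" where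
  "walk x d c = Move x Go_Left ;; Loop x nonblank (Move x Go_Left ;; Move d Go_Right ;; c) ;;
     Loop d nonblank (Move d Go_Left ;; Move x Go_Right) ;; Move x Go_Right"

definition walkB :: "nat \<Rightarrow> nat \<Rightarrow> nat" where
  "walkB M B = M * (B + 10) + 10"

lemma runs_walk:
  assumes x: "s x = ruler w M (int k)" "k < M" and d: "s d = ruler w M (-1)"
    and ne: "x \<noteq> d" "y \<noteq> x" "y \<noteq> d"
    and body: "\<And>s'. (\<And>z. z \<notin> {x, d, y} \<Longrightarrow> s' z = s z) \<Longrightarrow> runs B c s' (s'(y := shift \<delta> (s' y)))"
  shows "runs (walkB M B) (walk x d c) s (s(y := shift (\<delta> * int k) (s y)))"
proof -
  let ?S = "\<lambda>j. s(x := ruler w M (int k - 1 - int j), d := ruler w M (int j - 1),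
      y := shift (\<delta> * int j) (s y))"
  let ?R = "\<lambda>j. s(x := ruler w M (int j - 1), d := ruler w M (int k - 1 - int j),
      y := shift (\<delta> * int k) (s y))"
  have 1: "runs 1 (Move x Go_Left) s (?S 0)"
      by (rule runs_eq[OF runs_Move]) (use ne x d in \<open>auto simp: fun_eq_iff algebra_simps\<close>)
  have 2: "runs (k * Suc (Suc (1 + Suc (1 + B))) + 1)
      (Loop x nonblank (Move x Go_Left ;; Move d Go_Right ;; c)) (?S 0) (?S k)"
  proof (rule runs_loop)
    fix j assume "j < k"
    let ?a = "(?S j)(x := ruler w M (int k - 1 - int (Suc j)))"
    let ?b = "?a(d := ruler w M (int (Suc j) - 1))"
    have a: "runs 1 (Move x Go_Left) (?S j) ?a"
      by (rule runs_eq[OF runs_Move]) (use ne x d in \<open>auto simp: fun_eq_iff algebra_simps\<close>)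
    have b: "runs 1 (Move d Go_Right) ?a ?b"
      by (rule runs_eq[OF runs_Move]) (use ne x d in \<open>auto simp: fun_eq_iff algebra_simps\<close>)
    have c: "runs B c ?b (?b(y := shift \<delta> (?b y)))" by (rule body) auto
    have "?b(y := shift \<delta> (?b y)) = ?S (Suc j)"
      using ne by (auto simp: fun_eq_iff algebra_simps)
    from runs_eq[OF runs_seq[OF a runs_seq[OF b c]] this]
    show "runs (Suc (1 + Suc (1 + B))) (Move x Go_Left ;; Move d Go_Right ;; c)
        (?S j) (?S (Suc j))" .
  qed (use ne x in \<open>auto simp: read_ruler read_ruler_blank\<close>)
  have 3: "runs (k * Suc (Suc (1 + 1)) + 1)
      (Loop d nonblank (Move d Go_Left ;; Move x Go_Right)) (?R 0) (?R k)"
  proof (rule runs_loop)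
    fix j assume "j < k"
    let ?a = "(?R j)(d := ruler w M (int k - 1 - int (Suc j)))"
    have a: "runs 1 (Move d Go_Left) (?R j) ?a"
      by (rule runs_eq[OF runs_Move]) (use ne x d in \<open>auto simp: fun_eq_iff algebra_simps\<close>)
    have b: "runs 1 (Move x Go_Right) ?a (?R (Suc j))"
      by (rule runs_eq[OF runs_Move]) (use ne x d in \<open>auto simp: fun_eq_iff algebra_simps\<close>)
    show "runs (Suc (1 + 1)) (Move d Go_Left ;; Move x Go_Right) (?R j) (?R (Suc j))"
      by (rule runs_seq[OF a b])
  qed (use ne x in \<open>auto simp: read_ruler read_ruler_blank\<close>)
  have SR: "?S k = ?R 0" by (rule ext) (simp add: algebra_simps)
  have 4: "runs 1 (Move x Go_Right) (?R k) (s(y := shift (\<delta> * int k) (s y)))"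
      by (rule runs_eq[OF runs_Move]) (use ne x d in \<open>auto simp: fun_eq_iff algebra_simps\<close>)
  let ?T = "Suc (1 + Suc (k * Suc (Suc (1 + Suc (1 + B))) + 1 + Suc (k * Suc (Suc (1 + 1)) + 1 + 1)))"
  have "runs ?T (walk x d c) s (s(y := shift (\<delta> * int k) (s y)))"
    unfolding walk_def by (rule runs_seq[OF 1 runs_seq[OF 2[unfolded SR] runs_seq[OF 3 4]]])
  moreover have "?T \<le> walkB M B"
  proof -
    have "k * Suc (Suc (1 + Suc (1 + B))) + k * Suc (Suc (1 + 1)) = k * (B + 9)"
      by (simp add: algebra_simps)
    also have "\<dots> \<le> M * (B + 10)"
      using x(2) by (intro mult_mono) auto
    finally show ?thesis by (simp add: walkB_def)
  qed
  ultimately show ?thesis by (rule runs_mono)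
qed

lemma runs_nest_move:
  assumes "distinct xs" "y \<notin> set xs" "\<And>x. x \<in> set xs \<Longrightarrow> s x = ruler w M (-1)"
  shows "runs (nestB M (length xs) 1) (nest xs (Move y d)) s
    (s(y := shift (dir_int d * int (M ^ length xs)) (s y)))"
proof -
  let ?I = "\<lambda>j s'. \<forall>z. z \<notin> set xs \<longrightarrow> s' z = (s(y := shift (dir_int d * int j) (s y))) z"
  have "hoare (nestB M (length xs) 1) (\<lambda>s'. (\<forall>x\<in>set xs. s' x = s x) \<and> ?I 0 s') (nest xs (Move y d))
    (\<lambda>s'. (\<forall>x\<in>set xs. s' x = s x) \<and> ?I (0 + M ^ length xs) s')"
  proof (rule hoare_nest_count)
    fix j f
    show "hoare 1 (\<lambda>s. (\<forall>x\<in>set xs. s x = f x) \<and> ?I j s) (Move y d)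
       (\<lambda>s. (\<forall>x\<in>set xs. s x = f x) \<and> ?I (Suc j) s)"
      by (rule hoare_Move) (use assms in \<open>auto simp: move_tape_shift algebra_simps\<close>)
  qed (use assms in auto)
  from hoareD[OF this, of s] obtain s' where s': "runs (nestB M (length xs) 1) (nest xs (Move y d))
    s s'"
    "\<forall>x\<in>set xs. s' x = s x" "?I (M ^ length xs) s'" by auto
  have "s' z = (s(y := shift (dir_int d * int (M ^ length xs)) (s y))) z" for z
    using s' assms(2) by (cases "z \<in> set xs") auto
  then have "s' = s(y := shift (dir_int d * int (M ^ length xs)) (s y))" by (rule ext)
  with s'(1) show ?thesis by simp
qed

text \<open>A tuple read as a numeral in base \<open>M\<close>, most significant entry first; this
  is the number of its cell in a truth table.\<close>

fun idx :: "nat \<Rightarrow> nat list \<Rightarrow> nat" where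
  "idx M [] = 0"
| "idx M (v # vs) = v * M ^ length vs + idx M vs"

text \<open>The entry \<open>x\<close> has place value \<open>M ^ length xs\<close>. That many
  single moves come from a nest over \<open>length xs\<close> idle counters, so powers are never
  computed. The same program with the opposite direction undoes the walk.\<close>

fun seek :: "direction \<Rightarrow> nat \<Rightarrow> nat \<Rightarrow> nat list \<Rightarrow> nat list \<Rightarrow> 'c prog" where
  "seek dir y d cs [] = Skip"
| "seek dir y d cs (x # xs) =
    walk x d (nest (take (length xs) cs) (Move y dir)) ;; seek dir y d cs xs"

fun seekB :: "nat \<Rightarrow> nat \<Rightarrow> nat" where
  "seekB M 0 = 1"
| "seekB M (Suc k) = Suc (walkB M (nestB M k 1) + seekB M k)"

lemma runs_seek:
  assumes "length xs \<le> length cs" "distinct cs" "d \<notin> set cs" "y \<notin> set cs" "y \<noteq> d"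
    and "\<And>x. x \<in> set cs \<Longrightarrow> s x = ruler w M (-1)" "s d = ruler w M (-1)"
    and "\<And>x. x \<in> set xs \<Longrightarrow> x \<notin> set cs \<and> x \<noteq> d \<and> x \<noteq> y \<and> s x = ruler w M (int (\<sigma> x)) \<and> \<sigma> x < M"
  shows "runs (seekB M (length xs)) (seek dir y d cs xs) s
    (s(y := shift (dir_int dir * int (idx M (map \<sigma> xs))) (s y)))"
  using assms(1,6-8)
proof (induction xs arbitrary: s)
  case Nil
  then show ?case using runs_Skip[of s] by simp
next
  case (Cons x xs)
  let ?cs = "take (length xs) cs"
  let ?\<delta> = "dir_int dir * int (M ^ length xs)"
  let ?s = "s(y := shift (?\<delta> * int (\<sigma> x)) (s y))"
  have cs: "set ?cs \<subseteq> set cs" "length ?cs = length xs" using Cons.prems(1) by (auto dest: in_set_takeD)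
  have 1: "runs (walkB M (nestB M (length xs) 1)) (walk x d (nest ?cs (Move y dir))) s ?s"
  proof (rule runs_walk)
    fix s' assume s': "\<And>z. z \<notin> {x, d, y} \<Longrightarrow> s' z = s z"
    have "s' z = ruler w M (-1)" if "z \<in> set ?cs" for z
      using s'[of z] subsetD[OF cs(1) that] Cons.prems(2)[of z] Cons.prems(4)[of x] assms(3,4)
      by auto
    from runs_nest_move[where s = s' and xs = ?cs and y = y and d = dir, OF _ _ this]
    show "runs (nestB M (length xs) 1) (nest ?cs (Move y dir)) s' (s'(y := shift ?\<delta> (s' y)))"
      using cs assms(2,4) by auto
  qed (use Cons.prems assms in auto)
  have 2: "runs (seekB M (length xs)) (seek dir y d cs xs) ?s
     (?s(y := shift (dir_int dir * int (idx M (map \<sigma> xs))) (?s y)))"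
    by (rule Cons.IH) (use Cons.prems assms in auto)
  show ?case
    unfolding seek.simps
    by (rule runs_eq[OF runs_mono[OF runs_seq[OF 1 2]]])
      (use cs in \<open>auto simp: fun_eq_iff algebra_simps\<close>)
qed

section \<open>Datalog programs over an initial segment of the natural numbers\<close>

datatype ('c, 'p) lit =
    LZero nat
  | LSucc nat nat
  | LSym "'c option set" nat
  | LAtom 'p "nat list"

type_synonym ('c, 'p) datalog_rule = "('p \<times> nat list) \<times> ('c, 'p) lit list"

definition sym_at :: "'c list \<Rightarrow> nat \<Rightarrow> 'c option" where
  "sym_at w i = (if i < length w then Some (w ! i) else None)"

fun lit_holds :: "'c list \<Rightarrow> ('p \<times> nat list) set \<Rightarrow> (nat \<Rightarrow> nat) \<Rightarrow> ('c, 'p) lit \<Rightarrow> bool" where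
  "lit_holds w F \<sigma> (LZero x) \<longleftrightarrow> \<sigma> x = 0"
| "lit_holds w F \<sigma> (LSucc x y) \<longleftrightarrow> \<sigma> y = Suc (\<sigma> x)"
| "lit_holds w F \<sigma> (LSym A x) \<longleftrightarrow> sym_at w (\<sigma> x) \<in> A"
| "lit_holds w F \<sigma> (LAtom p xs) \<longleftrightarrow> (p, map \<sigma> xs) \<in> F"

definition datalog_closed ::
  "('c, 'p) datalog_rule set \<Rightarrow> 'c list \<Rightarrow> nat \<Rightarrow> ('p \<times> nat list) set \<Rightarrow> bool" where
  "datalog_closed Rs w M F \<longleftrightarrow> (\<forall>(h, b)\<in>Rs. \<forall>\<sigma>. (\<forall>x. \<sigma> x < M) \<longrightarrow>
     (\<forall>l\<in>set b. lit_holds w F \<sigma> l) \<longrightarrow> (fst h, map \<sigma> (snd h)) \<in> F)"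

definition datalog :: "('c, 'p) datalog_rule set \<Rightarrow> 'c list \<Rightarrow> nat \<Rightarrow> ('p \<times> nat list) set" where
  "datalog Rs w M = \<Inter> {F. datalog_closed Rs w M F}"

lemma lit_holds_mono: "lit_holds w F \<sigma> l \<Longrightarrow> F \<subseteq> F' \<Longrightarrow> lit_holds w F' \<sigma> l"
  by (cases l) auto

lemma datalog_least: "datalog_closed Rs w M F \<Longrightarrow> datalog Rs w M \<subseteq> F"
  by (auto simp: datalog_def)

text \<open>All literals are positive, so bodies are monotone in the set of facts and the
  intersection of closed sets is closed.\<close>

lemma datalog_closed: "datalog_closed Rs w M (datalog Rs w M)"
proof -
  have "(fst h, map \<sigma> (snd h)) \<in> F"
    if "(h, b) \<in> Rs" "\<forall>x. \<sigma> x < M" "\<forall>l\<in>set b. lit_holds w (datalog Rs w M) \<sigma> l"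
      "datalog_closed Rs w M F" for h b \<sigma> F
    using that lit_holds_mono[OF _ datalog_least[OF that(4)]] unfolding datalog_closed_def by fast
  then have "(fst h, map \<sigma> (snd h)) \<in> datalog Rs w M"
    if "(h, b) \<in> Rs" "\<forall>x. \<sigma> x < M" "\<forall>l\<in>set b. lit_holds w (datalog Rs w M) \<sigma> l" for h b \<sigma>
    by (subst datalog_def) (use that in blast)
  then show ?thesis unfolding datalog_closed_def by blast
qed

fun lit_wf :: "nat \<Rightarrow> 'p set \<Rightarrow> ('p \<Rightarrow> nat) \<Rightarrow> ('c, 'p) lit \<Rightarrow> bool" where
  "lit_wf V PS ar (LZero x) \<longleftrightarrow> x < V"
| "lit_wf V PS ar (LSucc x y) \<longleftrightarrow> x < V \<and> y < V"
| "lit_wf V PS ar (LSym A x) \<longleftrightarrow> x < V"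
| "lit_wf V PS ar (LAtom p xs) \<longleftrightarrow> p \<in> PS \<and> length xs = ar p \<and> set xs \<subseteq> {..<V}"

definition rule_wf :: "nat \<Rightarrow> 'p set \<Rightarrow> ('p \<Rightarrow> nat) \<Rightarrow> ('c, 'p) datalog_rule \<Rightarrow> bool" where
  "rule_wf V PS ar r \<longleftrightarrow> lit_wf V PS ar (LAtom (fst (fst r)) (snd (fst r)) :: ('c, 'p) lit) \<and>
     (\<forall>l\<in>set (snd r). lit_wf V PS ar l)"

fun seqs :: "'c prog list \<Rightarrow> 'c prog" where
  "seqs [] = Skip"
| "seqs (c # cs) = c ;; seqs cs"

definition tabc :: "('p \<times> nat) set \<Rightarrow> 'p \<Rightarrow> int \<Rightarrow> 'c tape_symbol" where
  "tabc T p i = (if 0 \<le> i \<and> (p, nat i) \<in> T then Work 1 else Blank)"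

definition flagt :: "bool \<Rightarrow> 'c tape" where
  "flagt b = ((\<lambda>_. Blank)(0 := if b then Work 1 else Blank), 0)"

lemma write_flagt [simp]: "write_tape Blank (flagt b) = flagt False"
  "write_tape (Work 1) (flagt b) = flagt True" "write_tape (Work (Suc 0)) (flagt b) = flagt True"
  by (auto simp: flagt_def write_tape_def)

lemma read_flagt [simp]: "read_tape (flagt b) = (if b then Work 1 else Blank)"
  by (auto simp: flagt_def)

lemma idx_less: "set vs \<subseteq> {..<M} \<Longrightarrow> idx M vs < M ^ length vs"
proof (induction vs)
  case (Cons v vs)
  then have "v * M ^ length vs + idx M vs < Suc v * M ^ length vs" by simp
  also have "\<dots> \<le> M * M ^ length vs" using Cons.prems by (intro mult_le_mono1) auto
  finally show ?case by simp
qed simp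

lemma idx_inj:
  "length vs = length us \<Longrightarrow> set vs \<subseteq> {..<M} \<Longrightarrow> set us \<subseteq> {..<M} \<Longrightarrow> idx M vs = idx M us \<Longrightarrow> vs = us"
proof (induction vs us rule: list_induct2)
  case (Cons v vs u us)
  have lt: "idx M vs < M ^ length vs" "idx M us < M ^ length vs"
    using idx_less[of vs M] idx_less[of us M] Cons by auto
  have "(idx M vs + v * M ^ length vs) div M ^ length vs = (idx M us + u * M ^ length vs) div M ^
    length vs"
    using Cons by (simp add: add.commute)
  moreover have "M ^ length vs \<noteq> 0" using lt by linarith
  ultimately have "v = u" using lt by simp
  with Cons show ?case by simp
qed simp

lemma seekB_mono: "k \<le> k' \<Longrightarrow> seekB M k \<le> seekB M k'"
  by (rule lift_Suc_mono_le[of "seekB M"]) auto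

text \<open>Facts are kept by cell number, as on the tapes. Going back to tuples is safe for entries
  below \<open>M\<close>, where \<open>idx\<close> is injective on tuples of equal length.\<close>

fun lit_holds_idx ::
  "nat \<Rightarrow> 'c list \<Rightarrow> ('p \<times> nat) set \<Rightarrow> (nat \<Rightarrow> nat) \<Rightarrow> ('c, 'p) lit \<Rightarrow> bool" where
  "lit_holds_idx M w T \<sigma> (LAtom p xs) \<longleftrightarrow> (p, idx M (map \<sigma> xs)) \<in> T"
| "lit_holds_idx M w T \<sigma> (LZero x) \<longleftrightarrow> \<sigma> x = 0"
| "lit_holds_idx M w T \<sigma> (LSucc x y) \<longleftrightarrow> \<sigma> y = Suc (\<sigma> x)"
| "lit_holds_idx M w T \<sigma> (LSym A x) \<longleftrightarrow> sym_at w (\<sigma> x) \<in> A"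

definition body_holds where
  "body_holds M w T \<sigma> r \<longleftrightarrow> (\<forall>l\<in>set (snd r). lit_holds_idx M w T \<sigma> l)"

definition head_idx where
  "head_idx M \<sigma> r = (fst (fst r), idx M (map \<sigma> (snd (fst r))))"

lemma body_holds_mono: "body_holds M w T \<sigma> r \<Longrightarrow> T \<subseteq> T' \<Longrightarrow> body_holds M w T' \<sigma> r"
proof -
  have "lit_holds_idx M w T \<sigma> l \<Longrightarrow> T \<subseteq> T' \<Longrightarrow> lit_holds_idx M w T' \<sigma> l" for l by (cases l) auto
  then show "body_holds M w T \<sigma> r \<Longrightarrow> T \<subseteq> T' \<Longrightarrow> body_holds M w T' \<sigma> r"
    unfolding body_holds_def by blast
qed

section \<open>Executing one rule under one assignment\<close>

locale datalog_machine =
  fixes Rs :: "('c, 'p) datalog_rule list" and PS :: "'p set" and ar :: "'p \<Rightarrow> nat"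
    and num :: "'p \<Rightarrow> nat" and V a q c :: nat
  assumes rules: "\<And>r. r \<in> set Rs \<Longrightarrow> rule_wf V PS ar r"
    and num: "inj_on num PS" and ar: "\<And>p. p \<in> PS \<Longrightarrow> ar p \<le> a"
begin

text \<open>Tape layout: the rulers \<open>0..<R\<close> hold the rule variables, two scratch counters \<open>scr\<close> and \<open>cmp\<close>,
  the counters \<open>cs\<close> for seeking and \<open>its\<close> for iterating; then come a flag, the rulers used to
  build the others, and the tables.\<close>

definition scr where "scr = V"
definition cs where "cs = [V + 1..<V + 1 + a]"
definition its where "its = [V + 1 + a..<V + 1 + a + q]"
definition cmp where "cmp = V + 1 + a + q"
definition R where "R = V + 2 + a + q"
definition flag where "flag = R"
definition helpers where "helpers = [R + 1..<R + 1 + c]"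
definition tb where "tb p = R + 1 + c + num p"

lemmas layout = scr_def cs_def its_def cmp_def R_def flag_def helpers_def tb_def

definition scratch where "scratch = {scr, cmp} \<union> set cs"

definition clear where "clear = Write flag Blank"

fun sym_of :: "'c option \<Rightarrow> 'c tape_symbol" where
  "sym_of None = Work 0"
| "sym_of (Some x) = Input x"

text \<open>A test can only clear the flag and otherwise restores the tapes, so a rule body becomes
  a sequence of tests. For \<open>LSucc\<close>, the head of \<open>cmp\<close> is brought to the
  difference of the two values; the difference is \<open>-1\<close> exactly when this cell is blank
  and its right neighbour is not.\<close>

fun test :: "('c, 'p) lit \<Rightarrow> 'c prog" where
  "test (LZero x) = Move x Go_Left ;; Branch x {Blank} Skip clear ;; Move x Go_Right"
| "test (LSucc x y) =
    walk x scr (Move cmp Go_Right) ;; walk y scr (Move cmp Go_Left) ;; Move cmp Go_Right ;;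
    Branch cmp {Blank} (Move cmp Go_Right ;; Branch cmp nonblank Skip clear ;; Move cmp Go_Left)
      clear ;;
    Move cmp Go_Left ;; walk y scr (Move cmp Go_Right) ;; walk x scr (Move cmp Go_Left)"
| "test (LSym A x) = Branch x (sym_of ` A) Skip clear"
| "test (LAtom p xs) = seek Go_Right (tb p) scr cs xs ;; Branch (tb p) {Work 1} Skip clear ;;
    seek Go_Left (tb p) scr cs xs"

definition rule_prog :: "('c, 'p) datalog_rule \<Rightarrow> 'c prog" where
  "rule_prog r = (case fst r of (p, xs) \<Rightarrow>
     Write flag (Work 1) ;; seqs (map test (snd r)) ;;
     Branch flag {Work 1}
       (seek Go_Right (tb p) scr cs xs ;; Write (tb p) (Work 1) ;; seek Go_Left (tb p) scr cs xs) Skip)"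

definition testB where "testB M = 2 * seekB M a + 4 * walkB M 1 + 30"

definition ruleB :: "nat \<Rightarrow> ('c, 'p) datalog_rule \<Rightarrow> nat" where
  "ruleB M r = length (snd r) * Suc (testB M) + 2 * seekB M a + 10"

end

locale datalog_run = datalog_machine Rs PS ar num V a q c
  for Rs :: "('c, 'p) datalog_rule list" and PS :: "'p set" and ar num V a q c +
  fixes w :: "'c list" and M :: nat
  assumes M: "length w < M" "2 \<le> M"
begin

definition tables where
  "tables T s \<longleftrightarrow> (\<forall>i\<in>scratch. s i = ruler w M (-1)) \<and> (\<forall>p\<in>PS. s (tb p) = (tabc T p, 0))"

definition vars where
  "vars \<sigma> s \<longleftrightarrow> (\<forall>x<V. s x = ruler w M (int (\<sigma> x)) \<and> \<sigma> x < M)"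

lemma runs_seek_tb:
  assumes "\<forall>i\<in>scratch. s i = ruler w M (-1)" "vars \<sigma> s" "p \<in> PS" "length xs = ar p"
    "set xs \<subseteq> {..<V}"
  shows "runs (seekB M a) (seek dir (tb p) scr cs xs) s
    (s(tb p := shift (dir_int dir * int (idx M (map \<sigma> xs))) (s (tb p))))"
proof (rule runs_mono)
  show "runs (seekB M (length xs)) (seek dir (tb p) scr cs xs) s
    (s(tb p := shift (dir_int dir * int (idx M (map \<sigma> xs))) (s (tb p))))"
    by (rule runs_seek[where w = w and M = M and \<sigma> = \<sigma>]) (use assms ar[of p] in \<open>auto simp: vars_def
      layout scratch_def\<close>)
  show "seekB M (length xs) \<le> seekB M a" using ar assms by (simp add: seekB_mono)
qed

lemma runs_walk_cmp:
  assumes "s scr = ruler w M (-1)" "vars \<sigma> s" "x < V"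
  shows "runs (walkB M 1) (walk x scr (Move cmp dir)) s
    (s(cmp := shift (dir_int dir * int (\<sigma> x)) (s cmp)))"
proof (rule runs_walk[where w = w and M = M])
  show "runs 1 (Move cmp dir) s' (s'(cmp := shift (dir_int dir) (s' cmp)))" for s' :: "'c tapes"
    by (rule runs_eq[OF runs_Move]) (simp add: move_tape_shift)
qed (use assms in \<open>auto simp: vars_def layout\<close>)

lemma runs_clear: "runs 1 clear s (s(flag := write_tape Blank (s flag)))"
  unfolding clear_def by (rule runs_Write)

lemma runs_test:
  assumes "tables T s" "vars \<sigma> s" "s flag = flagt b" "lit_wf V PS ar l"
  shows "runs (testB M) (test l) s (s(flag := flagt (b \<and> lit_holds_idx M w T \<sigma> l)))"
proof (cases l)
  case (LZero x)
  then have x: "s x = ruler w M (int (\<sigma> x))" "\<sigma> x < M" "x \<noteq> flag"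
    using assms by (auto simp: vars_def layout)
  let ?s = "s(x := ruler w M (int (\<sigma> x) - 1))"
  let ?t = "?s(flag := flagt (b \<and> \<sigma> x = 0))"
  have 1: "runs 1 (Move x Go_Left) s ?s"
    by (rule runs_eq[OF runs_Move]) (use x in auto)
  have 2: "runs (Suc 1) (Branch x {Blank} Skip clear) ?s ?t"
  proof (cases "\<sigma> x = 0")
    case True
    then show ?thesis
      by (intro runs_BranchT runs_eq[OF runs_Skip]) (use x assms(3) in \<open>auto simp: read_ruler_blank\<close>)
  next
    case False
    then show ?thesis
      by (intro runs_BranchF runs_eq[OF runs_clear]) (use x assms(3) in \<open>auto simp: read_ruler_blank\<close>)
  qed
  have 3: "runs 1 (Move x Go_Right) ?t (s(flag := flagt (b \<and> \<sigma> x = 0)))"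
    by (rule runs_eq[OF runs_Move]) (use x in auto)
  show ?thesis unfolding LZero test.simps lit_holds_idx.simps
    by (rule runs_mono[OF runs_seq[OF 1 runs_seq[OF 2 3]]]) (simp add: testB_def)
next
  case (LSym A x)
  then have x: "s x = ruler w M (int (\<sigma> x))" "\<sigma> x < M" "x \<noteq> flag"
    using assms by (auto simp: vars_def layout)
  have "inj sym_of" by (rule injI) (auto elim!: sym_of.elims)
  moreover have "read_tape (s x) = sym_of (sym_at w (\<sigma> x))"
    using x by (auto simp: ruler_def content_def sym_at_def)
  ultimately have iff: "read_tape (s x) \<in> sym_of ` A \<longleftrightarrow> sym_at w (\<sigma> x) \<in> A"
    by (metis inj_image_mem_iff)
  have "runs (Suc 1) (Branch x (sym_of ` A) Skip clear) s
      (s(flag := flagt (b \<and> lit_holds_idx M w T \<sigma> l)))"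
  proof (cases "sym_at w (\<sigma> x) \<in> A")
    case True
    then show ?thesis
      by (intro runs_BranchT runs_eq[OF runs_Skip]) (use iff LSym assms(3) in auto)
  next
    case False
    then show ?thesis
      by (intro runs_BranchF runs_eq[OF runs_clear]) (use iff LSym assms(3) in auto)
  qed
  then show ?thesis using LSym by (auto elim!: runs_mono simp: testB_def)
next
  case (LAtom p xs)
  then have p: "p \<in> PS" "length xs = ar p" "set xs \<subseteq> {..<V}" using assms by auto
  let ?n = "idx M (map \<sigma> xs)"
  let ?s = "s(tb p := (tabc T p, int ?n))"
  let ?t = "?s(flag := flagt (b \<and> (p, ?n) \<in> T))"
  have ne: "tb p \<noteq> flag" "tb p \<notin> scratch" "\<And>x. x < V \<Longrightarrow> tb p \<noteq> x" "flag \<notin> scratch"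
    "\<And>x. x < V \<Longrightarrow> flag \<noteq> x" "\<And>x. x < V \<Longrightarrow> x \<noteq> flag"
    by (auto simp: layout scratch_def)
  have tb: "s (tb p) = (tabc T p, 0)" using assms p by (auto simp: tables_def)
  have 1: "runs (seekB M a) (seek Go_Right (tb p) scr cs xs) s ?s"
    by (rule runs_eq[OF runs_seek_tb[of _ \<sigma>]])
      (use assms p tb in \<open>auto simp: tables_def shift_def\<close>)
  have 2: "runs (Suc 1) (Branch (tb p) {Work 1} Skip clear) ?s ?t"
  proof (cases "(p, ?n) \<in> T")
    case True
    then show ?thesis
      by (intro runs_BranchT runs_eq[OF runs_Skip]) (use ne assms(3) in \<open>auto simp: tabc_def\<close>)
  next
    case False
    then show ?thesis
      by (intro runs_BranchF runs_eq[OF runs_clear]) (use ne assms(3) in \<open>auto simp: tabc_def\<close>)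
  qed
  have 3: "runs (seekB M a) (seek Go_Left (tb p) scr cs xs) ?t (s(flag := flagt (b \<and> (p, ?n) \<in> T)))"
    by (rule runs_eq[OF runs_seek_tb[of _ \<sigma>]])
      (use assms p tb ne in \<open>auto simp: tables_def vars_def shift_def fun_eq_iff\<close>)
  show ?thesis unfolding LAtom test.simps lit_holds_idx.simps
    by (rule runs_mono[OF runs_seq[OF 1 runs_seq[OF 2 3]]]) (simp add: testB_def)
next
  case (LSucc x y)
  then have xy: "x < V" "y < V" using assms by auto
  have sc: "s scr = ruler w M (-1)" "s cmp = ruler w M (-1)"
    using assms by (auto simp: tables_def scratch_def)
  have ne: "cmp \<noteq> flag" "cmp \<noteq> scr" "flag \<noteq> scr" "\<And>x. x < V \<Longrightarrow> x \<noteq> cmp" "\<And>x. x < V \<Longrightarrow> x \<noteq> flag"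
    by (auto simp: layout)
  have lt: "\<sigma> x < M" "\<sigma> y < M" using xy assms by (auto simp: vars_def)
  let ?r = "b \<and> \<sigma> y = Suc (\<sigma> x)"
  let ?S = "\<lambda>b i. s(cmp := ruler w M i, flag := flagt b)"
  have v: "vars \<sigma> (?S b' i)" for b' i using assms(2) ne by (auto simp: vars_def)
  let ?d = "int (\<sigma> x) - int (\<sigma> y)"
  have w: "runs (walkB M 1) (walk z scr (Move cmp dir)) (?S b' i) (?S b' j)"
    if "z < V" "j = i + dir_int dir * int (\<sigma> z)" for z dir b' i j
    by (rule runs_eq[OF runs_walk_cmp[of _ \<sigma>]]) (use that ne sc v in \<open>auto simp: fun_eq_iff\<close>)
  have m: "runs 1 (Move cmp dir) (?S b' i) (?S b' j)" if "j = i + dir_int dir" for b' i j dir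
    by (rule runs_eq[OF runs_Move]) (use that ne in \<open>auto simp: move_tape_shift fun_eq_iff\<close>)
  have k: "runs 1 clear (?S b' i) (?S False i)" for b' i
    by (rule runs_eq[OF runs_clear]) (use ne in auto)
  have 0: "s = ?S b (-1)" using sc assms(3) by auto
  have 1: "runs (walkB M 1) (walk x scr (Move cmp Go_Right)) s (?S b (int (\<sigma> x) - 1))"
    by (subst 0) (rule w, use xy in auto)
  have 2: "runs (walkB M 1) (walk y scr (Move cmp Go_Left)) (?S b (int (\<sigma> x) - 1)) (?S b (?d - 1))"
    by (rule w) (use xy in auto)
  have 3: "runs 1 (Move cmp Go_Right) (?S b (?d - 1)) (?S b ?d)" by (rule m) simp
  have 4: "runs (Suc (Suc (1 + Suc (Suc 1 + 1))))
      (Branch cmp {Blank} (Move cmp Go_Right ;; Branch cmp nonblank Skip clear ;; Move cmp Go_Left)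
        clear)
      (?S b ?d) (?S ?r ?d)"
  proof (cases "0 \<le> ?d")
    case True
    then have "?S False ?d = ?S ?r ?d" by auto
    then show ?thesis
      by (intro runs_BranchF runs_mono[OF runs_eq[OF k]])
        (use True lt ne in \<open>auto simp: read_ruler_blank\<close>)
  next
    case False
    have i: "runs 1 (Move cmp Go_Right) (?S b ?d) (?S b (?d + 1))" by (rule m) simp
    have iii: "runs 1 (Move cmp Go_Left) (?S ?r (?d + 1)) (?S ?r ?d)" by (rule m) simp
    have ii: "runs (Suc 1) (Branch cmp nonblank Skip clear) (?S b (?d + 1)) (?S ?r (?d + 1))"
    proof (cases "?d = -1")
      case True
      then have "?S b (?d + 1) = ?S ?r (?d + 1)" by auto
      then show ?thesis
        by (intro runs_BranchT runs_eq[OF runs_Skip])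
          (use True M ne in \<open>auto simp: read_ruler read_ruler_blank\<close>)
    next
      case neq: False
      then have "?S False (?d + 1) = ?S ?r (?d + 1)" by auto
      then show ?thesis
        by (intro runs_BranchF runs_eq[OF k])
          (use False neq ne in \<open>auto simp: read_ruler read_ruler_blank\<close>)
    qed
    show ?thesis
      by (intro runs_BranchT runs_seq[OF i runs_seq[OF ii iii]])
        (use False ne in \<open>auto simp: read_ruler_blank\<close>)
  qed
  have 5: "runs 1 (Move cmp Go_Left) (?S ?r ?d) (?S ?r (?d - 1))" by (rule m) simp
  have 6: "runs (walkB M 1) (walk y scr (Move cmp Go_Right)) (?S ?r (?d - 1)) (?S ?r (int (\<sigma> x) - 1))"
    by (rule w) (use xy in auto)
  have 7: "runs (walkB M 1) (walk x scr (Move cmp Go_Left)) (?S ?r (int (\<sigma> x) - 1)) (?S ?r (- 1))"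
    by (rule w) (use xy in auto)
  have 8: "?S ?r (- 1) = s(flag := flagt ?r)" using sc by auto
  show ?thesis unfolding LSucc test.simps lit_holds_idx.simps 8[symmetric]
    by (rule runs_mono[OF runs_seq[OF 1 runs_seq[OF 2 runs_seq[OF 3 runs_seq[OF 4
      runs_seq[OF 5 runs_seq[OF 6 7]]]]]]]) (simp add: testB_def)
qed

lemma runs_tests:
  assumes "tables T s" "vars \<sigma> s" "s flag = flagt b" "\<forall>l\<in>set ls. lit_wf V PS ar l"
  shows "runs (length ls * Suc (testB M) + 1) (seqs (map test ls)) s
    (s(flag := flagt (b \<and> (\<forall>l\<in>set ls. lit_holds_idx M w T \<sigma> l))))"
  using assms
proof (induction ls arbitrary: s b)
  case Nil
  then have "s(flag := flagt b) = s" by auto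
  then show ?case using runs_Skip[of s] by simp
next
  case (Cons l ls)
  let ?s = "s(flag := flagt (b \<and> lit_holds_idx M w T \<sigma> l))"
  have 1: "runs (testB M) (test l) s ?s" using Cons.prems by (intro runs_test) auto
  have "flag \<notin> scratch" "\<And>x. x < V \<Longrightarrow> x \<noteq> flag" "\<And>p. tb p \<noteq> flag"
    by (auto simp: layout scratch_def)
  then have "tables T ?s" "vars \<sigma> ?s" using Cons.prems by (auto simp: tables_def vars_def)
  then have 2: "runs (length ls * Suc (testB M) + 1) (seqs (map test ls)) ?s
    (?s(flag := flagt ((b \<and> lit_holds_idx M w T \<sigma> l) \<and> (\<forall>l\<in>set ls. lit_holds_idx M w T \<sigma> l))))"
    by (rule Cons.IH) (use Cons.prems in auto)
  show ?case unfolding list.map seqs.simps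
    by (rule runs_eq[OF runs_mono[OF runs_seq[OF 1 2]]]) auto
qed

text \<open>The comprehension added to \<open>T\<close> has at most one element; it lets one
  statement cover both a satisfied and a failed body.\<close>

lemma runs_rule:
  assumes "r \<in> set Rs" "tables T s" "vars \<sigma> s" "\<exists>b. s flag = flagt b"
  obtains s' where "runs (ruleB M r) (rule_prog r) s s'" "vars \<sigma> s'" "\<exists>b. s' flag = flagt b"
    "tables (T \<union> {h. body_holds M w T \<sigma> r \<and> h = head_idx M \<sigma> r}) s'"
    "\<And>i. i \<in> set its \<Longrightarrow> s' i = s i"
proof -
  obtain p xs ls where r: "r = ((p, xs), ls)" by (metis prod.exhaust)
  have p: "p \<in> PS" "length xs = ar p" "set xs \<subseteq> {..<V}" and ls: "\<forall>l\<in>set ls. lit_wf V PS ar l"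
    using rules[OF assms(1)] by (auto simp: r rule_wf_def)
  have ne: "tb p \<noteq> flag" "tb p \<notin> scratch" "\<And>x. x < V \<Longrightarrow> tb p \<noteq> x" "flag \<notin> scratch"
    "\<And>x. x < V \<Longrightarrow> flag \<noteq> x" "\<And>x. x < V \<Longrightarrow> x \<noteq> flag" "\<And>p. tb p \<noteq> flag"
    "flag \<notin> set its" "tb p \<notin> set its"
    by (auto simp: layout scratch_def)
  define h where "h \<longleftrightarrow> body_holds M w T \<sigma> r"
  let ?n = "idx M (map \<sigma> xs)"
  let ?s = "s(flag := flagt True)" and ?t = "s(flag := flagt h)"
  have 1: "runs 1 (Write flag (Work 1)) s ?s"
    by (rule runs_eq[OF runs_Write]) (use assms(4) in auto)
  have ts: "tables T (s(flag := flagt b))" "vars \<sigma> (s(flag := flagt b))" for b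
    using assms ne by (auto simp: tables_def vars_def)
  have 2: "runs (length ls * Suc (testB M) + 1) (seqs (map test ls)) ?s ?t"
    by (rule runs_eq[OF runs_tests[OF ts]]) (use ls in \<open>auto simp: h_def body_holds_def r\<close>)
  show ?thesis
  proof (cases h)
    case False
    then have "runs (Suc 1) (Branch flag {Work 1}
       (seek Go_Right (tb p) scr cs xs ;; Write (tb p) (Work 1) ;; seek Go_Left (tb p) scr cs xs) Skip)
       ?t ?t"
      by (intro runs_BranchF runs_Skip) auto
    from runs_mono[OF runs_seq[OF 1 runs_seq[OF 2 this]], of "ruleB M r"]
    have "runs (ruleB M r) (rule_prog r) s ?t" by (simp add: rule_prog_def r ruleB_def)
    moreover have "T \<union> {x. body_holds M w T \<sigma> r \<and> x = head_idx M \<sigma> r} = T"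
      using False by (auto simp: h_def)
    ultimately show ?thesis using ts[of h] ne by (intro that[of ?t]) auto
  next
    case True
    define T' where "T' = T \<union> {h. body_holds M w T \<sigma> r \<and> h = head_idx M \<sigma> r}"
    have T: "T' = insert (p, ?n) T" using True by (auto simp: T'_def h_def head_idx_def r)
    have tb: "s (tb p) = (tabc T p, 0)" using assms p by (auto simp: tables_def)
    let ?u = "?t(tb p := (tabc T p, int ?n))"
    let ?v = "?t(tb p := (tabc T' p, int ?n))"
    let ?x = "?t(tb p := (tabc T' p, 0))"
    have a: "runs (seekB M a) (seek Go_Right (tb p) scr cs xs) ?t ?u"
      by (rule runs_eq[OF runs_seek_tb[of _ \<sigma>]])
        (use ts[of h] p tb ne in \<open>auto simp: tables_def shift_def\<close>)
    have "write_tape (Work 1) (tabc T p, int ?n) = (tabc T' p, int ?n)"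
      unfolding T by (auto simp: write_tape_def tabc_def fun_eq_iff)
    then have b: "runs 1 (Write (tb p) (Work 1)) ?u ?v"
      by (intro runs_eq[OF runs_Write]) auto
    have v: "vars \<sigma> ?v" "\<forall>i\<in>scratch. ?v i = ruler w M (-1)" "vars \<sigma> ?x"
      using ts[of h] ne by (auto simp: vars_def tables_def)
    have c: "runs (seekB M a) (seek Go_Left (tb p) scr cs xs) ?v ?x"
      by (rule runs_eq[OF runs_seek_tb[OF v(2) v(1)]]) (use p in \<open>auto simp: shift_def\<close>)
    have "runs (Suc (Suc (seekB M a + Suc (1 + seekB M a)))) (Branch flag {Work 1}
       (seek Go_Right (tb p) scr cs xs ;; Write (tb p) (Work 1) ;; seek Go_Left (tb p) scr cs xs) Skip)
       ?t ?x"
      using True by (intro runs_BranchT runs_seq[OF a runs_seq[OF b c]]) auto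
    from runs_mono[OF runs_seq[OF 1 runs_seq[OF 2 this]], of "ruleB M r"]
    have "runs (ruleB M r) (rule_prog r) s ?x" by (simp add: rule_prog_def r ruleB_def)
    moreover have "tables T' ?x" unfolding tables_def
    proof (intro conjI ballI)
      fix p' assume p': "p' \<in> PS"
      show "?x (tb p') = (tabc T' p', 0)"
      proof (cases "p' = p")
        case False
        then have "tb p' \<noteq> tb p" using inj_onD[OF num] p p' by (auto simp: tb_def)
        moreover have "tabc T' p' = (tabc T p' :: int \<Rightarrow> 'c tape_symbol)" unfolding T using False
          by (auto simp: tabc_def fun_eq_iff)
        ultimately show ?thesis using assms(2) p' ne by (auto simp: tables_def)
      qed simp
    qed (use assms(2) ne in \<open>auto simp: tables_def\<close>)
    moreover have "\<exists>b. ?x flag = flagt b"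
      by (subst fun_upd_other[OF ne(1)[symmetric]]) auto
    moreover have "?x i = s i" if "i \<in> set its" for i using that ne by auto
    ultimately show ?thesis using v(3) by (intro that[of ?x]) (auto simp: T'_def)
  qed
qed

end

text \<open>Each component may rely on the tapes outside \<open>I\<close> being as in
  \<open>s0\<close>. Copying from the input tape to several others needs this.\<close>

lemma runs_seqs_pointwise:
  assumes "\<And>i s'. i \<in> I \<Longrightarrow> s' i = s0 i \<Longrightarrow> (\<And>j. j \<notin> I \<Longrightarrow> s' j = s0 j) \<Longrightarrow>
      runs B (f i) s' (s'(i := b i))"
    and "distinct is" "set is \<subseteq> I" "\<And>i. i \<in> set is \<Longrightarrow> s i = s0 i" "\<And>j. j \<notin> I \<Longrightarrow> s j = s0 j"
  shows "runs (length is * Suc B + 1) (seqs (map f is)) s (\<lambda>j. if j \<in> set is then b j else s j)"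
  using assms(2-5)
proof (induction "is" arbitrary: s)
  case Nil
  then show ?case using runs_Skip[of s] by simp
next
  case (Cons i "is")
  let ?s = "s(i := b i)"
  have 1: "runs B (f i) s ?s" by (rule assms(1)) (use Cons.prems in auto)
  have 2: "runs (length is * Suc B + 1) (seqs (map f is)) ?s (\<lambda>j. if j \<in> set is then b j else ?s j)"
    by (rule Cons.IH) (use Cons.prems in auto)
  show ?case unfolding list.map seqs.simps
    by (rule runs_eq[OF runs_mono[OF runs_seq[OF 1 2]]]) auto
qed

lemma lit_holds_idx_cong:
  assumes "lit_wf V PS ar l" "\<And>x. x < V \<Longrightarrow> \<sigma> x = \<tau> x"
  shows "lit_holds_idx M w T \<sigma> l = lit_holds_idx M w T \<tau> l"
proof (cases l)
  case (LAtom p xs)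
  then have "map \<sigma> xs = map \<tau> xs" using assms by auto
  then show ?thesis using LAtom by (simp del: map_eq_conv)
qed (use assms in auto)

lemma body_holds_cong:
  assumes "rule_wf V PS ar r" "\<And>x. x < V \<Longrightarrow> \<sigma> x = \<tau> x"
  shows "body_holds M w T \<sigma> r = body_holds M w T \<tau> r"
  unfolding body_holds_def using assms
  by (intro ball_cong refl lit_holds_idx_cong[of V PS ar]) (auto simp: rule_wf_def)

lemma head_idx_cong:
  assumes "rule_wf V PS ar r" "\<And>x. x < V \<Longrightarrow> \<sigma> x = \<tau> x"
  shows "head_idx M \<sigma> r = head_idx M \<tau> r"
proof -
  have "map \<sigma> (snd (fst r)) = map \<tau> (snd (fst r))" using assms by (auto simp: rule_wf_def)
  then show ?thesis by (simp add: head_idx_def del: map_eq_conv)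
qed

section \<open>Passes over all rules, and rulers of polynomial length\<close>

context datalog_machine
begin

definition pass :: "'c prog" where
  "pass = seqs (map (\<lambda>r. nest [0..<V] (rule_prog r)) Rs)"

definition passB where
  "passB M = sum_list (map (\<lambda>r. Suc (nestB M V (ruleB M r))) Rs) + 1"

definition extend where "extend i = Write i (Work 0) ;; Move i Go_Right"

definition others where "others = [1..<R] @ helpers"

text \<open>After copying the input, two more cells turn the helpers into rulers of length
  \<open>n + 2\<close>. A nest over the \<open>c\<close> helpers then runs
  \<open>(n + 2) ^ c\<close> times and lengthens all working rulers in lockstep. The two cells keep
  the base at least \<open>2\<close>, also for the empty input.\<close>

definition prepare :: "'c prog" where
  "prepare =
    Loop 0 nonblank (seqs (map (\<lambda>i. Copy i 0 ;; Move i Go_Right) others) ;; Move 0 Go_Right) ;;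
    seqs (map (\<lambda>i. extend i ;; extend i ;; rewind i) helpers) ;;
    nest helpers (seqs (map extend [0..<R])) ;;
    seqs (map rewind [0..<R])"

definition prepareB where
  "prepareB n = n * (4 * length others + 4) + 1 + (c * (2 * n + 20) + 1) +
    nestB (n + 2) c (R * 4 + 1) + (R * (2 * (n + (n + 2) ^ c) + 4) + 1) + 3"

definition main :: "'c prog" where
  "main = prepare ;; nest its pass"

definition mainB where
  "mainB n = Suc (prepareB n + nestB (n + (n + 2) ^ c) q (passB (n + (n + 2) ^ c)))"

lemma runs_prepare:
  fixes w :: "'c list"
  defines "n \<equiv> length w"
  defines "M \<equiv> n + (n + 2) ^ c"
  shows "runs (prepareB n) prepare (init_tapes w) (\<lambda>i. if i < R then ruler w M (-1) else
    if i \<in> set helpers then ruler w (n + 2) (-1) else blank_tape)"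
proof -
  have ho: "\<not> i < R" if "i \<in> set helpers" for i using that by (auto simp: helpers_def)
  have R: "0 < R" by (simp add: R_def)
  have dist: "distinct others" "distinct helpers" "0 \<notin> set others" "length helpers = c"
    using ho by (auto simp: others_def helpers_def)
  \<comment> \<open>After \<open>j\<close> rounds each copy is a full ruler for the prefix of length
    \<open>j\<close>, so the notion of ruler also describes partial copies.\<close>
  let ?S1 = "\<lambda>j i. if i = 0 then ruler w n (int j)
    else if i \<in> set others then ruler (take j w) j (int j) else blank_tape"
  have S10: "init_tapes w = ?S1 0"
    by (auto simp: init_tapes_def input_tape_def blank_tape_def ruler_def content_def n_def fun_eq_iff)
  have 1: "runs (n * Suc (Suc ((length others * Suc 3 + 1) + 1)) + 1)
     (Loop 0 nonblank (seqs (map (\<lambda>i. Copy i 0 ;; Move i Go_Right) others) ;; Move 0 Go_Right))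
     (init_tapes w) (?S1 n)"
    unfolding S10
  proof (rule runs_loop)
    fix j assume j: "j < n"
    let ?b = "\<lambda>i. ruler (take (Suc j) w) (Suc j) (int (Suc j))"
    let ?t = "\<lambda>i. if i \<in> set others then ?b i else ?S1 j i"
    have a: "runs (length others * Suc 3 + 1) (seqs (map (\<lambda>i. Copy i 0 ;; Move i Go_Right) others))
      (?S1 j) ?t"
    proof (rule runs_seqs_pointwise[where I = "set others" and ?s0.0 = "?S1 j"])
      fix i and s' :: "'c tapes"
      assume i: "i \<in> set others" and s': "s' i = ?S1 j i" "\<And>k. k \<notin> set others \<Longrightarrow> s' k = ?S1 j k"
      have ne: "i \<noteq> 0" using i dist by metis
      have r: "read_tape (s' 0) = Input (w ! j)"
        using s'(2)[of 0] dist j by (auto simp: ruler_def content_def n_def)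
      let ?u = "s'(i := ruler (take (Suc j) w) (Suc j) (int j))"
      have "(content (take j w) j)(int j := Input (w ! j)) = content (take (Suc j) w) (Suc j)"
        using j by (auto simp: content_def n_def fun_eq_iff nth_append)
      then have "runs 1 (Copy i 0) s' ?u"
        using s'(1) i ne r
        by (intro runs_eq[OF runs_Copy]) (auto simp: write_tape_def ruler_def)
      moreover have "runs 1 (Move i Go_Right) ?u (s'(i := ?b i))"
        by (rule runs_eq[OF runs_Move]) (auto simp: add.commute)
      ultimately have "runs (Suc (1 + 1)) (Copy i 0 ;; Move i Go_Right) s' (s'(i := ?b i))"
        by (rule runs_seq)
      then show "runs 3 (Copy i 0 ;; Move i Go_Right) s' (s'(i := ?b i))"
        by (rule runs_mono) simp
    qed (use dist in auto)
    have b: "runs 1 (Move 0 Go_Right) ?t (?S1 (Suc j))"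
      by (rule runs_eq[OF runs_Move]) (use dist in \<open>auto simp: fun_eq_iff add.commute\<close>)
    show "runs (Suc ((length others * Suc 3 + 1) + 1))
       (seqs (map (\<lambda>i. Copy i 0 ;; Move i Go_Right) others) ;; Move 0 Go_Right) (?S1 j) (?S1 (Suc j))"
      by (rule runs_seq[OF a b])
  qed (auto simp: read_ruler read_ruler_blank)
  have ext: "runs 3 (extend i) s (s(i := ruler w (Suc m) (int (Suc m))))"
    if "s i = ruler w m (int m)" "n \<le> m" for s :: "'c tapes" and i m
  proof -
    let ?u = "s(i := ruler w (Suc m) (int m))"
    have "(content w m)(int m := Work 0) = content w (Suc m)"
      using that(2) by (auto simp: content_def n_def fun_eq_iff)
    then have a: "runs 1 (Write i (Work 0)) s ?u"
      using that by (intro runs_eq[OF runs_Write]) (auto simp: write_tape_def ruler_def)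
    have b: "runs 1 (Move i Go_Right) ?u (s(i := ruler w (Suc m) (int (Suc m))))"
      by (rule runs_eq[OF runs_Move]) (auto simp: add.commute)
    from runs_mono[OF runs_seq[OF a b]] show ?thesis by (simp add: extend_def)
  qed
  have S1n: "?S1 n i = ruler w n (int n)" if "i < R \<or> i \<in> set helpers" for i
    using that by (auto simp: n_def others_def)
  let ?S2 = "\<lambda>i. if i \<in> set helpers then ruler w (n + 2) (-1) else ?S1 n i"
  have 2: "runs (length helpers * Suc (2 * n + 19) + 1)
      (seqs (map (\<lambda>i. extend i ;; extend i ;; rewind i) helpers)) (?S1 n) ?S2"
  proof (rule runs_seqs_pointwise[where I = "set helpers" and ?s0.0 = "?S1 n"])
    fix i and s' :: "'c tapes"
    assume i: "i \<in> set helpers" and s': "s' i = ?S1 n i"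
    let ?u = "s'(i := ruler w (Suc n) (int (Suc n)))"
    let ?v = "s'(i := ruler w (n + 2) (int (n + 2)))"
    have a: "runs 3 (extend i) s' ?u" by (rule ext) (use i s' S1n in auto)
    have b: "runs 3 (extend i) ?u ?v" by (rule runs_eq[OF ext[of ?u i "Suc n"]]) auto
    have c: "runs (2 * (n + 2) + 3) (rewind i) ?v (s'(i := ruler w (n + 2) (-1)))"
      by (rule runs_eq[OF runs_rewind[of ?v i w "n + 2"]]) auto
    show "runs (2 * n + 19) (extend i ;; extend i ;; rewind i) s' (s'(i := ruler w (n + 2) (-1)))"
      by (rule runs_mono[OF runs_seq[OF a runs_seq[OF b c]]]) simp
  qed (use dist in auto)
  let ?I = "\<lambda>j s. \<forall>i. i \<notin> set helpers \<longrightarrow>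
    s i = (if i < R then ruler w (n + j) (int (n + j)) else blank_tape)"
  let ?f = "\<lambda>i. ruler w (n + 2) (-1)"
  have H: "hoare (nestB (n + 2) (length helpers) (R * 4 + 1)) (\<lambda>s. (\<forall>x\<in>set helpers. s x = ?f x) \<and>
    ?I 0 s)
     (nest helpers (seqs (map extend [0..<R])))
     (\<lambda>s. (\<forall>x\<in>set helpers. s x = ?f x) \<and> ?I (0 + (n + 2) ^ length helpers) s)"
  proof (rule hoare_nest_count)
    fix j f
    show "hoare (R * 4 + 1) (\<lambda>s. (\<forall>x\<in>set helpers. s x = f x) \<and> ?I j s)
       (seqs (map extend [0..<R])) (\<lambda>s. (\<forall>x\<in>set helpers. s x = f x) \<and> ?I (Suc j) s)"
    proof (rule hoareI)
      fix s assume s: "(\<forall>x\<in>set helpers. s x = f x) \<and> ?I j s"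
      let ?s = "\<lambda>i. if i \<in> set [0..<R] then ruler w (Suc (n + j)) (int (Suc (n + j))) else s i"
      have "runs (length [0..<R] * Suc 3 + 1) (seqs (map extend [0..<R])) s ?s"
      proof (rule runs_seqs_pointwise[where I = "{..<R}" and ?s0.0 = s])
        fix i and s' :: "'c tapes" assume i: "i \<in> {..<R}" "s' i = s i"
        moreover from this have "i \<notin> set helpers" using ho by blast
        ultimately have "s' i = ruler w (n + j) (int (n + j))" using s by simp
        then show "runs 3 (extend i) s' (s'(i := ruler w (Suc (n + j)) (int (Suc (n + j)))))"
          by (rule ext) simp
      qed auto
      moreover have "(\<forall>x\<in>set helpers. ?s x = f x) \<and> ?I (Suc j) ?s" using s ho by auto
      ultimately show "\<exists>s'. runs (R * 4 + 1) (seqs (map extend [0..<R])) s s' \<and>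
          (\<forall>x\<in>set helpers. s' x = f x) \<and> ?I (Suc j) s'"
        by (intro exI[of _ ?s]) simp
    qed
  qed (use dist in auto)
  have S2: "(\<forall>x\<in>set helpers. ?S2 x = ?f x) \<and> ?I 0 ?S2"
    using S1n R by (auto simp: others_def)
  obtain s3 where 3: "runs (nestB (n + 2) (length helpers) (R * 4 + 1))
      (nest helpers (seqs (map extend [0..<R]))) ?S2 s3"
    and s3: "\<forall>x\<in>set helpers. s3 x = ?f x" "?I (0 + (n + 2) ^ length helpers) s3"
    using hoareD[OF H, of ?S2, OF S2] by blast
  let ?S4 = "\<lambda>i. if i \<in> set [0..<R] then ruler w M (-1) else s3 i"
  have 4: "runs (length [0..<R] * Suc (2 * M + 3) + 1) (seqs (map rewind [0..<R])) s3 ?S4"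
  proof (rule runs_seqs_pointwise[where I = "{..<R}" and ?s0.0 = s3])
    fix i and s' :: "'c tapes" assume i: "i \<in> {..<R}" "s' i = s3 i"
    moreover from this have "i \<notin> set helpers" using ho by blast
    ultimately have "s' i = ruler w M (int M)" using s3(2) dist(4) by (simp add: M_def)
    then show "runs (2 * M + 3) (rewind i) s' (s'(i := ruler w M (-1)))" by (rule runs_rewind)
  qed auto
  have "?S4 = (\<lambda>i. if i < R then ruler w M (-1) else
    if i \<in> set helpers then ruler w (n + 2) (-1) else blank_tape)"
    using s3 by (auto simp: fun_eq_iff)
  then show ?thesis unfolding prepare_def
    by (rule runs_eq[OF runs_mono[OF runs_seq[OF 1 runs_seq[OF 2 runs_seq[OF 3 4]]]], rotated])
      (use dist in \<open>auto simp: prepareB_def M_def algebra_simps\<close>)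
qed

end

section \<open>Least fixpoints by iterated passes\<close>

context datalog_run
begin

definition step_closed where
  "step_closed S \<longleftrightarrow> (\<forall>r\<in>set Rs. \<forall>\<sigma>. (\<forall>x<V. \<sigma> x < M) \<longrightarrow> body_holds M w S \<sigma> r \<longrightarrow> head_idx M \<sigma> r \<in> S)"

definition good where
  "good T s \<longleftrightarrow> tables T s \<and> (\<exists>b. s flag = flagt b)"

lemma good_upd: "good T s \<Longrightarrow> i < V \<or> i \<in> set its \<Longrightarrow> good T (s(i := v))"
  by (auto simp: good_def tables_def layout scratch_def)

definition idle where
  "idle f s \<longleftrightarrow> (\<forall>x<V. s x = ruler w M (-1)) \<and> (\<forall>x\<in>set its. s x = f x)"

text \<open>Facts written early in a pass are visible later in it, so the new table is not the exact
  one-step image of \<open>T0\<close>. It is enclosed instead: it contains the consequences of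
  \<open>T0\<close> and stays inside the closed set \<open>S\<close>. The monotone predicate
  \<open>P\<close> carries along what earlier rules have achieved.\<close>

lemma hoare_rule:
  assumes r: "r \<in> set Rs" and S: "step_closed S" and P: "\<And>T T'. P T \<Longrightarrow> T \<subseteq> T' \<Longrightarrow> P T'"
  shows "hoare (nestB M V (ruleB M r))
    (\<lambda>s. idle f s \<and> (\<exists>T. good T s \<and> T0 \<subseteq> T \<and> T \<subseteq> S \<and> P T))
    (nest [0..<V] (rule_prog r))
    (\<lambda>s. idle f s \<and> (\<exists>T. good T s \<and> T0 \<subseteq> T \<and> T \<subseteq> S \<and>
      (\<forall>\<sigma>. (\<forall>x<V. \<sigma> x < M) \<longrightarrow> body_holds M w T0 \<sigma> r \<longrightarrow> head_idx M \<sigma> r \<in> T) \<and>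
      P T))"
proof -
  let ?I = "\<lambda>D s. (\<forall>x\<in>set its. s x = f x) \<and> (\<exists>T. good T s \<and> T0 \<subseteq> T \<and> T \<subseteq> S \<and>
    (\<forall>\<sigma>\<in>D. body_holds M w T0 \<sigma> r \<longrightarrow> head_idx M \<sigma> r \<in> T) \<and> P T)"
  let ?D = "{\<tau>. (\<forall>x. x \<notin> set [0..<V] \<longrightarrow> \<tau> x = (0::nat)) \<and> (\<forall>x\<in>set [0..<V]. \<tau> x < M)}"
  have its: "\<not> i < V" if "i \<in> set its" for i using that by (auto simp: its_def)
  have "hoare (nestB M (length [0..<V]) (ruleB M r))
    (\<lambda>s. (\<forall>x\<in>{..<V}. s x = ruler w M (if x \<in> set [0..<V] then -1 else int 0)) \<and> ?I {} s)
    (nest [0..<V] (rule_prog r))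
    (\<lambda>s. (\<forall>x\<in>{..<V}. s x = ruler w M (if x \<in> set [0..<V] then -1 else int 0)) \<and> ?I ({} \<union> ?D) s)"
  proof (rule hoare_nest_all[where \<sigma> = "\<lambda>_. 0"])
    fix \<sigma> :: "nat \<Rightarrow> nat" and D assume \<sigma>: "\<And>x. x \<in> {..<V} \<Longrightarrow> \<sigma> x < M"
    show "hoare (ruleB M r) (\<lambda>s. (\<forall>x\<in>{..<V}. s x = ruler w M (int (\<sigma> x))) \<and> ?I D s) (rule_prog r)
      (\<lambda>s. (\<forall>x\<in>{..<V}. s x = ruler w M (int (\<sigma> x))) \<and> ?I (insert \<sigma> D) s)"
    proof (rule hoareI)
      fix s assume s: "(\<forall>x\<in>{..<V}. s x = ruler w M (int (\<sigma> x))) \<and> ?I D s"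
      then obtain T where T: "good T s" "T0 \<subseteq> T" "T \<subseteq> S"
        "\<forall>\<sigma>\<in>D. body_holds M w T0 \<sigma> r \<longrightarrow> head_idx M \<sigma> r \<in> T" "P T" by blast
      have v: "vars \<sigma> s" using s \<sigma> by (auto simp: vars_def)
      define T1 where "T1 = T \<union> {h. body_holds M w T \<sigma> r \<and> h = head_idx M \<sigma> r}"
      obtain s' where s': "runs (ruleB M r) (rule_prog r) s s'" "vars \<sigma> s'" "\<exists>b. s' flag = flagt b"
        "tables T1 s'" "\<And>i. i \<in> set its \<Longrightarrow> s' i = s i"
        using runs_rule[OF r _ v, of T] T(1) unfolding good_def T1_def by blast
      have "?I (insert \<sigma> D) s'"
      proof (rule conjI, goal_cases)
        case 2
        have "T1 \<subseteq> S" using S T(3) r \<sigma> body_holds_mono[of M w T \<sigma> r S]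
          unfolding step_closed_def T1_def by auto
        moreover have "good T1 s'" using s' by (auto simp: good_def)
        moreover have "\<forall>\<tau>\<in>insert \<sigma> D. body_holds M w T0 \<tau> r \<longrightarrow> head_idx M \<tau> r \<in> T1"
          using T(2,4) body_holds_mono[of M w T0 \<sigma> r T] unfolding T1_def by auto
        moreover have "T0 \<subseteq> T1" "T \<subseteq> T1" using T(2) unfolding T1_def by blast+
        ultimately show ?case using P[OF T(5)] by (intro exI[of _ T1]) simp
      qed (use s s'(5) in simp)
      then show "\<exists>s'. runs (ruleB M r) (rule_prog r) s s' \<and>
          (\<forall>x\<in>{..<V}. s' x = ruler w M (int (\<sigma> x))) \<and> ?I (insert \<sigma> D) s'"
        using s'(1,2) by (intro exI[of _ s']) (auto simp: vars_def)
    qed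
  next
    fix D s v x assume "x \<in> {..<V}" "?I D s"
    then show "?I D (s(x := v))" using its good_upd[of _ s x v] by auto
  next
    fix D D' :: "(nat \<Rightarrow> nat) set" and s assume "?I D s" "D' \<subseteq> D"
    then show "?I D' s" by blast
  qed auto
  then show ?thesis
  proof (rule hoare_conseq)
    fix s assume s: "idle f s \<and> (\<exists>T. good T s \<and> T0 \<subseteq> T \<and> T \<subseteq> S \<and> P T)"
    then show "(\<forall>x\<in>{..<V}. s x = ruler w M (if x \<in> set [0..<V] then -1 else int 0)) \<and> ?I {} s"
      by (simp add: idle_def)
  next
    fix s assume s: "(\<forall>x\<in>{..<V}. s x = ruler w M (if x \<in> set [0..<V] then -1 else int 0)) \<and>
      ?I ({} \<union> ?D) s"
    then obtain T where T: "good T s" "T0 \<subseteq> T" "T \<subseteq> S"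
        "\<forall>\<sigma>\<in>?D. body_holds M w T0 \<sigma> r \<longrightarrow> head_idx M \<sigma> r \<in> T" "P T" by blast
    have "head_idx M \<sigma> r \<in> T" if \<sigma>: "\<forall>x<V. \<sigma> x < M" "body_holds M w T0 \<sigma> r" for \<sigma>
    proof -
      \<comment> \<open>The loops enumerate only the variables below \<open>V\<close>; the visited
        assignments are \<open>0\<close> elsewhere, so the given one is cut down to that
        form.\<close>
      let ?\<tau> = "\<lambda>x. if x < V then \<sigma> x else 0"
      have b: "body_holds M w T0 ?\<tau> r"
        using \<sigma>(2) by (rule body_holds_cong[OF rules[OF r], THEN iffD1, rotated]) simp
      have h: "head_idx M ?\<tau> r = head_idx M \<sigma> r"
        by (rule head_idx_cong[OF rules[OF r]]) simp
      have "?\<tau> \<in> ?D" using \<sigma>(1) by simp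
      with T(4) have "body_holds M w T0 ?\<tau> r \<longrightarrow> head_idx M ?\<tau> r \<in> T" by (rule bspec)
      with b h show ?thesis by simp
    qed
    then have "\<forall>\<sigma>. (\<forall>x<V. \<sigma> x < M) \<longrightarrow> body_holds M w T0 \<sigma> r \<longrightarrow> head_idx M \<sigma> r \<in> T" by simp
    moreover have "idle f s" using s by (simp add: idle_def)
    ultimately show "idle f s \<and> (\<exists>T. good T s \<and> T0 \<subseteq> T \<and> T \<subseteq> S \<and>
      (\<forall>\<sigma>. (\<forall>x<V. \<sigma> x < M) \<longrightarrow> body_holds M w T0 \<sigma> r \<longrightarrow> head_idx M \<sigma> r \<in> T) \<and>
      P T)"
      using T(1-3,5) by (intro conjI exI[of _ T])
  qed simp
qed

lemma hoare_rules:
  assumes S: "step_closed S" and "set rs \<subseteq> set Rs"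
  shows "hoare (sum_list (map (\<lambda>r. Suc (nestB M V (ruleB M r))) rs) + 1)
    (\<lambda>s. idle f s \<and> (\<exists>T. good T s \<and> T0 \<subseteq> T \<and> T \<subseteq> S \<and>
      (\<forall>r\<in>D. \<forall>\<sigma>. (\<forall>x<V. \<sigma> x < M) \<longrightarrow> body_holds M w T0 \<sigma> r \<longrightarrow> head_idx M \<sigma> r \<in> T)))
    (seqs (map (\<lambda>r. nest [0..<V] (rule_prog r)) rs))
    (\<lambda>s. idle f s \<and> (\<exists>T. good T s \<and> T0 \<subseteq> T \<and> T \<subseteq> S \<and>
      (\<forall>r\<in>D \<union> set rs. \<forall>\<sigma>. (\<forall>x<V. \<sigma> x < M) \<longrightarrow> body_holds M w T0 \<sigma> r \<longrightarrow> head_idx M \<sigma> r \<in> T)))"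
  using assms(2)
proof (induction rs arbitrary: D)
  case Nil
  show ?case by (rule hoareI) (use runs_Skip in auto)
next
  case (Cons r rs)
  let ?P = "\<lambda>D T. \<forall>r\<in>D. \<forall>\<sigma>. (\<forall>x<V. \<sigma> x < M) \<longrightarrow> body_holds M w T0 \<sigma> r \<longrightarrow> head_idx M \<sigma> r \<in> T"
  have "hoare (nestB M V (ruleB M r))
    (\<lambda>s. idle f s \<and> (\<exists>T. good T s \<and> T0 \<subseteq> T \<and> T \<subseteq> S \<and> ?P D T)) (nest [0..<V] (rule_prog r))
    (\<lambda>s. idle f s \<and> (\<exists>T. good T s \<and> T0 \<subseteq> T \<and> T \<subseteq> S \<and> ?P (insert r D) T))"
  proof (rule hoare_conseq[OF hoare_rule[OF _ S, of r "?P D" f T0]])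
    show "r \<in> set Rs" using Cons.prems by simp
    show "?P D T'" if "?P D T" "T \<subseteq> T'" for T T' using that by blast
  qed (auto simp: conj_assoc)
  from hoare_seq[OF this Cons.IH[of "insert r D"]] Cons.prems show ?case
    by (simp add: add.assoc)
qed

lemma hoare_pass:
  assumes S: "step_closed S"
  shows "hoare (passB M) (\<lambda>s. idle f s \<and> good T0 s \<and> T0 \<subseteq> S) pass
    (\<lambda>s. idle f s \<and> (\<exists>T. good T s \<and> T0 \<subseteq> T \<and> T \<subseteq> S \<and>
      (\<forall>r\<in>set Rs. \<forall>\<sigma>. (\<forall>x<V. \<sigma> x < M) \<longrightarrow> body_holds M w T0 \<sigma> r \<longrightarrow> head_idx M \<sigma> r \<in> T)))"
  unfolding pass_def passB_def
  by (rule hoare_conseq[OF hoare_rules[OF S subset_refl, of f T0 "{}"]]) auto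

text \<open>While the table is not closed, every pass adds a fact of \<open>S\<close>. More passes
  than \<open>S\<close> has elements therefore end in a closed table, without any test for
  stability.\<close>

lemma hoare_iterate:
  assumes S: "step_closed S" "finite S" "card S < M ^ q"
  shows "hoare (nestB M q (passB M)) (\<lambda>s. idle (\<lambda>_. ruler w M (-1)) s \<and> good {} s) (nest its pass)
    (\<lambda>s. \<exists>T. good T s \<and> T \<subseteq> S \<and> step_closed T)"
proof -
  let ?I = "\<lambda>j s. (\<forall>x<V. s x = ruler w M (-1)) \<and>
    (\<exists>T. good T s \<and> T \<subseteq> S \<and> (j \<le> card T \<or> step_closed T))"
  have its: "\<not> i < V" if "i \<in> set its" for i using that by (auto simp: its_def)
  have "hoare (nestB M (length its) (passB M)) (\<lambda>s. (\<forall>x\<in>set its. s x = (\<lambda>_. ruler w M (-1)) x) \<and> ?I 0 s)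
    (nest its pass) (\<lambda>s. (\<forall>x\<in>set its. s x = (\<lambda>_. ruler w M (-1)) x) \<and> ?I (0 + M ^ length its) s)"
  proof (rule hoare_nest_count)
    fix j f
    show "hoare (passB M) (\<lambda>s. (\<forall>x\<in>set its. s x = f x) \<and> ?I j s) pass
      (\<lambda>s. (\<forall>x\<in>set its. s x = f x) \<and> ?I (Suc j) s)"
    proof (rule hoareI)
      fix s assume s: "(\<forall>x\<in>set its. s x = f x) \<and> ?I j s"
      then obtain T0 where T0: "good T0 s" "T0 \<subseteq> S" "j \<le> card T0 \<or> step_closed T0" by blast
      have idle: "idle f s" using s by (auto simp: idle_def)
      show "\<exists>s'. runs (passB M) pass s s' \<and> (\<forall>x\<in>set its. s' x = f x) \<and> ?I (Suc j) s'"
      proof (cases "step_closed T0")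
        case True
        \<comment> \<open>Taking \<open>T0\<close> itself as the upper bound squeezes the result: a
          pass does not change a closed table.\<close>
        obtain s' T where "runs (passB M) pass s s'" "idle f s'" "good T s'" "T0 \<subseteq> T" "T \<subseteq> T0"
          using hoareD[OF hoare_pass[OF True, of f T0], of s] idle T0 by blast
        then show ?thesis using True T0 by (intro exI[of _ s']) (auto simp: idle_def)
      next
        case False
        obtain s' T where s': "runs (passB M) pass s s'" "idle f s'" "good T s'" "T0 \<subseteq> T" "T \<subseteq> S"
          "\<forall>r\<in>set Rs. \<forall>\<sigma>. (\<forall>x<V. \<sigma> x < M) \<longrightarrow> body_holds M w T0 \<sigma> r \<longrightarrow> head_idx M \<sigma> r \<in> T"
          using hoareD[OF hoare_pass[OF S(1), of f T0], of s] idle T0 by blast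
        with False have "T0 \<noteq> T" unfolding step_closed_def by blast
        then have "card T0 < card T" using s'(4,5) S(2)
          by (meson finite_subset psubsetI psubset_card_mono)
        then have "Suc j \<le> card T" using T0(3) False by simp
        then show ?thesis using s' by (intro exI[of _ s']) (auto simp: idle_def)
      qed
    qed
  next
    fix j s v x assume "x \<in> set its" "?I j s"
    then obtain T where T: "good T s" "T \<subseteq> S \<and> (j \<le> card T \<or> step_closed T)"
      and s: "\<forall>x<V. s x = ruler w M (-1)" by blast
    have "good T (s(x := v))" using T(1) \<open>x \<in> set its\<close> by (simp add: good_upd)
    moreover have "\<forall>y<V. (s(x := v)) y = ruler w M (-1)" using s its[OF \<open>x \<in> set its\<close>] by auto
    ultimately show "?I j (s(x := v))" using T(2) by blast
  qed (auto simp: its_def)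
  moreover have "length its = q" by (simp add: its_def)
  ultimately show ?thesis
  proof (elim hoare_conseq, goal_cases)
    case (1 s)
    then show ?case by (auto simp: idle_def)
  next
    case (2 s)
    then obtain T where T: "good T s" "T \<subseteq> S" "M ^ q \<le> card T \<or> step_closed T" by auto
    then show ?case using S card_mono[of S T] by auto
  qed auto
qed

end

section \<open>Datalog programs run in polynomial time\<close>

lemma prog_wf_seqs: "prog_wf K (seqs cs) \<longleftrightarrow> (\<forall>c\<in>set cs. prog_wf K c)"
  by (induction cs) auto

lemma prog_wf_rewind [simp]: "prog_wf K (rewind x) \<longleftrightarrow> x < K"
  by (auto simp: rewind_def)

lemma prog_wf_nest [simp]: "prog_wf K (nest xs c) \<longleftrightarrow> set xs \<subseteq> {..<K} \<and> prog_wf K c"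
  by (induction xs) (auto simp: For_def)

lemma prog_wf_walk [simp]: "prog_wf K (walk x d c) \<longleftrightarrow> x < K \<and> d < K \<and> prog_wf K c"
  by (auto simp: walk_def)

lemma prog_wf_seek:
  "y < K \<Longrightarrow> d < K \<Longrightarrow> set cs \<subseteq> {..<K} \<Longrightarrow> set xs \<subseteq> {..<K} \<Longrightarrow> prog_wf K (seek dir y d cs xs)"
  by (induction xs) (auto dest: in_set_takeD)

text \<open>Being bounded by a polynomial, rather than being one, passes through the recursively
  defined time bounds rule by rule.\<close>

definition poly_bounded :: "(nat \<Rightarrow> nat) \<Rightarrow> bool" where
  "poly_bounded f \<longleftrightarrow> (\<exists>p :: nat poly. \<forall>n. f n \<le> poly p n)"

named_theorems poly_bounded

lemma poly_bounded_id [poly_bounded]: "poly_bounded (\<lambda>n. n)"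
  unfolding poly_bounded_def by (rule exI[of _ "[:0, 1:]"]) simp

lemma poly_bounded_const [poly_bounded]: "poly_bounded (\<lambda>n. k)"
  unfolding poly_bounded_def by (rule exI[of _ "[:k:]"]) simp

lemma poly_bounded_add [poly_bounded]:
  "poly_bounded f \<Longrightarrow> poly_bounded g \<Longrightarrow> poly_bounded (\<lambda>n. f n + g n)"
  unfolding poly_bounded_def by (metis add_mono poly_add)

lemma poly_bounded_Suc [poly_bounded]: "poly_bounded f \<Longrightarrow> poly_bounded (\<lambda>n. Suc (f n))"
  using poly_bounded_add[of f "\<lambda>_. 1"] poly_bounded_const by auto

lemma poly_bounded_mult [poly_bounded]:
  "poly_bounded f \<Longrightarrow> poly_bounded g \<Longrightarrow> poly_bounded (\<lambda>n. f n * g n)"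
  unfolding poly_bounded_def by (metis mult_le_mono poly_mult)

lemma poly_bounded_power [poly_bounded]: "poly_bounded f \<Longrightarrow> poly_bounded (\<lambda>n. f n ^ k)"
  by (induction k) (auto intro: poly_bounded)

lemma poly_bounded_nestB [poly_bounded]:
  "poly_bounded f \<Longrightarrow> poly_bounded g \<Longrightarrow> poly_bounded (\<lambda>n. nestB (f n) k (g n))"
  by (induction k) (auto intro!: poly_bounded)

lemma poly_bounded_walkB [poly_bounded]:
  "poly_bounded f \<Longrightarrow> poly_bounded g \<Longrightarrow> poly_bounded (\<lambda>n. walkB (f n) (g n))"
  unfolding walkB_def by (intro poly_bounded)

lemma poly_bounded_seekB [poly_bounded]: "poly_bounded f \<Longrightarrow> poly_bounded (\<lambda>n. seekB (f n) k)"
  by (induction k) (auto intro!: poly_bounded)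

context datalog_machine
begin

lemma poly_bounded_ruleB [poly_bounded]: "poly_bounded f \<Longrightarrow> poly_bounded (\<lambda>n. ruleB (f n) r)"
  unfolding ruleB_def testB_def by (intro poly_bounded)

lemma poly_bounded_passB [poly_bounded]: "poly_bounded f \<Longrightarrow> poly_bounded (\<lambda>n. passB (f n))"
proof -
  assume f: "poly_bounded f"
  have "poly_bounded (\<lambda>n. sum_list (map (\<lambda>r. Suc (nestB (f n) V (ruleB (f n) r))) rs))" for rs
  proof (induction rs)
    case (Cons r rs)
    then show ?case using f by (auto intro!: poly_bounded)
  qed (simp add: poly_bounded)
  then show ?thesis unfolding passB_def by (intro poly_bounded)
qed

lemma poly_bounded_mainB: "poly_bounded mainB"
  unfolding mainB_def prepareB_def by (intro poly_bounded)

lemma prog_wf_main: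
  assumes "\<And>p. p \<in> PS \<Longrightarrow> num p < P"
  shows "prog_wf (R + 1 + c + P) main"
proof -
  let ?K = "R + 1 + c + P"
  have s: "set [0..<V] \<subseteq> {..<?K}" "set its \<subseteq> {..<?K}" "set cs \<subseteq> {..<?K}" "set helpers \<subseteq> {..<?K}"
    "set others \<subseteq> {..<?K}" "scr < ?K" "cmp < ?K" "flag < ?K" "\<And>i. i < V \<Longrightarrow> i < ?K"
    by (auto simp: layout others_def)
  have tb: "tb p < ?K" if "p \<in> PS" for p using assms[OF that] by (simp add: tb_def)
  have seek: "prog_wf ?K (seek dir (tb p) scr cs xs)" if "p \<in> PS" "set xs \<subseteq> {..<V}" for p xs dir
  proof (rule prog_wf_seek)
    show "set xs \<subseteq> {..<?K}" using that(2) by (auto simp: layout)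
  qed (use that s(3,6) tb in auto)
  have test: "prog_wf ?K (test l)" if "lit_wf V PS ar l" for l
    using that s(6-9) tb seek by (cases l) (auto simp: clear_def)
  have "prog_wf ?K (rule_prog r)" if r: "r \<in> set Rs" for r
    using rules[OF r] s(6-9) tb seek test
    by (auto simp: rule_prog_def rule_wf_def prog_wf_seqs split: prod.split)
  then have "prog_wf ?K pass" using s(1) by (auto simp: pass_def prog_wf_seqs)
  moreover have "prog_wf ?K prepare"
    using s(4,5) by (auto simp: prepare_def prog_wf_seqs extend_def)
  ultimately show ?thesis using s(2) by (auto simp: main_def)
qed

end

context datalog_run
begin

text \<open>A closed table, read back through \<open>idx\<close>, is a closed set of facts and so
  contains the least fixpoint.\<close>

lemma idx_closed_iff:
  assumes "step_closed T" and g: "g \<in> PS" "ar g = 0" and "(g, []) \<in> datalog (set Rs) w M"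
  shows "(g, 0) \<in> T"
proof -
  let ?F = "{(p, vs). (p, idx M vs) \<in> T}"
  have "datalog_closed (set Rs) w M ?F"
    unfolding datalog_closed_def
  proof (clarify, goal_cases)
    case (1 p xs b \<sigma>)
    have "lit_holds_idx M w T \<sigma> l" if "l \<in> set b" for l
      using 1(3) that by (cases l) auto
    then have "body_holds M w T \<sigma> ((p, xs), b)" by (auto simp: body_holds_def)
    then show ?case using assms(1) 1 by (force simp: step_closed_def head_idx_def)
  qed
  from datalog_least[OF this] assms(4) show ?thesis by auto
qed

text \<open>The least fixpoint as it appears in the tables; it serves as upper bound for all
  passes.\<close>

definition sem where
  "sem = {(p, idx M vs) | p vs. p \<in> PS \<and> length vs = ar p \<and> set vs \<subseteq> {..<M} \<and>
    (p, vs) \<in> datalog (set Rs) w M}"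

text \<open>Injectivity of \<open>idx\<close> is the point: a cell that is set can only come from
  the very tuple that is being tested.\<close>

lemma sem_closed: "step_closed sem"
  unfolding step_closed_def
proof (clarify, goal_cases)
  case (1 p xs b \<sigma>)
  let ?\<tau> = "\<lambda>x. if x < V then \<sigma> x else 0"
  have r: "rule_wf V PS ar ((p, xs), b)" using rules 1 by blast
  have \<tau>: "body_holds M w sem ?\<tau> ((p, xs), b)"
    using 1(3) by (rule body_holds_cong[OF r, THEN iffD1, rotated]) simp
  have lt: "?\<tau> x < M" for x using 1 M by auto
  have "lit_holds w (datalog (set Rs) w M) ?\<tau> l" if l: "l \<in> set b" for l
  proof (cases l)
    case (LAtom p' xs')
    then have wf: "p' \<in> PS" "length xs' = ar p'" "set xs' \<subseteq> {..<V}"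
      using r l LAtom by (auto simp: rule_wf_def dest!: bspec[of _ _ l])
    have "(p', idx M (map ?\<tau> xs')) \<in> sem" using \<tau> l LAtom by (auto simp: body_holds_def)
    then obtain vs where vs: "idx M (map ?\<tau> xs') = idx M vs" "length vs = ar p'" "set vs \<subseteq> {..<M}"
      "(p', vs) \<in> datalog (set Rs) w M" by (auto simp: sem_def)
    have "map ?\<tau> xs' = vs" by (rule idx_inj[of _ _ M]) (use vs wf 1(2) in auto)
    then show ?thesis using vs(4) LAtom by simp
  qed (use bspec[OF \<tau>[unfolded body_holds_def snd_conv] l] in \<open>simp_all split del: if_split\<close>)
  then have "(p, map ?\<tau> xs) \<in> datalog (set Rs) w M"
    using datalog_closed[of "set Rs" w M] 1(1) lt unfolding datalog_closed_def by fastforce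
  then have "head_idx M ?\<tau> ((p, xs), b) \<in> sem"
    using r 1(2) unfolding sem_def head_idx_def
    by (auto simp: rule_wf_def subset_iff intro!: exI[of _ "map ?\<tau> xs"])
  then show ?case using head_idx_cong[OF r, of ?\<tau> \<sigma> M] by simp
qed

text \<open>There are at most \<open>card PS * M ^ a\<close> relevant cells, and
  \<open>card PS < 2 ^ card PS \<le> M ^ card PS\<close>. This explains the choice of
  \<open>q\<close>, and \<open>2 \<le> M\<close> is used here.\<close>

lemma sem_small:
  assumes "finite PS" "q = card PS + a"
  shows "finite sem \<and> card sem < M ^ q"
proof -
  have "idx M vs < M ^ a" if "p \<in> PS" "length vs = ar p" "set vs \<subseteq> {..<M}" for p and vs :: "nat list"
  proof -
    have "M ^ ar p \<le> M ^ a" using ar[OF that(1)] M by (intro power_increasing) auto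
    then show ?thesis using idx_less[OF that(3)] that(2) by simp
  qed
  then have sub: "sem \<subseteq> PS \<times> {..<M ^ a}" by (auto simp: sem_def)
  have "card sem \<le> card PS * M ^ a"
    using card_mono[OF _ sub] assms(1) by (simp add: card_cartesian_product)
  also have "\<dots> < 2 ^ card PS * M ^ a" using M by (intro mult_strict_right_mono) auto
  also have "\<dots> \<le> M ^ card PS * M ^ a" using M by (intro mult_right_mono power_mono) auto
  finally show ?thesis using finite_subset[OF sub] assms by (simp add: power_add)
qed

lemma main_correct:
  assumes "finite PS" "q = card PS + a" "M = length w + (length w + 2) ^ c"
    and g: "g \<in> PS" "ar g = 0"
  obtains t s where "t \<le> mainB (length w)" "run main (init_tapes w) t s"
    "read_tape (s (tb g)) \<in> {Work 1} \<longleftrightarrow> (g, []) \<in> datalog (set Rs) w M"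
proof -
  let ?s = "\<lambda>i. if i < R then ruler w M (-1) else
    if i \<in> set helpers then ruler w (length w + 2) (-1) else (blank_tape :: 'c tape)"
  \<comment> \<open>Blank tapes already stand for a lowered flag and empty tables, so the iteration
    starts from the empty set of facts.\<close>
  have "blank_tape = (flagt False :: 'c tape)" "blank_tape = (tabc {} p, 0 :: int)" for p :: 'p
    by (auto simp: blank_tape_def flagt_def tabc_def fun_eq_iff)
  moreover have "flag \<notin> set helpers" "\<not> flag < R" "tb p \<notin> set helpers" "\<not> tb p < R"
    "i \<in> scratch \<Longrightarrow> i < R" for i p
    by (auto simp: layout scratch_def)
  ultimately have "good {} ?s" unfolding good_def tables_def by auto
  moreover have "idle (\<lambda>_. ruler w M (-1)) ?s" by (auto simp: idle_def layout)
  ultimately obtain s T where s: "runs (nestB M q (passB M)) (nest its pass) ?s s"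
    and T: "good T s" "T \<subseteq> sem" "step_closed T"
    using hoareD[OF hoare_iterate[OF sem_closed], of ?s] sem_small[OF assms(1,2)] by blast
  have "runs (mainB (length w)) main (init_tapes w) s"
    using runs_seq[OF runs_prepare[of w, folded assms(3)] s] assms(3)
    by (simp add: main_def mainB_def)
  moreover have "read_tape (s (tb g)) \<in> {Work 1} \<longleftrightarrow> (g, 0) \<in> T"
    using T(1) g by (auto simp: good_def tables_def tabc_def)
  moreover have "(g, 0) \<in> T \<longleftrightarrow> (g, []) \<in> datalog (set Rs) w M"
    using T idx_closed_iff[OF T(3) g] g by (auto simp: sem_def)
  ultimately show ?thesis using that unfolding runs_def by blast
qed

end

text \<open>The program is fixed, so arities and the depth of all loop nests are constants; only the
  segment length depends on the input, and it does so polynomially.\<close>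

theorem datalog_in_class_P:
  fixes Rs :: "('c, 'p) datalog_rule list"
  assumes wf: "\<And>r. r \<in> set Rs \<Longrightarrow> rule_wf V PS ar r"
    and PS: "finite PS" "g \<in> PS" "ar g = 0" and c: "0 < c"
    and L: "finite \<Sigma>" "L \<subseteq> lists \<Sigma>" "\<And>w. w \<in> lists \<Sigma> \<Longrightarrow>
      w \<in> L \<longleftrightarrow> (g, []) \<in> datalog (set Rs) w (length w + (length w + 2) ^ c)"
  shows "in_class_P \<Sigma> L"
proof -
  obtain num :: "'p \<Rightarrow> nat" where num: "inj_on num PS"
    using finite_imp_inj_to_nat_seg[OF PS(1)] by blast
  define a where "a = Max (ar ` PS)"
  define P where "P = Suc (Max (num ` PS))"
  have P: "num p < P" if "p \<in> PS" for p using PS that by (simp add: P_def le_imp_less_Suc)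
  interpret datalog_machine Rs PS ar num V a "card PS + a" c
    by unfold_locales (use wf num PS in \<open>auto simp: a_def\<close>)
  obtain p :: "nat poly" where p: "mainB n \<le> poly p n" for n
    using poly_bounded_mainB unfolding poly_bounded_def by blast
  show ?thesis
  proof (rule prog_in_class_P[OF L(1,2) prog_wf_main[OF P]])
    show "tb g < R + 1 + c + P" using P PS(2) by (simp add: tb_def)
    fix w assume w: "w \<in> lists \<Sigma>"
    have M: "2 \<le> length w + (length w + 2) ^ c" "length w < length w + (length w + 2) ^ c"
      using self_le_power[of "length w + 2" c] c by auto
    interpret datalog_run Rs PS ar num V a "card PS + a" c w "length w + (length w + 2) ^ c"
      by unfold_locales (use M in auto)
    obtain t s where "t \<le> mainB (length w)" "run main (init_tapes w) t s"
      "read_tape (s (tb g)) \<in> {Work 1} \<longleftrightarrow> w \<in> L"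
      using main_correct[OF PS(1) refl refl PS(2,3)] L(3)[OF w] by metis
    then show "\<exists>t\<le>poly p (length w). \<exists>s. run main (init_tapes w) t s \<and>
        (read_tape (s (tb g)) \<in> {Work 1} \<longleftrightarrow> w \<in> L)"
      using p order_trans by blast
  qed
qed

section \<open>Words in groups\<close>

lemma word_val_Nil [simp]: "word_val G [] = \<one>\<^bsub>G\<^esub>"
  by (simp add: word_val_def group_prod_def)

lemma word_val_Cons [simp]: "word_val G (a # w) = letter_val G a \<otimes>\<^bsub>G\<^esub> word_val G w"
  by (simp add: word_val_def group_prod_def)

definition inv_letter :: "'a letter \<Rightarrow> 'a letter" where
  "inv_letter a = (fst a, \<not> snd a)"

definition inv_word :: "'a letter list \<Rightarrow> 'a letter list" where
  "inv_word w = rev (map inv_letter w)"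

lemma length_inv_word [simp]: "length (inv_word w) = length w"
  by (simp add: inv_word_def)

lemma inv_letter_mem [simp]: "inv_letter a \<in> letters X \<longleftrightarrow> a \<in> letters X"
  by (cases a) (auto simp: inv_letter_def letters_def)

lemma inv_word_mem: "w \<in> lists (letters X) \<Longrightarrow> inv_word w \<in> lists (letters X)"
  by (auto simp: inv_word_def in_lists_conv_set)

context group
begin

lemma letter_val_closed [simp]: "X \<subseteq> carrier G \<Longrightarrow> a \<in> letters X \<Longrightarrow> letter_val G a \<in> carrier G"
  by (cases a) (auto simp: letters_def)

lemma word_val_closed [simp]:
  "X \<subseteq> carrier G \<Longrightarrow> w \<in> lists (letters X) \<Longrightarrow> word_val G w \<in> carrier G"
  by (induction w) auto

lemma word_val_append:
  "X \<subseteq> carrier G \<Longrightarrow> u \<in> lists (letters X) \<Longrightarrow> v \<in> lists (letters X) \<Longrightarrow>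
    word_val G (u @ v) = word_val G u \<otimes> word_val G v"
  by (induction u) (auto simp: m_assoc)

lemma inv_letter_val: "X \<subseteq> carrier G \<Longrightarrow> a \<in> letters X \<Longrightarrow> letter_val G (inv_letter a) =
  inv (letter_val G a)"
  by (cases a) (auto simp: inv_letter_def letters_def)

lemma word_val_inv:
  "X \<subseteq> carrier G \<Longrightarrow> w \<in> lists (letters X) \<Longrightarrow> word_val G (inv_word w) = inv (word_val G w)"
proof (induction w)
  case (Cons a w)
  have w: "w \<in> lists (letters X)" "a \<in> letters X" using Cons.prems by auto
  have "word_val G (inv_word (a # w)) = word_val G (inv_word w @ [inv_letter a])"
    by (simp add: inv_word_def)
  also have "\<dots> = word_val G (inv_word w) \<otimes> word_val G [inv_letter a]"
    using word_val_append[OF Cons.prems(1) inv_word_mem[OF w(1)], of "[inv_letter a]"] w(2) by simp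
  finally show ?case using Cons by (simp add: inv_letter_val inv_mult_group)
qed (simp add: inv_word_def)

lemma word_exists:
  assumes "finite_generating_set G X" "g \<in> carrier G"
  shows "\<exists>w\<in>lists (letters X). word_val G w = g"
proof -
  have X: "X \<subseteq> carrier G" "g \<in> generate G X" using assms by (auto simp: finite_generating_set_def)
  from X(2) show ?thesis
  proof (induction rule: generate.induct)
    case one
    show ?case by (rule bexI[of _ "[]"]) auto
  next
    case (incl h)
    then show ?case using X(1) by (intro bexI[of _ "[(h, True)]"]) (auto simp: letters_def)
  next
    case (inv h)
    then show ?case using X(1) by (intro bexI[of _ "[(h, False)]"]) (auto simp: letters_def)
  next
    case (eng h1 h2)
    then obtain u v where "u \<in> lists (letters X)" "word_val G u = h1"
      "v \<in> lists (letters X)" "word_val G v = h2" by blast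
    then show ?case using X(1) by (intro bexI[of _ "u @ v"]) (auto simp: word_val_append)
  qed
qed

end

locale word_metric = group G for G (structure) +
  fixes S :: "'a set"
  assumes gen: "finite_generating_set G S"
begin

abbreviation len where "len \<equiv> word_length G S"
abbreviation "val \<equiv> word_val G"
abbreviation "Words \<equiv> lists (letters S)"

lemma S: "S \<subseteq> carrier G" "finite S"
  using gen by (auto simp: finite_generating_set_def)

lemma val_closed [simp]: "w \<in> Words \<Longrightarrow> val w \<in> carrier G"
  using S by simp

lemma val_append: "u \<in> Words \<Longrightarrow> v \<in> Words \<Longrightarrow> val (u @ v) = val u \<otimes> val v"
  by (rule word_val_append[OF S(1)])

lemma geodesic_exists:
  assumes "g \<in> carrier G"
  obtains w where "w \<in> Words" "val w = g" "length w = len g"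
proof -
  have "\<exists>n. \<exists>w\<in>Words. val w = g \<and> length w = n" using word_exists[OF gen assms] by blast
  from LeastI_ex[OF this] show ?thesis using that unfolding word_length_def by blast
qed

lemma len_le: "w \<in> Words \<Longrightarrow> len (val w) \<le> length w"
  unfolding word_length_def by (rule Least_le) blast

lemma len_one [simp]: "len \<one> = 0"
  using len_le[of "[]"] by simp

lemma len_mult: "g \<in> carrier G \<Longrightarrow> h \<in> carrier G \<Longrightarrow> len (g \<otimes> h) \<le> len g + len h"
proof -
  assume "g \<in> carrier G" "h \<in> carrier G"
  then obtain u v where "u \<in> Words" "val u = g" "length u = len g" "v \<in> Words" "val v =
    h" "length v = len h"
    by (metis geodesic_exists)
  then show ?thesis using len_le[of "u @ v"] by (auto simp: val_append)
qed

lemma len_inv_le: "g \<in> carrier G \<Longrightarrow> len (inv g) \<le> len g"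
proof -
  assume "g \<in> carrier G"
  then obtain u where "u \<in> Words" "val u = g" "length u = len g" by (metis geodesic_exists)
  then show ?thesis
    using len_le[OF inv_word_mem[of u]] word_val_inv[OF S(1), of u] by auto
qed

lemma len_inv [simp]: "g \<in> carrier G \<Longrightarrow> len (inv g) = len g"
  using len_inv_le[of g] len_inv_le[of "inv g"] by simp

abbreviation d where "d \<equiv> word_dist G S"

lemma dist_one [simp]: "g \<in> carrier G \<Longrightarrow> d \<one> g = len g" "g \<in> carrier G \<Longrightarrow> d g \<one> = len g"
  by (auto simp: word_dist_def)

lemma dist_sym: "g \<in> carrier G \<Longrightarrow> h \<in> carrier G \<Longrightarrow> d g h = d h g"
  using len_inv[of "inv g \<otimes> h"] by (simp add: word_dist_def inv_mult_group)

lemma dist_mult: "g \<in> carrier G \<Longrightarrow> h \<in> carrier G \<Longrightarrow> d g (g \<otimes> h) = len h"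
  by (simp add: word_dist_def flip: m_assoc)

lemma len_diff: "g \<in> carrier G \<Longrightarrow> h \<in> carrier G \<Longrightarrow> real (len h) \<le> len g + d g h"
  using len_mult[of g "inv g \<otimes> h"] by (simp add: word_dist_def inv_solve_left flip: m_assoc of_nat_add)

section \<open>Local geodesics\<close>

definition local_geodesic :: "nat \<Rightarrow> 'a letter list \<Rightarrow> bool" where
  "local_geodesic k w \<longleftrightarrow> (\<forall>a x b. w = a @ x @ b \<longrightarrow> length x \<le> k \<longrightarrow> len (val x) = length x)"

text \<open>The finite, length-reducing rewriting system of Dehn's algorithm at scale
  \<open>k\<close>.\<close>

definition shortening :: "nat \<Rightarrow> ('a letter list \<times> 'a letter list) set" where
  "shortening k = {(x, y). x \<in> Words \<and> y \<in> Words \<and> length x \<le> k \<and> length y < length x \<and> val x = val y}"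

definition shorten :: "nat \<Rightarrow> ('a letter list \<times> 'a letter list) set" where
  "shorten k = {(a @ x @ b, a @ y @ b) | a b x y. a \<in> Words \<and> b \<in> Words \<and> (x, y) \<in> shortening k}"

lemma finite_shortening: "finite (shortening k)"
proof -
  have "finite (letters S)" using S by (simp add: letters_def)
  then have fin: "finite {x. set x \<subseteq> letters S \<and> length x \<le> k}" (is "finite ?A")
    by (rule finite_lists_length_le)
  have "shortening k \<subseteq> ?A \<times> ?A" by (auto simp: shortening_def in_lists_conv_set)
  then show ?thesis using fin by (blast intro: finite_subset finite_cartesian_product)
qed

lemma shorten_sound:
  "(u, v) \<in> shorten k \<Longrightarrow> u \<in> Words \<and> v \<in> Words \<and> val u = val v \<and> length v < length u"
proof -
  assume "(u, v) \<in> shorten k"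
  then obtain a b x y where uv: "u = a @ x @ b" "v = a @ y @ b"
    and W: "a \<in> Words" "b \<in> Words" "x \<in> Words" "y \<in> Words"
    and xy: "length y < length x" "val x = val y"
    unfolding shorten_def shortening_def by blast
  have "x @ b \<in> Words" "y @ b \<in> Words" using W by auto
  then show ?thesis
    using W xy val_append[of a "x @ b"] val_append[of a "y @ b"] val_append[of x b] val_append[of y b]
    unfolding uv by simp
qed

text \<open>A subword of length at most \<open>k\<close> that is not geodesic can be exchanged for a
  geodesic one, and every exchange shortens the word.\<close>

lemma shorten_local_geodesic:
  "u \<in> Words \<Longrightarrow> \<exists>v. (u, v) \<in> (shorten k)\<^sup>* \<and> local_geodesic k v"
proof (induction "length u" arbitrary: u rule: less_induct)
  case less
  show ?case
  proof (cases "local_geodesic k u")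
    case False
    then obtain a x b where u: "u = a @ x @ b" "length x \<le> k" "len (val x) \<noteq> length x"
      unfolding local_geodesic_def by blast
    then have x: "x \<in> Words" "a \<in> Words" "b \<in> Words" using less.prems by auto
    obtain y where y: "y \<in> Words" "val y = val x" "length y = len (val x)"
      using geodesic_exists[OF val_closed[OF x(1)]] by metis
    have "(x, y) \<in> shortening k"
      using len_le[OF x(1)] x y u unfolding shortening_def by auto
    then have step: "(u, a @ y @ b) \<in> shorten k" using x u unfolding shorten_def by blast
    with less.hyps[of "a @ y @ b"] shorten_sound[OF step] show ?thesis
      by (meson converse_rtrancl_into_rtrancl)
  qed blast
qed

lemma shorten_rtrancl:
  "(u, v) \<in> (shorten k)\<^sup>* \<Longrightarrow> u \<in> Words \<Longrightarrow> v \<in> Words \<and> val u = val v \<and> length v \<le> length u"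
  by (induction rule: rtrancl_induct) (auto dest: shorten_sound)

end

locale hyperbolic = word_metric +
  fixes \<delta> :: real
  assumes \<delta>: "0 \<le> \<delta>"
    and hyp: "\<And>x y z w. x \<in> carrier G \<Longrightarrow> y \<in> carrier G \<Longrightarrow> z \<in> carrier G \<Longrightarrow> w \<in> carrier G \<Longrightarrow>
      gromov_product d x y w \<ge> min (gromov_product d x z w) (gromov_product d z y w) - \<delta>"
begin

lemma four_point:
  assumes "x \<in> carrier G" "y \<in> carrier G" "z \<in> carrier G" "w \<in> carrier G"
  shows "d z w + d x y \<le> max (d x w + d z y) (d y w + d x z) + 2 * \<delta>"
  using hyp[OF assms] unfolding gromov_product_def by (auto simp: min_def max_def field_simps split:
    if_splits)

text \<open>Apply the four-point condition to the start and to three points at distance \<open>t\<close> along the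
  word: the distances of the two outer points cannot both be smaller than that of the middle one.\<close>

lemma local_geodesic_grows:
  assumes w: "w \<in> Words" "local_geodesic k w" and t: "2 * \<delta> + 1 \<le> real t" "2 * t \<le> k"
    and "Suc j * t \<le> length w"
  shows "len (val (take (j * t) w)) + 1 \<le> len (val (take (Suc j * t) w))"
  using assms(5)
proof (induction j)
  case 0
  have "len (val (take t w)) = length (take t w)"
    using w(2) t(2) append_take_drop_id[of t w] unfolding local_geodesic_def
    by (metis append_Nil append_take_drop_id length_take min.cobounded2 mult_2 add_leE order_trans)
  then show ?case using 0 t(1) \<delta> by simp
next
  case (Suc j)
  let ?p = "\<lambda>i. val (take i w)"
  have sub: "d (?p i) (?p (i + m)) = m" if "i + m \<le> length w" "m \<le> k" for i m
  proof -
    have tk: "take (i + m) w = take i w @ take m (drop i w)" by (rule take_add)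
    have W: "take i w \<in> Words" "take m (drop i w) \<in> Words"
      using w(1) by (auto simp: in_lists_conv_set dest: in_set_takeD in_set_dropD)
    have "w = take i w @ take m (drop i w) @ drop m (drop i w)" by (metis append_take_drop_id)
    then have "len (val (take m (drop i w))) = length (take m (drop i w))"
      using w(2) that(2) unfolding local_geodesic_def by (metis length_take min.coboundedI2)
    then show ?thesis using that W unfolding tk by (simp add: val_append dist_mult)
  qed
  have W: "take i w \<in> Words" for i using w(1) by (auto simp: in_lists_conv_set dest: in_set_takeD)
  have e: "Suc j * t = j * t + t" "Suc (Suc j) * t = (j * t + t) + t" "Suc (Suc j) * t = j * t + 2 * t"
    by simp_all
  let ?x = "?p (j * t)" and ?z = "?p (Suc j * t)" and ?y = "?p (Suc (Suc j) * t)"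
  have 1: "d ?x ?z = t" "d ?z ?y = t" "d ?x ?y = real (2 * t)"
    using sub[of "j * t" t] sub[of "j * t + t" t] sub[of "j * t" "2 * t", folded e(3)] Suc.prems t(2)
    unfolding e(1,2) by linarith+
  have 2: "d ?z \<one> + d ?x ?y \<le> max (d ?x \<one> + d ?z ?y) (d ?y \<one> + d ?x ?z) + 2 * \<delta>"
    by (rule four_point) (use W in auto)
  have 3: "len ?x + 1 \<le> len ?z" using Suc by simp
  \<comment> \<open>With the induction hypothesis, the first alternative of the maximum would give
    \<open>t < 2 * \<delta>\<close>; the second gives a gain of
    \<open>t - 2 * \<delta> \<ge> 1\<close>.\<close>
  show ?case using 2 3 t(1) W unfolding 1 by (auto simp: max_def split: if_splits)
qed

text \<open>Cut the word at the multiples of \<open>t\<close>. Each piece leads at least one unit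
  further from the identity, so there are at most \<open>len (val w) + t\<close> pieces; here
  \<open>t\<close> allows for the remainder, which is shorter than one piece.\<close>

lemma local_geodesic_length:
  assumes w: "w \<in> Words" "local_geodesic k w" and t: "2 * \<delta> + 1 \<le> real t" "2 * t \<le> k"
  shows "length w \<le> t * (len (val w) + t + 1)"
proof -
  let ?q = "length w div t" and ?r = "length w mod t"
  have W: "take i w \<in> Words" "drop i w \<in> Words" for i
    using w(1) by (auto simp: in_lists_conv_set dest: in_set_takeD in_set_dropD)
  have "j * t \<le> length w \<Longrightarrow> j \<le> len (val (take (j * t) w))" for j
  proof (induction j)
    case (Suc j)
    then show ?case using local_geodesic_grows[OF w t, of j] by simp
  qed simp
  then have 1: "?q \<le> len (val (take (?q * t) w))" by simp
  have "t > 0" using t(1) \<delta> by (cases t) auto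
  have 2: "len (val (drop (?q * t) w)) \<le> t"
    using len_le[OF W(2)[of "?q * t"]] \<open>t > 0\<close> by (simp add: minus_div_mult_eq_mod order.trans[OF _
      less_imp_le])
  have "val w = val (take (?q * t) w) \<otimes> val (drop (?q * t) w)"
    using val_append[OF W, of "?q * t" "?q * t"] by simp
  then have "val (take (?q * t) w) = val w \<otimes> inv (val (drop (?q * t) w))"
    using W by (simp add: m_assoc)
  then have "len (val (take (?q * t) w)) \<le> len (val w) + len (val (drop (?q * t) w))"
    using len_mult[of "val w" "inv (val (drop (?q * t) w))"] W w by simp
  with 1 2 have "?q \<le> len (val w) + t" by linarith
  moreover have "length w = ?q * t + ?r" by simp
  moreover have "?r < t" using \<open>t > 0\<close> by simp
  ultimately have "length w \<le> (len (val w) + t) * t + t"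
    using mult_le_mono1[of ?q "len (val w) + t" t] by linarith
  then show ?thesis by (simp add: algebra_simps)
qed

text \<open>For a trivial value the length bound becomes \<open>t * (t + 1) \<le> k\<close>, so the
  entire word lies within the scale on which it is geodesic.\<close>

lemma local_geodesic_trivial:
  assumes w: "w \<in> Words" "local_geodesic k w" "val w = \<one>"
    and t: "2 * \<delta> + 1 \<le> real t" "2 * t \<le> k" "t * (t + 1) \<le> k"
  shows "w = []"
proof -
  have "length w \<le> k" using local_geodesic_length[OF w(1,2) t(1,2)] w(3) t(3) by simp
  then have "len (val w) = length w"
    using w(2) unfolding local_geodesic_def by (metis append_Nil append_Nil2)
  then show ?thesis using w(3) by simp
qed

section \<open>Triangulating closed paths\<close>

abbreviation gp where "gp x y \<equiv> gromov_product d x y \<one>"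

text \<open>Hyperbolicity loses \<open>\<delta>\<close> only once per bisection, whence the logarithm.\<close>

lemma gromov_product_chain:
  assumes p: "\<And>k. p k \<in> carrier G"
  shows "i < j \<Longrightarrow> j - i \<le> 2 ^ r \<Longrightarrow> (\<And>k. i \<le> k \<Longrightarrow> k < j \<Longrightarrow> m \<le> gp (p k) (p (Suc k))) \<Longrightarrow>
    m - real r * \<delta> \<le> gp (p i) (p j)"
proof (induction r arbitrary: i j)
  case 0
  then have "j = Suc i" by simp
  then show ?case using 0 by simp
next
  case (Suc r)
  show ?case
  proof (cases "j - i \<le> 2 ^ r")
    case True
    have "m - real (Suc r) * \<delta> \<le> m - real r * \<delta>" using \<delta> by (simp add: algebra_simps)
    also have "\<dots> \<le> gp (p i) (p j)" using Suc.IH[of i j] Suc.prems True by simp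
    finally show ?thesis .
  next
    case False
    let ?n = "i + 2 ^ r"
    have n: "i < ?n" "?n < j" "j - ?n \<le> 2 ^ r" using False Suc.prems by auto
    have "m - real r * \<delta> \<le> gp (p i) (p ?n)" using n Suc.prems(3) by (intro Suc.IH) auto
    moreover have "m - real r * \<delta> \<le> gp (p ?n) (p j)" using n Suc.prems(3) by (intro Suc.IH) auto
    ultimately have "m - real r * \<delta> - \<delta> \<le> gp (p i) (p j)"
      using hyp[OF p[of i] p[of j] p[of ?n] one_closed] by linarith
    then show ?thesis by (simp add: algebra_simps)
  qed
qed

text \<open>The points in between are at least as far from the identity as both ends, so consecutive
  points have Gromov product at least the larger end distance minus \<open>c\<close>. The chain
  lemma carries this to the two ends at a loss of \<open>r * \<delta>\<close>, and ends with a large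
  Gromov product are close to each other.\<close>

lemma chord_bound:
  assumes p: "\<And>k. p k \<in> carrier G" and step: "\<And>k. k < j \<Longrightarrow> d (p k) (p (Suc k)) \<le> c"
    and ij: "i < j" "j - i \<le> 2 ^ r"
    and far: "\<And>k. i < k \<Longrightarrow> k < j \<Longrightarrow> len (p i) \<le> len (p k) \<and> len (p j) \<le> len (p k)"
  shows "d (p i) (p j) \<le> 2 * c + 2 * real r * \<delta>"
proof -
  let ?h = "\<lambda>k. real (len (p k))" and ?m = "max (real (len (p i))) (real (len (p j)))"
  have diff: "\<bar>?h k - ?h (Suc k)\<bar> \<le> c" if "k < j" for k
    using len_diff[OF p[of k] p[of "Suc k"]] len_diff[OF p[of "Suc k"] p[of k]] step[OF that]
      dist_sym[OF p[of k] p[of "Suc k"]] by auto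
  have "?m - c \<le> gp (p k) (p (Suc k))" if k: "i \<le> k" "k < j" for k
  proof -
    \<comment> \<open>Interior points contribute at least \<open>?m\<close> each. Only an end can
      fall short, and by at most \<open>c\<close>, being one step away from a point that does
      not.\<close>
    have "2 * ?m - c \<le> ?h k + ?h (Suc k)"
    proof (cases "k = i")
      case True
      then show ?thesis
        using diff[of i] far[of "Suc i"] ij by (cases "Suc i = j") (auto simp: max_def)
    next
      case False
      then show ?thesis
        using diff[OF k(2)] far[of k] far[of "Suc k"] k by (cases "Suc k = j") (auto simp: max_def)
    qed
    then show ?thesis using step[OF k(2)] p by (simp add: gromov_product_def)
  qed
  then have "?m - c - real r * \<delta> \<le> gp (p i) (p j)"
    by (intro gromov_product_chain) (use p ij in auto)
  then show ?thesis using p by (auto simp: gromov_product_def max_def field_simps split: if_splits)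
qed

text \<open>Cutting at an interior point closest to the base point preserves the hypothesis \<open>far\<close> of
  the previous lemma.\<close>

lemma closed_path_induct:
  assumes p: "\<And>k. p k \<in> carrier G" "p 0 = \<one>" "p T = \<one>"
    and step: "\<And>k. k < T \<Longrightarrow> d (p k) (p (Suc k)) \<le> c" and T: "0 < T" "T \<le> 2 ^ r"
    and base: "\<And>k. k < T \<Longrightarrow> P k (Suc k)"
    and join: "\<And>i m j. i < m \<Longrightarrow> m < j \<Longrightarrow> j \<le> T \<Longrightarrow> d (p i) (p j) \<le> 2 * c + 2 * real r * \<delta> \<Longrightarrow>
      P i m \<Longrightarrow> P m j \<Longrightarrow> P i j"
  shows "P 0 T"
proof -
  have "P i j" if "i < j" "j \<le> T"
    "\<And>k. i < k \<Longrightarrow> k < j \<Longrightarrow> len (p i) \<le> len (p k) \<and> len (p j) \<le> len (p k)" for i j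
    using that
  proof (induction "j - i" arbitrary: i j rule: less_induct)
    case less
    show ?case
    proof (cases "j = Suc i")
      case True
      then show ?thesis using base less.prems by simp
    next
      case False
      define m where "m = arg_min_on (\<lambda>k. len (p k)) {i<..<j}"
      have fin: "finite {i<..<j}" "{i<..<j} \<noteq> {}"
        using False less.prems by (auto intro!: exI[of _ "Suc i"] simp: set_eq_iff)
      have m: "i < m" "m < j" and min: "\<And>k. i < k \<Longrightarrow> k < j \<Longrightarrow> len (p m) \<le> len (p k)"
        using arg_min_if_finite[OF fin, of "\<lambda>k. len (p k)"] arg_min_least[OF fin, of _ "\<lambda>k. len (p k)"]
        unfolding m_def[symmetric] by auto
      have "P i m" using m min less.prems by (intro less.hyps) auto
      moreover have "P m j" using m min less.prems by (intro less.hyps) auto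
      moreover have "d (p i) (p j) \<le> 2 * c + 2 * real r * \<delta>"
        by (rule chord_bound) (use less.prems T step p in auto)
      ultimately show ?thesis using join m less.prems by blast
    qed
  qed
  \<comment> \<open>Both ends of the closed path lie at distance \<open>0\<close>, so the hypothesis
    on interior points holds trivially for the whole interval.\<close>
  from this[of 0 T] show ?thesis using T p by simp
qed

end

section \<open>Knapsack instances as paths in a graph\<close>

locale bkp_graph = group G for G (structure) +
  fixes X :: "'a set" and w :: "'a bkp_symbol list"
  assumes X: "X \<subseteq> carrier G"
begin

definition letter_syms :: "'a bkp_symbol set" where
  "letter_syms = Letter ` letters X"

text \<open>This and the following notions make sense for an arbitrary word \<open>w\<close>,
  because the Datalog program also runs on inputs that encode no instance.\<close>

definition sep_of :: "nat \<Rightarrow> nat \<Rightarrow> bool" where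
  "sep_of i s \<longleftrightarrow> i \<le> s \<and> s < length w \<and> w ! s = Sep \<and> (\<forall>k. i \<le> k \<longrightarrow> k < s \<longrightarrow> w ! k \<in> letter_syms)"

definition ones :: "nat \<Rightarrow> bool" where
  "ones i \<longleftrightarrow> (\<forall>k. i \<le> k \<longrightarrow> k < length w \<longrightarrow> w ! k = One)"

definition last_sep :: "nat \<Rightarrow> bool" where
  "last_sep s \<longleftrightarrow> s < length w \<and> w ! s = Sep \<and> ones (Suc s)"

definition valid_from :: "nat \<Rightarrow> bool" where
  "valid_from i \<longleftrightarrow> (\<exists>s\<ge>i. last_sep s \<and> (\<forall>k. i \<le> k \<longrightarrow> k < s \<longrightarrow> w ! k \<in> insert Sep letter_syms))"

text \<open>Marks where another copy of a block begins. The relation \<open>sep_of\<close> alone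
  would not do, since it holds from every position of the block.\<close>

definition block_start :: "nat \<Rightarrow> bool" where
  "block_start i \<longleftrightarrow> i = 0 \<or> (\<exists>j. i = Suc j \<and> j < length w \<and> w ! j = Sep)"

text \<open>Singles out the blocks before the target: one more separator must follow.\<close>

definition inner :: "nat \<Rightarrow> bool" where
  "inner i \<longleftrightarrow> (\<exists>s s'. sep_of i s \<and> sep_of (Suc s) s')"

definition tail_start :: "nat \<Rightarrow> bool" where
  "tail_start p \<longleftrightarrow> (\<exists>s. last_sep s \<and> p = Suc s)"

text \<open>A node \<open>(i, p)\<close> consists of a position \<open>i\<close> in the blocks and a position \<open>p\<close> in the unary tail,
  which counts how often the current block has been used. At the separator of a block \<open>u\<^sub>j\<close> one may
  either use another copy of \<open>u\<^sub>j\<close> or go to the separator of the next block. The last block is the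
  target and is read backwards.\<close>

definition edge :: "nat \<times> nat \<Rightarrow> 'a \<Rightarrow> nat \<times> nat \<Rightarrow> bool" where
  "edge v g v' \<longleftrightarrow> (case v of (i, p) \<Rightarrow> case v' of (j, q) \<Rightarrow>
     (\<exists>a\<in>letters X. i < length w \<and> w ! i = Letter a \<and> j = Suc i \<and> q = p \<and> inner i \<and> g =
       letter_val G a) \<or>
     (i < length w \<and> w ! i = Sep \<and> inner i \<and> block_start j \<and> sep_of j i \<and>
       p < length w \<and> w ! p = One \<and> q = Suc p \<and> g = \<one>) \<or>
     (i < length w \<and> w ! i = Sep \<and> inner i \<and> sep_of (Suc i) j \<and> tail_start q \<and> g = \<one>) \<or>
     (\<exists>a\<in>letters X. j < length w \<and> w ! j = Letter a \<and> i = Suc j \<and> q = p \<and>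
       (\<exists>s. sep_of j s \<and> last_sep s) \<and> g = letter_val G (inv_letter a)))"

definition conf :: "(((nat \<times> nat) \<times> 'a) \<times> ((nat \<times> nat) \<times> 'a)) set" where
  "conf = {((v, a), (v', a \<otimes> g)) | v v' a g. a \<in> carrier G \<and> edge v g v'}"

text \<open>The path starts at the first separator rather than at position \<open>0\<close>, so that
  the exponent \<open>0\<close> is possible: a copy is read only after a loop edge. At the start of
  the last block the target has been divided off, so the accumulated element must be
  trivial.\<close>

definition accepting :: bool where
  "accepting \<longleftrightarrow> valid_from 0 \<and> (\<exists>s p b s'. sep_of 0 s \<and> tail_start p \<and> block_start b \<and>
     sep_of b s' \<and> last_sep s' \<and> (((s, p), \<one>), ((b, p), \<one>)) \<in> conf\<^sup>*)"

lemma sep_of_unique: "sep_of i s \<Longrightarrow> sep_of i s' \<Longrightarrow> s = s'"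
  by (cases s s' rule: linorder_cases) (auto simp: sep_of_def letter_syms_def)

lemma edge_closed: "edge v g v' \<Longrightarrow> g \<in> carrier G"
proof -
  have l: "letter_val G a \<in> carrier G" "letter_val G (inv_letter a) \<in> carrier G"
    if "a \<in> letters X" for a
    using that X by simp_all
  show "edge v g v' \<Longrightarrow> g \<in> carrier G"
    by (cases v; cases v') (auto simp: edge_def l simp del: letter_val.simps)
qed

end

section \<open>Solutions versus paths for a well-formed instance\<close>

definition block :: "'a letter list \<Rightarrow> 'a bkp_symbol list" where
  "block u = map Letter u @ [Sep]"

locale bkp_instance = bkp_graph +
  fixes us :: "'a letter list list" and m :: nat
  assumes us: "us \<noteq> []" "us \<in> lists (lists (letters X))"
    and w: "w = concat (map block us) @ replicate m One"
begin

definition start where "start j = length (concat (map block (take j us)))"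
definition sep where "sep j = start j + length (us ! j)"
definition k where "k = length us - 1"

lemma k: "length us = Suc k"
  using us by (simp add: k_def)

lemma start_Suc: "j \<le> k \<Longrightarrow> start (Suc j) = Suc (sep j)"
  using k by (simp add: start_def sep_def take_Suc_conv_app_nth block_def)

lemma start_0 [simp]: "start 0 = 0"
  by (simp add: start_def)

lemma start_mono: "i \<le> j \<Longrightarrow> start i \<le> start j"
proof -
  assume "i \<le> j"
  then have "take j us = take i us @ take (j - i) (drop i us)" by (metis le_add_diff_inverse take_add)
  then show ?thesis by (simp add: start_def)
qed

lemma sep_less_start: "i < j \<Longrightarrow> i \<le> k \<Longrightarrow> sep i < start j"
  using start_mono[of "Suc i" j] start_Suc[of i] by simp

lemma length_w: "length w = start (Suc k) + m"
  using k by (simp add: w start_def)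

lemma nth_block:
  assumes "j \<le> k" "x \<le> length (us ! j)"
  shows "w ! (start j + x) = block (us ! j) ! x"
proof -
  have "us = take j us @ us ! j # drop (Suc j) us" using assms k by (intro id_take_nth_drop) simp
  then have "w = concat (map block (take j us)) @ block (us ! j) @
      (concat (map block (drop (Suc j) us)) @ replicate m One)"
    unfolding w by (metis append.assoc concat.simps(2) concat_append list.simps(9) map_append)
  then have "w ! (start j + x) = (block (us ! j) @ (concat (map block (drop (Suc j) us)) @ replicate
    m One)) ! x"
    by (metis nth_append_length_plus start_def)
  then show ?thesis using assms by (simp add: nth_append block_def)
qed

lemma nth_letter: "j \<le> k \<Longrightarrow> x < length (us ! j) \<Longrightarrow> w ! (start j + x) = Letter (us ! j ! x)"
  by (simp add: nth_block) (simp add: block_def nth_append)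

lemma nth_sep: "j \<le> k \<Longrightarrow> w ! sep j = Sep"
  unfolding sep_def by (simp add: nth_block) (simp add: block_def nth_append)

lemma nth_one: "start (Suc k) \<le> i \<Longrightarrow> i < length w \<Longrightarrow> w ! i = One"
  using k unfolding length_w by (simp add: w start_def nth_append)

lemma us_letters: "j \<le> k \<Longrightarrow> us ! j \<in> lists (letters X)"
  using us k by (auto simp: in_lists_conv_set)

lemma us_letter: "j \<le> k \<Longrightarrow> x < length (us ! j) \<Longrightarrow> us ! j ! x \<in> letters X"
  using us_letters[of j] by (auto simp: in_lists_conv_set)

lemma sep_less: "j \<le> k \<Longrightarrow> sep j < length w"
  using sep_less_start[of j "Suc k"] by (simp add: length_w)

lemma sep_of_sep: "j \<le> k \<Longrightarrow> x \<le> length (us ! j) \<Longrightarrow> sep_of (start j + x) (sep j)"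
  unfolding sep_of_def
proof (intro conjI allI impI)
  fix i assume "j \<le> k" "start j + x \<le> i" "i < sep j"
  then show "w ! i \<in> letter_syms"
    using nth_letter[of j "i - start j"] us_letter[of j "i - start j"]
    by (auto simp: sep_def letter_syms_def)
qed (auto simp: sep_def[symmetric] nth_sep sep_less, auto simp: sep_def)

lemma sep_of_iff: "j \<le> k \<Longrightarrow> x \<le> length (us ! j) \<Longrightarrow> sep_of (start j + x) s \<longleftrightarrow> s = sep j"
  using sep_of_sep sep_of_unique by blast

lemma sep_of_start_iff: "j \<le> k \<Longrightarrow> sep_of (start j) s \<longleftrightarrow> s = sep j"
  using sep_of_iff[of j 0] by simp

lemma sep_of_tail: "\<not> sep_of (start (Suc k)) s"
  using nth_one[of s] by (auto simp: sep_of_def)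

lemma last_sep_iff: "last_sep s \<longleftrightarrow> s = sep k"
proof
  assume s: "last_sep s"
  show "s = sep k"
  proof (cases s "sep k" rule: linorder_cases)
    case less
    then show ?thesis using s nth_sep[of k] sep_less[of k] by (auto simp: last_sep_def ones_def)
  next
    case greater
    then show ?thesis using s nth_one[of s] by (auto simp: last_sep_def start_Suc)
  qed
qed (auto simp: last_sep_def ones_def sep_less nth_sep nth_one start_Suc)

lemma tail_start_iff: "tail_start p \<longleftrightarrow> p = start (Suc k)"
  by (simp add: tail_start_def last_sep_iff start_Suc)

lemma inner_iff: "j \<le> k \<Longrightarrow> x \<le> length (us ! j) \<Longrightarrow> inner (start j + x) \<longleftrightarrow> j < k"
proof -
  assume j: "j \<le> k" "x \<le> length (us ! j)"
  have "inner (start j + x) \<longleftrightarrow> (\<exists>s'. sep_of (Suc (sep j)) s')"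
    unfolding inner_def using sep_of_iff[OF j] by auto
  also have "\<dots> \<longleftrightarrow> j < k"
    using j sep_of_tail sep_of_start_iff[of "Suc j"] by (cases "j = k") (auto simp flip: start_Suc)
  finally show ?thesis .
qed

lemma block_start_start: "j \<le> k \<Longrightarrow> block_start (start j)"
  by (cases j) (auto simp: block_start_def start_Suc nth_sep sep_less)

text \<open>An earlier block start would leave a separator before \<open>sep j\<close>; a later one
  would require a separator among the letters of block \<open>j\<close>.\<close>

lemma block_start_unique:
  assumes "block_start b" "sep_of b (sep j)" "j \<le> k"
  shows "b = start j"
proof (cases b "start j" rule: linorder_cases)
  case less
  then obtain j' where j: "j = Suc j'" by (cases j) auto
  then have "b \<le> sep j'" "sep j' < sep j"
    using less start_Suc[of j'] assms(3) by (auto simp: sep_def)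
  then show ?thesis using assms nth_sep[of j'] j by (auto simp: sep_of_def letter_syms_def)
next
  case greater
  then obtain i where i: "b = Suc i" "w ! i = Sep" "start j \<le> i"
    using assms(1) by (auto simp: block_start_def)
  have "b \<le> sep j" using assms(2) by (simp add: sep_of_def)
  then have "i - start j < length (us ! j)" using i by (simp add: sep_def less_diff_conv2)
  then have "w ! i = Letter (us ! j ! (i - start j))"
    using nth_letter[OF assms(3), of "i - start j"] i by (simp add: sep_def)
  then show ?thesis using i by simp
qed

definition p0 where "p0 = start (Suc k)"

lemma length_w_p0: "length w = p0 + m"
  by (simp add: length_w p0_def)

lemma edge_letter:
  assumes "j < k" "x < length (us ! j)"
  shows "edge (start j + x, p) (letter_val G (us ! j ! x)) (start j + Suc x, p)"
  using assms nth_letter[of j x] us_letter[of j x] inner_iff[of j x] sep_less[of j]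
  by (auto simp: edge_def sep_def)

lemma edge_loop:
  assumes "j < k" "e < m"
  shows "edge (sep j, p0 + e) \<one> (start j, p0 + Suc e)"
  using assms nth_sep[of j] sep_less[of j] inner_iff[of j "length (us ! j)"] block_start_start[of j]
    sep_of_start_iff[of j] nth_one[of "p0 + e"] length_w_p0
  by (auto simp: edge_def p0_def sep_def)

lemma edge_exit:
  assumes "j < k"
  shows "edge (sep j, p) \<one> (sep (Suc j), p0)"
  using assms nth_sep[of j] sep_less[of j] inner_iff[of j "length (us ! j)"]
    sep_of_start_iff[of "Suc j"] start_Suc[of j] tail_start_iff
  by (auto simp: edge_def p0_def sep_def)

lemma edge_back:
  assumes "x < length (us ! k)"
  shows "edge (start k + Suc x, p) (letter_val G (inv_letter (us ! k ! x))) (start k + x, p)"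
  using assms nth_letter[of k x] us_letter[of k x] sep_less[of k] sep_of_iff[of k x] last_sep_iff
  by (auto simp: edge_def sep_def)

lemma conf_step: "edge v g v' \<Longrightarrow> a \<in> carrier G \<Longrightarrow> b = a \<otimes> g \<Longrightarrow> ((v, a), (v', b)) \<in> conf"
  unfolding conf_def by blast

lemma conf_letters:
  assumes "j < k" "x \<le> length (us ! j)" "a \<in> carrier G"
  shows "(((start j, p), a), ((start j + x, p), a \<otimes> word_val G (take x (us ! j)))) \<in> conf ^^ x"
  using assms(2)
proof (induction x)
  case 0
  then show ?case using assms by simp
next
  case (Suc x)
  let ?u = "take x (us ! j)" and ?l = "us ! j ! x"
  have W: "?u \<in> lists (letters X)" "[?l] \<in> lists (letters X)"
    using us_letters[of j] us_letter[of j x] Suc.prems assms(1)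
      by (auto simp: in_lists_conv_set dest: in_set_takeD)
  have "word_val G (take (Suc x) (us ! j)) = word_val G (?u @ [?l])"
    using Suc.prems by (simp add: take_Suc_conv_app_nth)
  also have "\<dots> = word_val G ?u \<otimes> letter_val G ?l"
    using word_val_append[OF X W] X W by simp
  finally have v: "word_val G (take (Suc x) (us ! j)) = word_val G ?u \<otimes> letter_val G ?l" .
  have "(((start j + x, p), a \<otimes> word_val G ?u), ((start j + Suc x, p),
      a \<otimes> word_val G (take (Suc x) (us ! j)))) \<in> conf"
    unfolding v
    by (rule conf_step[OF edge_letter]) (use Suc.prems assms W X us_letter[of j x] in \<open>auto simp:
      m_assoc\<close>)
  from relpow_Suc_I[OF Suc.IH this] Suc.prems show ?case by (simp del: relpow.simps)
qed

text \<open>A copy costs one loop edge and one edge per letter. Each loop edge consumes one symbol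
  of the unary tail, which is how \<open>m\<close> bounds the exponent.\<close>

lemma conf_copies:
  assumes "j < k" "e \<le> m" "a \<in> carrier G"
  shows "(((sep j, p0), a), ((sep j, p0 + e), a \<otimes> word_val G (us ! j) [^] e))
    \<in> conf ^^ (e * Suc (length (us ! j)))"
  using assms(2)
proof (induction e)
  case 0
  then show ?case using assms by simp
next
  case (Suc e)
  let ?g = "word_val G (us ! j)"
  have g: "?g \<in> carrier G" using X us_letters[of j] assms(1) by simp
  have "(((sep j, p0 + e), a \<otimes> ?g [^] e), ((start j, p0 + Suc e), a \<otimes> ?g [^] e)) \<in> conf"
    by (rule conf_step[OF edge_loop]) (use Suc.prems assms g in auto)
  then have "(((sep j, p0), a), ((start j, p0 + Suc e), a \<otimes> ?g [^] e))
      \<in> conf ^^ Suc (e * Suc (length (us ! j)))"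
    using Suc by (auto intro: relpow_Suc_I)
  moreover have "(((start j, p0 + Suc e), a \<otimes> ?g [^] e), ((sep j, p0 + Suc e), a \<otimes> ?g [^] Suc e))
      \<in> conf ^^ length (us ! j)"
    using conf_letters[OF assms(1) order_refl, of "a \<otimes> ?g [^] e" "p0 + Suc e"] assms g
    by (simp add: m_assoc sep_def)
  ultimately have "(((sep j, p0), a), ((sep j, p0 + Suc e), a \<otimes> ?g [^] Suc e))
      \<in> conf ^^ (Suc (e * Suc (length (us ! j))) + length (us ! j))"
    unfolding relpow_add by (rule relcompI)
  moreover have "Suc (e * Suc (length (us ! j))) + length (us ! j) = Suc e * Suc (length (us ! j))"
    by simp
  ultimately show ?case by metis
qed

definition powers :: "nat list \<Rightarrow> 'a" where
  "powers es = group_prod G (map2 (\<lambda>u e. word_val G u [^] e) us es)"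

lemma powers_Nil [simp]: "powers [] = \<one>"
  by (simp add: powers_def group_prod_def)

lemma group_prod_closed: "set xs \<subseteq> carrier G \<Longrightarrow> group_prod G xs \<in> carrier G"
  by (induction xs) (auto simp: group_prod_def)

lemma group_prod_append:
  assumes "set xs \<subseteq> carrier G" "set ys \<subseteq> carrier G"
  shows "group_prod G (xs @ ys) = group_prod G xs \<otimes> group_prod G ys"
  using assms(1)
proof (induction xs)
  case Nil
  then show ?case using group_prod_closed[OF assms(2)] by (simp add: group_prod_def)
next
  case (Cons x xs)
  then show ?case
    using group_prod_closed[of xs] group_prod_closed[OF assms(2)] by (simp add: group_prod_def m_assoc)
qed

lemma powers_carrier: "set (map2 (\<lambda>u e. word_val G u [^] (e::nat)) us es) \<subseteq> carrier G"
proof -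
  have "word_val G u \<in> carrier G" if "(u, e) \<in> set (zip us es)" for u and e :: nat
    using us(2) X set_zip_leftD[OF that] by (auto simp: in_lists_conv_set intro!: word_val_closed[OF X])
  then show ?thesis by auto
qed

lemma powers_closed: "powers es \<in> carrier G"
  using group_prod_closed[OF powers_carrier] by (simp add: powers_def)

lemma powers_snoc:
  assumes "length es \<le> k"
  shows "powers (es @ [e]) = powers es \<otimes> word_val G (us ! length es) [^] e"
proof -
  let ?f = "\<lambda>u e. word_val G u [^] (e::nat)" and ?j = "length es"
  have us': "us = take ?j us @ us ! ?j # drop (Suc ?j) us"
    using assms k by (intro id_take_nth_drop) simp
  have "map2 ?f us (es @ [e]) = map2 ?f us es @ [?f (us ! ?j) e]"
  proof (rule nth_equalityI)
    fix i assume "i < length (map2 ?f us (es @ [e]))"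
    then have "i \<le> ?j" "i < length us" by auto
    then show "map2 ?f us (es @ [e]) ! i = (map2 ?f us es @ [?f (us ! ?j) e]) ! i"
      using assms k by (cases "i = ?j") (auto simp: nth_append)
  qed (use assms k in auto)
  moreover have "?f (us ! ?j) e \<in> carrier G" using X us_letters[OF assms] by simp
  ultimately show ?thesis
    using group_prod_append[OF powers_carrier, of "[?f (us ! ?j) e]" es]
    unfolding powers_def by (simp add: group_prod_def del: map_append)
qed

text \<open>A block contributes at most \<open>m\<close> copies and one exit edge, hence at most
  \<open>Suc m\<close> times its encoded length.\<close>

lemma conf_blocks:
  assumes "length es \<le> k" "set es \<subseteq> {0..m}"
  shows "\<exists>T \<le> Suc m * start (length es).
    (((sep 0, p0), \<one>), ((sep (length es), p0), powers es)) \<in> conf ^^ T"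
  using assms
proof (induction es rule: rev_induct)
  case Nil
  then show ?case by (intro exI[of _ 0]) simp
next
  case (snoc e es)
  let ?j = "length es" and ?u = "us ! length es"
  obtain T where T: "T \<le> Suc m * start ?j" "(((sep 0, p0), \<one>), ((sep ?j, p0), powers es)) \<in> conf ^^ T"
    using snoc by auto
  have j: "?j < k" "e \<le> m" using snoc.prems by auto
  have "(((sep ?j, p0 + e), powers es \<otimes> word_val G ?u [^] e),
      ((sep (Suc ?j), p0), powers es \<otimes> word_val G ?u [^] e)) \<in> conf"
    by (rule conf_step[OF edge_exit]) (use j X us_letters[of ?j] powers_closed in auto)
  with conf_copies[OF j powers_closed]
  have "(((sep ?j, p0), powers es), ((sep (Suc ?j), p0), powers es \<otimes> word_val G ?u [^] e))
      \<in> conf ^^ Suc (e * Suc (length ?u))"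
    by (rule relpow_Suc_I)
  with T(2) have "(((sep 0, p0), \<one>), ((sep (Suc ?j), p0), powers es \<otimes> word_val G ?u [^] e))
      \<in> conf ^^ (T + Suc (e * Suc (length ?u)))"
    unfolding relpow_add by (rule relcompI)
  moreover have "T + Suc (e * Suc (length ?u)) \<le> Suc m * start (Suc ?j)"
  proof -
    have "Suc (e * Suc (length ?u)) \<le> Suc m * Suc (length ?u)"
      using mult_le_mono1[OF j(2), of "Suc (length ?u)"] by simp
    with T(1) have "T + Suc (e * Suc (length ?u)) \<le> Suc m * (start ?j + Suc (length ?u))"
      by (simp only: distrib_left)
    then show ?thesis using j(1) by (simp add: start_Suc sep_def)
  qed
  ultimately show ?case using powers_snoc[of es e] j
    by (intro exI[of _ "T + Suc (e * Suc (length ?u))"]) (simp del: relpow.simps)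
qed

text \<open>Inversion reverses the order of letters, so the target is read from its end, one
  inverted letter at a time.\<close>

lemma conf_back:
  assumes "x \<le> length (us ! k)" "a \<in> carrier G"
  shows "(((sep k, p0), a), ((sep k - x, p0), a \<otimes> inv (word_val G (drop (length (us ! k) - x) (us !
    k)))))
    \<in> conf ^^ x"
  using assms(1)
proof (induction x)
  case 0
  then show ?case using assms by simp
next
  case (Suc x)
  let ?u = "us ! k"
  let ?y = "length ?u - Suc x"
  have y: "?y < length ?u" "length ?u - x = Suc ?y" using Suc.prems by auto
  have W: "drop (Suc ?y) ?u \<in> lists (letters X)" "?u ! ?y \<in> letters X"
    using us_letters[of k] us_letter[OF order_refl y(1)]
      by (auto simp: in_lists_conv_set dest: in_set_dropD)
  have c: "letter_val G (?u ! ?y) \<in> carrier G" "word_val G (drop (Suc ?y) ?u) \<in> carrier G"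
    using X W by auto
  have "drop ?y ?u = ?u ! ?y # drop (Suc ?y) ?u" using y by (simp add: Cons_nth_drop_Suc)
  then have v: "a \<otimes> inv (word_val G (drop ?y ?u)) =
      a \<otimes> inv (word_val G (drop (Suc ?y) ?u)) \<otimes> letter_val G (inv_letter (?u ! ?y))"
    using c assms(2) inv_letter_val[OF X W(2)] by (simp add: inv_mult_group m_assoc)
  have "(((start k + Suc ?y, p0), a \<otimes> inv (word_val G (drop (Suc ?y) ?u))),
      ((start k + ?y, p0), a \<otimes> inv (word_val G (drop ?y ?u)))) \<in> conf"
    unfolding v by (rule conf_step[OF edge_back]) (use y c assms in auto)
  moreover have "sep k - x = start k + Suc ?y" "sep k - Suc x = start k + ?y"
    using Suc.prems by (auto simp: sep_def)
  ultimately show ?case using Suc y(2) by (auto intro: relpow_Suc_I)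
qed

lemma solvable_iff:
  "bkp_solvable G (butlast us) (last us) m \<longleftrightarrow>
    (\<exists>es. length es = k \<and> set es \<subseteq> {0..m} \<and> word_val G (us ! k) = powers es)"
proof -
  have last: "last us = us ! k" using us by (simp add: last_conv_nth k_def)
  have lb: "length (butlast us) = k" by (simp add: k_def)
  have "map2 (\<lambda>u e. word_val G u [^] e) (butlast us) es = map2 (\<lambda>u e. word_val G u [^] e) us es"
    if "length es = k" for es :: "nat list"
    using that us by (intro nth_equalityI) (auto simp: k_def nth_butlast)
  then have "powers es = group_prod G (map2 (\<lambda>u e. word_val G u [^] e) (butlast us) es)"
    if "length es = k" for es
    using that by (simp add: powers_def)
  then show ?thesis unfolding bkp_solvable_def last lb by metis
qed

lemma solvable_path:
  assumes "bkp_solvable G (butlast us) (last us) m"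
  shows "\<exists>T \<le> (length w + 2) ^ 2. (((sep 0, p0), \<one>), ((start k, p0), \<one>)) \<in> conf ^^ T"
proof -
  obtain es where es: "length es = k" "set es \<subseteq> {0..m}" "word_val G (us ! k) = powers es"
    using assms solvable_iff by auto
  obtain T where T: "T \<le> Suc m * start k" "(((sep 0, p0), \<one>), ((sep k, p0), powers es)) \<in> conf ^^ T"
    using conf_blocks[of es] es by auto
  have "(((sep k, p0), powers es), ((start k, p0), \<one>)) \<in> conf ^^ length (us ! k)"
    using conf_back[OF order_refl powers_closed[of es]] es(3) powers_closed[of es]
    by (simp add: sep_def)
  with T(2) have "(((sep 0, p0), \<one>), ((start k, p0), \<one>)) \<in> conf ^^ (T + length (us ! k))"
    unfolding relpow_add by (rule relcompI)
  moreover have "T + length (us ! k) \<le> (length w + 2) ^ 2"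
  proof -
    have "start k + length (us ! k) \<le> length w + 2" "Suc m \<le> length w + 2"
      by (auto simp: length_w start_Suc sep_def)
    then have "Suc m * (start k + length (us ! k)) \<le> (length w + 2) * (length w + 2)"
      by (intro mult_le_mono)
    then show ?thesis using T(1) by (simp add: power2_eq_square algebra_simps)
  qed
  ultimately show ?thesis by blast
qed

lemma valid: "valid_from 0"
  unfolding valid_from_def
proof (intro exI[of _ "sep k"] conjI allI impI)
  fix i assume "i < sep k"
  then have i: "i < length (concat (map block us))"
    using start_Suc[of k] by (simp add: start_def k)
  then have "w ! i \<in> set (concat (map block us))" by (simp add: w nth_append del: set_concat)
  then show "w ! i \<in> insert Sep letter_syms"
    using us by (auto simp: block_def letter_syms_def in_lists_conv_set)
qed (auto simp: last_sep_iff)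

text \<open>The list \<open>es\<close> holds the exponents of the finished blocks, and the tail
  position shows the exponent \<open>e\<close> in progress. A loop edge raises \<open>e\<close>
  before the copy is read: strictly inside a block only \<open>e - 1\<close> copies are complete, at
  its separator all \<open>e\<close> are. In the target block only the suffix already read
  matters.\<close>

definition inv_node :: "nat \<times> nat \<Rightarrow> 'a \<Rightarrow> bool" where
  "inv_node v a \<longleftrightarrow> (\<exists>es. set es \<subseteq> {0..m} \<and>
    ((\<exists>x e. length es < k \<and> x \<le> length (us ! length es) \<and> v = (start (length es) + x, p0 + e) \<and> e \<le> m \<and>
       (if x = length (us ! length es) then a = powers es \<otimes> word_val G (us ! length es) [^] e
        else 0 < e \<and> a = powers es \<otimes> word_val G (us ! length es) [^] (e - 1) \<otimes>
          word_val G (take x (us ! length es)))) \<or>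
     (\<exists>x. length es = k \<and> x \<le> length (us ! k) \<and> v = (start k + x, p0) \<and>
       a = powers es \<otimes> inv (word_val G (drop x (us ! k))))))"

lemma inv_node_step:
  assumes "inv_node v a" "edge v g v'"
  shows "inv_node v' (a \<otimes> g)"
proof -
  obtain es where es: "set es \<subseteq> {0..m}" and
    "(\<exists>x e. length es < k \<and> x \<le> length (us ! length es) \<and> v = (start (length es) + x, p0 + e) \<and> e \<le> m \<and>
       (if x = length (us ! length es) then a = powers es \<otimes> word_val G (us ! length es) [^] e
        else 0 < e \<and> a = powers es \<otimes> word_val G (us ! length es) [^] (e - 1) \<otimes>
          word_val G (take x (us ! length es)))) \<or>
     (\<exists>x. length es = k \<and> x \<le> length (us ! k) \<and> v = (start k + x, p0) \<and>
       a = powers es \<otimes> inv (word_val G (drop x (us ! k))))"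
    using assms(1) unfolding inv_node_def by blast
  then show ?thesis
  proof (elim disjE exE conjE)
    fix x e
    let ?j = "length es" and ?u = "us ! length es"
    let ?g = "word_val G ?u"
    assume j: "?j < k" and x: "x \<le> length ?u" and v: "v = (start ?j + x, p0 + e)" and e: "e \<le> m"
      and a: "if x = length ?u then a = powers es \<otimes> ?g [^] e
        else 0 < e \<and> a = powers es \<otimes> ?g [^] (e - 1) \<otimes> word_val G (take x ?u)"
    have u: "?u \<in> lists (letters X)" using us_letters j by simp
    have gc: "?g \<in> carrier G" using X u by simp
    have tk: "take y ?u \<in> lists (letters X)" for y using u
      by (auto simp: in_lists_conv_set dest: in_set_takeD)
    have tkc: "word_val G (take y ?u) \<in> carrier G" for y using X tk by simp
    obtain i q where v': "v' = (i, q)" by (cases v')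
    have sepj: "x = length ?u" if "w ! (start ?j + x) = Sep"
      using nth_letter[of ?j x] that j x by (cases "x = length ?u") auto
    from assms(2) consider
      (letter) b where "w ! (start ?j + x) = Letter b" "i = Suc (start ?j + x)" "q = p0 + e" "g =
        letter_val G b"
    | (loop) "w ! (start ?j + x) = Sep" "block_start i" "sep_of i (start ?j + x)" "p0 + e < length w"
        "q = Suc (p0 + e)" "g = \<one>"
    | (leave) "w ! (start ?j + x) = Sep" "sep_of (Suc (start ?j + x)) i" "tail_start q" "g = \<one>"
    | (backward) s where "start ?j + x = Suc i" "sep_of i s" "last_sep s"
      unfolding v v' edge_def by auto
    then show ?thesis
    proof cases
      case letter
      have lt: "x < length ?u"
        using letter(1) nth_sep[of ?j] x j by (cases "x = length ?u") (auto simp: sep_def)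
      then have b: "b = ?u ! x" using letter(1) nth_letter[of ?j x] j by simp
      have "take (Suc x) ?u = take x ?u @ [b]" using lt b by (simp add: take_Suc_conv_app_nth)
      then have val: "word_val G (take (Suc x) ?u) = word_val G (take x ?u) \<otimes> g"
        using word_val_append[OF X tk, of "[b]" x] us_letter[of ?j x] lt j b X letter(4) by simp
      have gg: "g \<in> carrier G" using edge_closed[OF assms(2)] .
      have a': "a \<otimes> g = powers es \<otimes> ?g [^] (e - 1) \<otimes> word_val G (take (Suc x) ?u)" "0 < e"
        using a lt val gg gc tkc powers_closed by (auto simp: m_assoc)
      have "a \<otimes> g = powers es \<otimes> ?g [^] e" if "Suc x = length ?u"
        using that a' gc powers_closed nat_pow_Suc[of ?g "e - 1"] by (simp add: m_assoc)
      then show ?thesis unfolding inv_node_def v' using es j lt e letter a'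
        by (intro exI[of _ es] conjI disjI1 exI[of _ "Suc x"] exI[of _ e]) auto
    next
      case loop
      have xl: "x = length ?u" using sepj loop(1) by simp
      have i: "i = start ?j" using block_start_unique[of i ?j] loop(2,3) j xl by (simp add: sep_def)
      have em: "Suc e \<le> m" using loop(4) length_w_p0 by simp
      have ac: "a = powers es \<otimes> ?g [^] e" using a xl by simp
      then have "a \<otimes> g = a" using loop(6) gc powers_closed by simp
      \<comment> \<open>In an empty block the start coincides with the separator, so the loop edge
        alone completes a copy, of value \<open>\<one>\<close>.\<close>
      moreover have "a = powers es \<otimes> ?g [^] Suc e" if "length ?u = 0"
        using ac that by simp
      ultimately show ?thesis unfolding inv_node_def v' using es j em loop(5) ac i gc powers_closed
        by (intro exI[of _ es] conjI disjI1 exI[of _ 0] exI[of _ "Suc e"]) auto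
    next
      case leave
      have xl: "x = length ?u" using sepj leave(1) by simp
      have i: "i = sep (Suc ?j)"
        using leave(2) sep_of_start_iff[of "Suc ?j" i] j xl start_Suc[of ?j] by (simp add: sep_def)
      have q: "q = p0" using leave(3) by (simp add: tail_start_iff p0_def)
      have ac: "a \<otimes> g = powers (es @ [e])"
        using a xl leave(4) gc powers_closed powers_snoc[of es e] j by simp
      have es': "set (es @ [e]) \<subseteq> {0..m}" using es e by auto
      show ?thesis
      proof (cases "Suc ?j = k")
        case True
        then show ?thesis unfolding inv_node_def v' using es' ac q i powers_closed
          by (intro exI[of _ "es @ [e]"] conjI disjI2 exI[of _ "length (us ! k)"]) (auto simp: sep_def)
      next
        case False
        then show ?thesis unfolding inv_node_def v' using es' ac q i powers_closed j
          by (intro exI[of _ "es @ [e]"] conjI disjI1 exI[of _ "length (us ! Suc ?j)"] exI[of _ 0])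
            (auto simp: sep_def)
      qed
    next
      case backward
      \<comment> \<open>A backward edge demands letters all the way to the last separator, but the
        separator of block \<open>?j\<close> lies in between.\<close>
      have "i < sep ?j" using backward(1) x by (simp add: sep_def)
      moreover have "sep ?j < s" using backward(3) sep_less_start[of ?j k] j
        by (simp add: last_sep_iff sep_def)
      ultimately have "w ! sep ?j \<in> letter_syms" using backward(2) by (simp add: sep_of_def)
      then show ?thesis using nth_sep[of ?j] j by (auto simp: letter_syms_def)
    qed
  next
    fix x
    let ?u = "us ! k"
    assume j: "length es = k" and x: "x \<le> length ?u" and v: "v = (start k + x, p0)"
      and a: "a = powers es \<otimes> inv (word_val G (drop x ?u))"
    obtain i q where v': "v' = (i, q)" by (cases v')
    have "\<not> inner (start k + x)" using inner_iff[OF order_refl x] by simp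
    with assms(2) obtain b where b: "b \<in> letters X" "w ! i = Letter b" "i < length w"
      "start k + x = Suc i" "q = p0" "g = letter_val G (inv_letter b)"
      unfolding v v' edge_def by auto
    \<comment> \<open>Otherwise the symbol read would precede the target block: a separator, or no
      symbol at all.\<close>
    have "x \<noteq> 0"
    proof
      assume "x = 0"
      then obtain j where "k = Suc j" "i = sep j" using b(4) start_Suc[of "k - 1"] by (cases k) auto
      then show False using b(2) nth_sep[of j] by simp
    qed
    then obtain y where y: "x = Suc y" by (cases x) auto
    then have i: "i = start k + y" "y < length ?u" using b(4) x by auto
    then have by': "b = ?u ! y" using b(2) nth_letter[of k y] by simp
    have "drop y ?u = b # drop x ?u" using i by' y by (simp add: Cons_nth_drop_Suc)
    moreover have dr: "drop x ?u \<in> lists (letters X)"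
      using us_letters[of k] by (auto simp: in_lists_conv_set dest: in_set_dropD)
    moreover have c: "letter_val G b \<in> carrier G" "word_val G (drop x ?u) \<in> carrier G"
      using X b(1) word_val_closed[OF X dr] by simp_all
    ultimately have "a \<otimes> g = powers es \<otimes> inv (word_val G (drop y ?u))"
      using a b(6) inv_letter_val[OF X b(1)] powers_closed by (simp add: inv_mult_group m_assoc)
    then show ?thesis unfolding inv_node_def v' using es j i b(5)
      by (intro exI[of _ es] conjI disjI2 exI[of _ y]) auto
  qed
qed

lemma path_solvable:
  assumes "(((sep 0, p0), \<one>), ((start k, p0), \<one>)) \<in> conf\<^sup>*"
  shows "bkp_solvable G (butlast us) (last us) m"
proof -
  have init: "inv_node (sep 0, p0) \<one>"
  proof (cases "k = 0")
    case True
    then show ?thesis unfolding inv_node_def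
      by (intro exI[of _ "[]"] conjI disjI2 exI[of _ "length (us ! k)"]) (auto simp: sep_def)
  next
    case False
    then show ?thesis unfolding inv_node_def
      by (intro exI[of _ "[]"] conjI disjI1 exI[of _ "length (us ! 0)"] exI[of _ 0]) (auto simp:
        sep_def)
  qed
  have "inv_node (fst c) (snd c)" if "(((sep 0, p0), \<one>), c) \<in> conf\<^sup>*" for c
    using that
  proof (induction rule: rtrancl_induct)
    case (step c c')
    then show ?case using inv_node_step by (auto simp: conf_def)
  qed (use init in simp)
  from this[OF assms] obtain es where es: "set es \<subseteq> {0..m}" and
    "(\<exists>x e. length es < k \<and> x \<le> length (us ! length es) \<and> start k = start (length es) + x) \<or>
     (\<exists>x. length es = k \<and> x \<le> length (us ! k) \<and> start k = start k + x \<and>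
       \<one> = powers es \<otimes> inv (word_val G (drop x (us ! k))))"
    unfolding inv_node_def by auto
  \<comment> \<open>Nodes of earlier blocks lie strictly before \<open>start k\<close>, which rules
    out the first form of the invariant at the end node.\<close>
  moreover have "start (length es) + x < start k" if "length es < k" "x \<le> length (us ! length es)" for x
    using sep_less_start[of "length es" k] that by (simp add: sep_def)
  ultimately have l: "length es = k" and "\<one> = powers es \<otimes> inv (word_val G (us ! k))" by fastforce+
  moreover have "word_val G (us ! k) \<in> carrier G" using X us_letters[of k] by simp
  ultimately have "word_val G (us ! k) = powers es"
    using powers_closed[of es] by (metis inv_closed inv_equality inv_inv)
  then show ?thesis using solvable_iff es l by blast
qed

lemma accepting_iff: "accepting \<longleftrightarrow> bkp_solvable G (butlast us) (last us) m"
proof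
  assume accepting
  then obtain s p b s' where *: "sep_of 0 s" "tail_start p" "block_start b" "sep_of b s'" "last_sep s'"
    "(((s, p), \<one>), ((b, p), \<one>)) \<in> conf\<^sup>*" unfolding accepting_def by blast
  have "s = sep 0" using *(1) sep_of_start_iff[of 0] by simp
  moreover have "p = p0" using *(2) by (simp add: tail_start_iff p0_def)
  moreover have "b = start k" using block_start_unique[of b k] *(3-5) last_sep_iff by simp
  ultimately show "bkp_solvable G (butlast us) (last us) m" using *(6) path_solvable by simp
next
  assume "bkp_solvable G (butlast us) (last us) m"
  from solvable_path[OF this] have "(((sep 0, p0), \<one>), ((start k, p0), \<one>)) \<in> conf\<^sup>*"
    using relpow_imp_rtrancl by blast
  then show accepting unfolding accepting_def
    using valid sep_of_start_iff[of 0] tail_start_iff p0_def block_start_start[of k]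
      sep_of_start_iff[of k] last_sep_iff by (metis le0 order_refl start_0)
qed

end

section \<open>Arbitrary input words\<close>

context bkp_graph
begin

lemma valid_decompose:
  assumes "w \<in> lists (bkp_alphabet X)" "valid_from 0"
  obtains us m where "us \<noteq> []" "us \<in> lists (lists (letters X))"
    "w = concat (map block us) @ replicate m One"
proof -
  obtain s where s: "s < length w" "w ! s = Sep" "ones (Suc s)"
    "\<forall>k<s. w ! k \<in> insert Sep letter_syms"
    using assms(2) unfolding valid_from_def last_sep_def by blast
  \<comment> \<open>Induction from the front: a separator opens a new empty block, a letter is put
    before the first block.\<close>
  have blocks: "\<exists>us. us \<noteq> [] \<and> us \<in> lists (lists (letters X)) \<and> v @ [Sep] = concat (map block us)"
    if "set v \<subseteq> insert Sep letter_syms" for v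
    using that
  proof (induction v)
    case Nil
    then show ?case by (intro exI[of _ "[[]]"]) (auto simp: block_def)
  next
    case (Cons x v)
    then obtain us where us: "us \<noteq> []" "us \<in> lists (lists (letters X))" "v @ [Sep] =
      concat (map block us)"
      by auto
    show ?case
    proof (cases "x = Sep")
      case True
      then show ?thesis using us by (intro exI[of _ "[] # us"]) (auto simp: block_def[of "[]"])
    next
      case False
      then obtain a where a: "x = Letter a" "a \<in> letters X" using Cons.prems
        by (auto simp: letter_syms_def)
      obtain u vs where "us = u # vs" using us by (cases us) auto
      then show ?thesis using us a by (intro exI[of _ "(a # u) # vs"]) (auto simp: block_def[of u]
        block_def[of "a # u"])
    qed
  qed
  have "set (take s w) \<subseteq> insert Sep letter_syms"
    using s(1,4) by (auto simp: set_conv_nth)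
  from blocks[OF this] obtain us where us: "us \<noteq> []" "us \<in> lists (lists (letters X))"
    "take s w @ [Sep] = concat (map block us)" by blast
  have "drop (Suc s) w = replicate (length w - Suc s) One"
    using s(3) by (intro nth_equalityI) (auto simp: ones_def)
  then have "w = concat (map block us) @ replicate (length w - Suc s) One"
    using us(3) s(1,2) id_take_nth_drop[of s w] by (metis append.assoc append_Cons append_Nil)
  then show ?thesis using that us by blast
qed

lemma encode_blocks: "us \<noteq> [] \<Longrightarrow> bkp_encode (butlast us) (last us) m =
  concat (map block us) @ replicate m One"
  by (simp add: bkp_encode_def block_def[abs_def])

lemma accepting_BKP:
  assumes "w \<in> lists (bkp_alphabet X)" accepting
  shows "w \<in> BKP G X"
proof -
  have "valid_from 0" using assms(2) by (simp add: accepting_def)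
  then obtain us m where dec: "us \<noteq> []" "us \<in> lists (lists (letters X))"
    "w = concat (map block us) @ replicate m One" using valid_decompose assms(1) by metis
  interpret bkp_instance G X w us m by unfold_locales (use dec in auto)
  have "butlast us \<in> lists (lists (letters X))" "last us \<in> lists (letters X)"
    using dec by (auto simp: in_lists_conv_set dest: in_set_butlastD)
  then have "bkp_encode (butlast us) (last us) m \<in> BKP G X"
    using assms(2) accepting_iff by (simp add: bkp_encode_mem_BKP)
  then show ?thesis using encode_blocks[OF dec(1), of m] dec(3) by simp
qed

lemma BKP_path:
  assumes "w \<in> BKP G X"
  obtains s p b s' T where "valid_from 0" "sep_of 0 s" "tail_start p" "block_start b" "sep_of b s'"
    "last_sep s'" "T \<le> (length w + 2) ^ 2" "(((s, p), \<one>), ((b, p), \<one>)) \<in> conf ^^ T"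
proof -
  obtain gs g m where enc: "w = bkp_encode gs g m" "gs \<in> lists (lists (letters X))" "g \<in> lists
    (letters X)"
    "bkp_solvable G gs g m" using assms unfolding BKP_def by blast
  interpret bkp_instance G X w "gs @ [g]" m
    by unfold_locales (use enc encode_blocks[of "gs @ [g]"] in auto)
  obtain T where "T \<le> (length w + 2) ^ 2" "(((sep 0, p0), \<one>), ((start k, p0), \<one>)) \<in> conf ^^ T"
    using solvable_path enc(4) by auto
  then show ?thesis
    using that[OF valid, of "sep 0" p0 "start k" "sep k" T] sep_of_start_iff[of 0]
      block_start_start[of k] sep_of_start_iff[of k]
    by (simp add: tail_start_iff p0_def last_sep_iff)
qed

end

section \<open>A Datalog program for the knapsack problem\<close>

declare in_listsI [rule del] in_listsD [rule del]

text \<open>Arithmetic on words has to be programmed from zero and successor. \<open>Lin a\<close>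
  is the graph of the map that sends \<open>x\<close> to \<open>K * x + a\<close>, i.e. of
  prepending a letter with digit \<open>a\<close>; \<open>Wd v\<close> pins down the code of one
  fixed word.\<close>

datatype 'a pred =
    Lin nat | Wd "'a letter list" | Wrd | Conc | Rew
  | Ones | Last | SepOf | Good | Beg | Mid | Tail | Reach | Goal

primrec arity :: "'a pred \<Rightarrow> nat" where
  "arity (Lin a) = 2"
| "arity (Wd v) = 1"
| "arity Wrd = 1"
| "arity Conc = 3"
| "arity Rew = 2"
| "arity Ones = 1"
| "arity Last = 1"
| "arity SepOf = 2"
| "arity Good = 1"
| "arity Beg = 1"
| "arity Mid = 1"
| "arity Tail = 1"
| "arity Reach = 5"
| "arity Goal = 0"

text \<open>Instances are written over \<open>X\<close>, distances are measured over
  \<open>S\<close>, and \<open>rep\<close> translates. \<open>t\<close> is the stride at which local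
  geodesics make progress and \<open>k\<close> the scale on which they are geodesic.
  \<open>L\<close> bounds the words occurring as constants of the program: translations and the two
  sides of shortening rules.\<close>

locale bkp_rules = hyperbolic G S \<delta> for G (structure) and S \<delta> +
  fixes X :: "'a set" and t k K L :: nat
    and dig :: "'a letter \<Rightarrow> nat" and rep :: "'a letter \<Rightarrow> 'a letter list"
  assumes X: "X \<subseteq> carrier G" "finite X"
    and t: "2 * \<delta> + 1 \<le> real t" "2 * t \<le> k" "t * (t + 1) \<le> k"
    and dig: "bij_betw dig (letters S) {1..K}"
    and rep: "\<And>a. a \<in> letters X \<Longrightarrow> rep a \<in> Words \<and> val (rep a) = letter_val G a \<and>
      length (rep a) = len (letter_val G a) \<and> length (rep a) \<le> L"
    and L: "k \<le> L"
begin

text \<open>Words are numbered in bijective base \<open>K\<close>, with the first letter as the least significant digit.\<close>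

primrec code :: "'a letter list \<Rightarrow> nat" where
  "code [] = 0"
| "code (a # u) = K * code u + dig a"

lemma dig_bounds: "a \<in> letters S \<Longrightarrow> 1 \<le> dig a \<and> dig a \<le> K"
  using dig by (auto simp: bij_betw_def)

lemma code_inj: "u \<in> Words \<Longrightarrow> v \<in> Words \<Longrightarrow> code u = code v \<Longrightarrow> u = v"
proof (induction u arbitrary: v)
  case Nil
  then show ?case using dig_bounds by (cases v) force+
next
  case (Cons a u)
  have a: "1 \<le> dig a" "dig a \<le> K" using dig_bounds Cons.prems by auto
  then obtain b v' where v: "v = b # v'" using Cons.prems by (cases v) auto
  have b: "1 \<le> dig b" "dig b \<le> K" using dig_bounds Cons.prems v by auto
  \<comment> \<open>Lowering the digits by one puts them below \<open>K\<close>, so division by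
    \<open>K\<close> separates the first letter from the rest.\<close>
  have eq: "(dig a - 1) + K * code u = (dig b - 1) + K * code v'" using Cons.prems(3) a b v by simp
  have lt: "dig a - 1 < K" "dig b - 1 < K" using a b by auto
  have "code u = code v'" using arg_cong[OF eq, of "\<lambda>x. x div K"] lt by simp
  moreover from this eq a b have "dig a = dig b" by simp
  ultimately show ?case
    using Cons v bij_betw_imp_inj_on[OF dig] by (auto dest: inj_onD)
qed

lemma code_less: "u \<in> Words \<Longrightarrow> code u < (K + 1) ^ length u"
proof (induction u)
  case (Cons a u)
  then have "K * (code u + 1) \<le> K * (K + 1) ^ length u" by (intro mult_le_mono2) simp
  then have "code (a # u) \<le> K * (K + 1) ^ length u" using dig_bounds[of a] Cons.prems by simp
  also have "\<dots> < (K + 1) * (K + 1) ^ length u" by simp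
  finally show ?case by simp
qed simp

definition short_words where "short_words = {v \<in> Words. length v \<le> L}"

text \<open>The successor advances \<open>a\<close> up to \<open>K\<close>; then
  \<open>K * x + K = K * (x + 1) + 0\<close> carries over to the next \<open>x\<close>.\<close>

definition lin_rules :: "('a bkp_symbol, 'a pred) datalog_rule set" where
  "lin_rules =
    {((Lin 0, [0, 1]), [LZero 0, LZero 1]),
     ((Lin 0, [2, 1]), [LAtom (Lin K) [0, 1], LSucc 0 2])} \<union>
    (\<lambda>a. ((Lin (Suc a), [0, 2]), [LAtom (Lin a) [0, 1], LSucc 1 2])) ` {..<K}"

definition word_rules :: "('a bkp_symbol, 'a pred) datalog_rule set" where
  "word_rules =
    {((Wd [], [0]), [LZero 0]), ((Wrd, [0]), [LZero 0])} \<union>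
    (\<lambda>v. ((Wd v, [1]), [LAtom (Wd (tl v)) [0], LAtom (Lin (dig (hd v))) [0,
      1]])) ` (short_words - {[]}) \<union>
    (\<lambda>a. ((Wrd, [1]), [LAtom Wrd [0], LAtom (Lin (dig a)) [0, 1]])) ` letters S"

text \<open>Recursion on the first word: prepending a letter is one application of
  \<open>Lin\<close>, thanks to the least significant digit coming first.\<close>

definition conc_rules :: "('a bkp_symbol, 'a pred) datalog_rule set" where
  "conc_rules =
    {((Conc, [0, 1, 1]), [LZero 0, LAtom Wrd [1]])} \<union>
    (\<lambda>a. ((Conc, [3, 1, 4]), [LAtom Conc [0, 1, 2], LAtom (Lin (dig a)) [0, 3],
      LAtom (Lin (dig a)) [2, 4]]))
      ` letters S"

text \<open>The first kind of rule rewrites at the front with an arbitrary remainder, the second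
  prepends a common letter to both sides; together they shorten anywhere in a word.\<close>

definition rew_rules :: "('a bkp_symbol, 'a pred) datalog_rule set" where
  "rew_rules =
    (\<lambda>(x, y). ((Rew, [3, 4]), [LAtom (Wd x) [0], LAtom (Wd y) [1], LAtom Conc [0, 2, 3],
      LAtom Conc [1, 2, 4]]))
      ` shortening k \<union>
    (\<lambda>a. ((Rew, [3, 4]), [LAtom Rew [0, 1], LAtom (Lin (dig a)) [0, 3], LAtom (Lin (dig a)) [1, 4]]))
      ` letters S"

abbreviation "sep_sym \<equiv> {Some Sep}"
abbreviation "one_sym \<equiv> {Some One}"
abbreviation "letter_sym \<equiv> Some ` Letter ` letters X"

text \<open>The recursive predicates propagate from right to left, from a position to its
  predecessor. \<open>None\<close> is the symbol beyond the end of the input.\<close>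

definition input_rules :: "('a bkp_symbol, 'a pred) datalog_rule set" where
  "input_rules =
    {((Ones, [0]), [LSym {None} 0]),
     ((Ones, [0]), [LSym one_sym 0, LSucc 0 1, LAtom Ones [1]]),
     ((Last, [0]), [LSym sep_sym 0, LSucc 0 1, LAtom Ones [1]]),
     ((SepOf, [0, 0]), [LSym sep_sym 0]),
     ((SepOf, [0, 2]), [LSym letter_sym 0, LSucc 0 1, LAtom SepOf [1, 2]]),
     ((Good, [0]), [LAtom Last [0]]),
     ((Good, [0]), [LSym (insert (Some Sep) letter_sym) 0, LSucc 0 1, LAtom Good [1]]),
     ((Beg, [0]), [LZero 0]),
     ((Beg, [1]), [LSym sep_sym 0, LSucc 0 1]),
     ((Mid, [0]), [LAtom SepOf [0, 1], LSucc 1 2, LAtom SepOf [2, 3]]),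
     ((Tail, [1]), [LAtom Last [0], LSucc 0 1])}"

text \<open>Labels are codes of words over \<open>S\<close>: the translation of a letter, or
  \<open>0\<close>, the code of the empty word, for an edge with trivial label.\<close>

definition edge_rules :: "('a bkp_symbol, 'a pred) datalog_rule set" where
  "edge_rules =
    (\<lambda>a. ((Reach, [0, 2, 1, 2, 3]),
      [LSym {Some (Letter a)} 0, LSucc 0 1, LAtom Mid [0], LAtom (Wd (rep a)) [3]])) ` letters X \<union>
    {((Reach, [0, 2, 1, 3, 4]), [LSym sep_sym 0, LAtom Mid [0], LAtom Beg [1], LAtom SepOf [1, 0],
       LSym one_sym 2, LSucc 2 3, LZero 4]),
     ((Reach, [0, 2, 1, 3, 4]), [LSym sep_sym 0, LAtom Mid [0], LSucc 0 5, LAtom SepOf [5, 1],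
       LAtom Tail [3], LZero 4])} \<union>
    (\<lambda>a. ((Reach, [1, 2, 0, 2, 3]),
      [LSym {Some (Letter a)} 0, LSucc 0 1, LAtom SepOf [0, 4], LAtom Last [4],
       LAtom (Wd (rep (inv_letter a))) [3]])) ` letters X"

text \<open>A word whose code is not below \<open>M\<close> is out of reach, so it matters in which
  order a path is combined and that labels can be shortened in between. In the rule for
  \<open>Goal\<close>, variable \<open>0\<close> is both the first input position and the code of
  the empty word.\<close>

definition path_rules :: "('a bkp_symbol, 'a pred) datalog_rule set" where
  "path_rules =
    {((Reach, [0, 1, 0, 1, 2]), [LZero 2]),
     ((Reach, [0, 1, 4, 5, 8]), [LAtom Reach [0, 1, 2, 3, 6], LAtom Reach [2, 3, 4, 5, 7],
       LAtom Conc [6, 7, 8]]),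
     ((Reach, [0, 1, 2, 3, 5]), [LAtom Reach [0, 1, 2, 3, 4], LAtom Rew [4, 5]]),
     ((Goal, []), [LZero 0, LAtom Good [0], LAtom SepOf [0, 1], LAtom Tail [2], LAtom Beg [3],
       LAtom SepOf [3, 4], LAtom Last [4], LAtom Reach [1, 2, 3, 2, 0]])}"

definition rules where
  "rules = lin_rules \<union> word_rules \<union> conc_rules \<union> rew_rules \<union> input_rules \<union> edge_rules \<union> path_rules"

definition preds where
  "preds = Lin ` {..K} \<union> Wd ` short_words \<union>
    {Wrd, Conc, Rew, Ones, Last, SepOf, Good, Beg, Mid, Tail, Reach, Goal}"

lemma finite_letters: "finite (letters S)" "finite (letters X)"
  using S X by (auto simp: letters_def)

lemma finite_short_words: "finite short_words"
proof (rule finite_subset)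
  show "short_words \<subseteq> {v. set v \<subseteq> letters S \<and> length v \<le> L}"
    by (auto simp: short_words_def in_lists_conv_set)
  show "finite {v. set v \<subseteq> letters S \<and> length v \<le> L}"
    by (rule finite_lists_length_le[OF finite_letters(1)])
qed

lemma finite_rules: "finite rules"
  using finite_letters finite_short_words finite_shortening[of k]
  by (simp add: rules_def lin_rules_def word_rules_def conc_rules_def rew_rules_def input_rules_def
      edge_rules_def path_rules_def)

lemma finite_preds: "finite preds"
  using finite_short_words by (simp add: preds_def)

lemma lin_preds: "a \<in> letters S \<Longrightarrow> Lin (dig a) \<in> preds"
  using dig_bounds by (auto simp: preds_def)

lemma wd_preds: "v \<in> Words \<Longrightarrow> length v \<le> L \<Longrightarrow> Wd v \<in> preds"
  by (auto simp: preds_def short_words_def)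

lemma tl_short: "v \<in> short_words \<Longrightarrow> v \<noteq> [] \<Longrightarrow> tl v \<in> Words \<and> length (tl v) \<le> L \<and> hd v \<in> letters S"
  by (cases v) (auto simp: short_words_def)

lemma rules_wf: "r \<in> rules \<Longrightarrow> rule_wf 9 preds arity r"
proof -
  have "\<forall>r\<in>lin_rules. rule_wf 9 preds arity r"
    by (auto simp: lin_rules_def rule_wf_def preds_def)
  moreover have "\<forall>r\<in>word_rules. rule_wf 9 preds arity r"
  proof -
    have "Lin (dig (hd v)) \<in> preds" "Wd (tl v) \<in> preds" "Wd v \<in> preds"
      if "v \<in> short_words" "v \<noteq> []" for v
      using tl_short[OF that] lin_preds wd_preds that by (auto simp: short_words_def)
    then show ?thesis using lin_preds wd_preds[of "[]"]
      by (auto simp: word_rules_def rule_wf_def) (auto simp: preds_def)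
  qed
  moreover have "\<forall>r\<in>conc_rules. rule_wf 9 preds arity r"
    using lin_preds by (auto simp: conc_rules_def rule_wf_def) (auto simp: preds_def)
  moreover have "\<forall>r\<in>rew_rules. rule_wf 9 preds arity r"
    using lin_preds wd_preds L
    by (auto simp: rew_rules_def rule_wf_def shortening_def) (auto simp: preds_def)
  moreover have "\<forall>r\<in>input_rules. rule_wf 9 preds arity r"
    by (auto simp: input_rules_def rule_wf_def preds_def)
  moreover have "\<forall>r\<in>edge_rules. rule_wf 9 preds arity r"
  proof -
    have r: "Wd (rep a) \<in> preds" "Wd (rep (inv_letter a)) \<in> preds" if "a \<in> letters X" for a
      using rep[OF that] rep[of "inv_letter a"] wd_preds that by auto
    have "{Reach, Mid, Beg, SepOf, Tail, Last} \<subseteq> preds" by (auto simp: preds_def)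
    then show ?thesis by (simp add: edge_rules_def rule_wf_def r ball_Un)
  qed
  moreover have "\<forall>r\<in>path_rules. rule_wf 9 preds arity r"
    by (auto simp: path_rules_def rule_wf_def preds_def)
  ultimately show "r \<in> rules \<Longrightarrow> rule_wf 9 preds arity r" unfolding rules_def by blast
qed

end

section \<open>Soundness of the Datalog program\<close>

locale bkp_run = bkp_rules G S \<delta> X t k K L dig rep + bkp_graph G X w
  for G (structure) and S \<delta> X t k K L dig rep w
begin

text \<open>In the clause for \<open>Reach\<close> the accumulated element \<open>a\<close> is
  arbitrary, so that labels of consecutive paths can be multiplied.\<close>

primrec sem :: "'a pred \<Rightarrow> nat list \<Rightarrow> bool" where
  "sem (Lin a) vs \<longleftrightarrow> (\<exists>x. vs = [x, K * x + a])"
| "sem (Wd v) vs \<longleftrightarrow> v \<in> Words \<and> vs = [code v]"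
| "sem Wrd vs \<longleftrightarrow> (\<exists>u\<in>Words. vs = [code u])"
| "sem Conc vs \<longleftrightarrow> (\<exists>u\<in>Words. \<exists>v\<in>Words. vs = [code u, code v, code (u @ v)])"
| "sem Rew vs \<longleftrightarrow> (\<exists>u\<in>Words. \<exists>v\<in>Words. vs = [code u, code v] \<and> val u = val v)"
| "sem Ones vs \<longleftrightarrow> (\<exists>i. vs = [i] \<and> ones i)"
| "sem Last vs \<longleftrightarrow> (\<exists>i. vs = [i] \<and> last_sep i)"
| "sem SepOf vs \<longleftrightarrow> (\<exists>i s. vs = [i, s] \<and> sep_of i s)"
| "sem Good vs \<longleftrightarrow> (\<exists>i. vs = [i] \<and> valid_from i)"
| "sem Beg vs \<longleftrightarrow> (\<exists>i. vs = [i] \<and> block_start i)"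
| "sem Mid vs \<longleftrightarrow> (\<exists>i. vs = [i] \<and> inner i)"
| "sem Tail vs \<longleftrightarrow> (\<exists>p. vs = [p] \<and> tail_start p)"
| "sem Reach vs \<longleftrightarrow> (\<exists>i p j q. \<exists>u\<in>Words. vs = [i, p, j, q, code u] \<and>
    (\<forall>a\<in>carrier G. (((i, p), a), ((j, q), a \<otimes> val u)) \<in> conf\<^sup>*))"
| "sem Goal vs \<longleftrightarrow> vs = [] \<and> accepting"

abbreviation "Sem \<equiv> {(p, vs). sem p vs}"

text \<open>Assignments range over all naturals, so soundness follows for every segment length at
  once.\<close>

definition sound :: "('a bkp_symbol, 'a pred) datalog_rule \<Rightarrow> bool" where
  "sound r \<longleftrightarrow> (\<forall>\<sigma>. (\<forall>l\<in>set (snd r). lit_holds w Sem \<sigma> l) \<longrightarrow> sem (fst (fst r)) (map \<sigma> (snd (fst r))))"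

lemma sym_at_iff: "sym_at w i = Some x \<longleftrightarrow> i < length w \<and> w ! i = x" "sym_at w i = None \<longleftrightarrow> length w \<le> i"
  by (auto simp: sym_at_def)

lemma code_eq_iff: "u \<in> Words \<Longrightarrow> v \<in> Words \<Longrightarrow> code u = code v \<longleftrightarrow> u = v"
  using code_inj by blast

lemma code_zero_iff: "u \<in> Words \<Longrightarrow> code u = 0 \<longleftrightarrow> u = []" "u \<in> Words \<Longrightarrow> 0 = code u \<longleftrightarrow> u = []"
  using code_eq_iff[of u "[]"] by auto

lemma sound_lin: "\<forall>r\<in>lin_rules. sound r"
  by (auto simp: lin_rules_def sound_def)

lemma sound_word: "\<forall>r\<in>word_rules. sound r"
proof -
  have "\<exists>u\<in>Words. K * code u' + dig a = code u" if "u' \<in> Words" "a \<in> letters S" for u' a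
    using that by (intro bexI[of _ "a # u'"]) auto
  moreover have "v = []" if "K * code (tl v) + dig (hd v) \<noteq> code v" for v
    using that by (cases v) auto
  ultimately show ?thesis
    by (auto simp: word_rules_def sound_def short_words_def intro: bexI[of _ "[]"])
qed

lemma sound_conc: "\<forall>r\<in>conc_rules. sound r"
proof -
  have "\<exists>u'\<in>Words. \<exists>v'\<in>Words. K * code u + dig a = code u' \<and> code v = code v' \<and>
      K * code (u @ v) + dig a = code (u' @ v')" if "u \<in> Words" "v \<in> Words" "a \<in> letters S" for u v a
    using that by (intro bexI[of _ "a # u"] bexI[of _ v]) auto
  moreover have "\<exists>u'\<in>Words. \<exists>v'\<in>Words. 0 = code u' \<and> code v = code v' \<and> code v = code (u' @ v')"
    if "v \<in> Words" for v
    using that by (intro bexI[of _ "[]"] bexI[of _ v]) auto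
  ultimately show ?thesis by (auto simp: conc_rules_def sound_def)
qed

lemma sound_rew: "\<forall>r\<in>rew_rules. sound r"
proof -
  have closure: "\<exists>u'\<in>Words. \<exists>v'\<in>Words. K * code u + dig a = code u' \<and> K * code v + dig a = code v' \<and>
    val u' = val v'"
    if "u \<in> Words" "v \<in> Words" "a \<in> letters S" "val u = val v" for u v a
    using that by (intro bexI[of _ "a # u"] bexI[of _ "a # v"]) auto
  have step: "sem Rew [\<sigma> 3, \<sigma> 4]"
    if as: "(x, y) \<in> shortening k" "\<sigma> 0 = code x" "\<sigma> 1 = code y" "sem Conc [\<sigma> 0, \<sigma> 2, \<sigma> 3]"
      "sem Conc [\<sigma> 1, \<sigma> 2, \<sigma> 4]" for x y and \<sigma> :: "nat \<Rightarrow> nat"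
  proof -
    have xy: "x \<in> Words" "y \<in> Words" "val x = val y" using as(1) by (auto simp: shortening_def)
    obtain u v where 1: "u \<in> Words" "v \<in> Words" "code x = code u" "\<sigma> 2 = code v" "\<sigma> 3 = code (u @ v)"
      using as(2,4) by auto
    obtain u' v' where 2: "u' \<in> Words" "v' \<in> Words" "code y = code u'" "\<sigma> 2 = code v'" "\<sigma> 4 =
      code (u' @ v')"
      using as(3,5) by auto
    have "u = x" "u' = y" "v' = v" using 1 2 xy code_inj by metis+
    moreover have "val (x @ v) = val (y @ v)" using xy 1(2) by (simp add: val_append)
    ultimately have "sem Rew [code (x @ v), code (y @ v)]" unfolding sem.simps
      by (intro bexI[of _ "x @ v"] bexI[of _ "y @ v"]) (use xy 1(2) in simp_all)
    then show ?thesis using 1(5) 2(5) \<open>u = x\<close> \<open>u' = y\<close> \<open>v' = v\<close> by simp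
  qed
  have A: "sound ((Rew, [3, 4]),
      [LAtom (Wd x) [0], LAtom (Wd y) [1], LAtom Conc [0, 2, 3], LAtom Conc [1, 2, 4]])"
    if "(x, y) \<in> shortening k" for x y
    unfolding sound_def by (auto simp del: sem.simps(4,5) intro: step[OF that])
  have B: "sound ((Rew, [3, 4]), [LAtom Rew [0, 1], LAtom (Lin (dig a)) [0, 3],
    LAtom (Lin (dig a)) [1, 4]])"
    if "a \<in> letters S" for a
    unfolding sound_def using closure[OF _ _ that] by auto
  show ?thesis unfolding rew_rules_def using A B by auto
qed

lemma ones_Suc: "w ! i = One \<Longrightarrow> ones (Suc i) \<Longrightarrow> ones i"
  unfolding ones_def by (metis Suc_leI le_neq_implies_less)

lemma sep_of_Suc: "i < length w \<Longrightarrow> w ! i \<in> letter_syms \<Longrightarrow> sep_of (Suc i) s \<Longrightarrow> sep_of i s"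
  unfolding sep_of_def by (metis Suc_leD Suc_leI le_neq_implies_less)

lemma valid_from_Suc: "w ! i \<in> insert Sep letter_syms \<Longrightarrow> valid_from (Suc i) \<Longrightarrow> valid_from i"
  unfolding valid_from_def by (metis Suc_leD Suc_leI le_neq_implies_less)

lemma sound_input: "\<forall>r\<in>input_rules. sound r"
proof -
  have "ones i" if "length w \<le> i" for i using that by (auto simp: ones_def)
  moreover have "valid_from i" if "last_sep i" for i
    using that by (auto simp: valid_from_def intro: exI[of _ i])
  moreover have "sep_of i i" if "i < length w" "w ! i = Sep" for i using that by (auto simp: sep_of_def)
  moreover have "valid_from i" if "Letter a = w ! i" "a \<in> letters X" "valid_from (Suc i)" for i a
    using that valid_from_Suc[of i] unfolding letter_syms_def by (metis imageI insertI2)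
  moreover have "sep_of i s" if "i < length w" "Letter a = w ! i" "a \<in> letters X" "sep_of (Suc i) s"
    for i a s
    using that sep_of_Suc[of i s] unfolding letter_syms_def by (metis imageI)
  moreover have "inner i" if "sep_of i s" "sep_of (Suc s) s'" for i s s'
    using that unfolding inner_def by blast
  ultimately show ?thesis
    using ones_Suc valid_from_Suc
    by (auto simp: input_rules_def sound_def sym_at_iff last_sep_def block_start_def tail_start_def)
qed

lemma conf_edge:
  "edge v g v' \<Longrightarrow> a \<in> carrier G \<Longrightarrow> ((v, a), (v', a \<otimes> g)) \<in> conf\<^sup>*"
  unfolding conf_def by blast

lemma sem_edge:
  assumes "edge (i, p) (val u) (j, q)" "u \<in> Words"
  shows "sem Reach [i, p, j, q, code u]"
  using assms conf_edge by auto

lemma sound_edge: "\<forall>r\<in>edge_rules. sound r"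
proof -
  have 1: "sem Reach [i, p, Suc i, p, code (rep a)]"
    if "i < length w" "w ! i = Letter a" "inner i" "a \<in> letters X" for i p a
    by (rule sem_edge) (use that rep in \<open>auto simp: edge_def\<close>)
  have 2: "sem Reach [i, p, j, Suc p, code []]"
    if "i < length w" "w ! i = Sep" "inner i" "block_start j" "sep_of j i" "p < length w" "w ! p =
      One" for i p j
    by (rule sem_edge) (use that in \<open>auto simp: edge_def\<close>)
  have 3: "sem Reach [i, p, j, q, code []]"
    if "i < length w" "w ! i = Sep" "inner i" "sep_of (Suc i) j" "tail_start q" for i p j q
    by (rule sem_edge) (use that in \<open>auto simp: edge_def\<close>)
  have 4: "sem Reach [Suc i, p, i, p, code (rep (inv_letter a))]"
    if "i < length w" "w ! i = Letter a" "sep_of i s" "last_sep s" "a \<in> letters X" for i p a s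
    by (rule sem_edge) (use that rep[of "inv_letter a"] in \<open>auto simp: edge_def\<close>)
  show ?thesis
    using 1 2 3 4 unfolding edge_rules_def sound_def
    by (auto simp: sym_at_iff simp del: sem.simps(13))
qed

text \<open>Each fact comes with its own witnessing words; injectivity of \<open>code\<close>
  identifies those that share a number.\<close>

lemma sem_trans:
  assumes "sem Reach [i, p, j, q, x]" "sem Reach [j, q, i', p', y]" "sem Conc [x, y, z]"
  shows "sem Reach [i, p, i', p', z]"
proof -
  obtain u v where uv: "u \<in> Words" "v \<in> Words" "x = code u" "y = code v" "z = code (u @ v)"
    using assms(3) by auto
  have 1: "\<forall>a\<in>carrier G. (((i, p), a), ((j, q), a \<otimes> val u)) \<in> conf\<^sup>*"
    using assms(1) uv code_inj by auto
  have 2: "\<forall>a\<in>carrier G. (((j, q), a), ((i', p'), a \<otimes> val v)) \<in> conf\<^sup>*"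
    using assms(2) uv code_inj by auto
  have "(((i, p), a), ((i', p'), a \<otimes> val (u @ v))) \<in> conf\<^sup>*" if "a \<in> carrier G" for a
    using 1 2 that uv val_closed by (simp add: val_append m_assoc[symmetric]) (meson m_closed
      rtrancl_trans val_closed)
  then show ?thesis using uv by auto
qed

lemma sound_path: "\<forall>r\<in>path_rules. sound r"
proof -
  have 1: "sem Reach [i, p, i, p, 0]" for i p by (auto intro: bexI[of _ "[]"])
  have 2: "sem Reach [i, p, j, q, y]" if as: "sem Reach [i, p, j, q, x]" "sem Rew [x,
    y]" for i p j q x y
  proof -
    obtain u v where uv: "u \<in> Words" "v \<in> Words" "x = code u" "y = code v" "val u = val v"
      using as(2) by auto
    have "\<forall>a\<in>carrier G. (((i, p), a), ((j, q), a \<otimes> val u)) \<in> conf\<^sup>*"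
      using as(1) uv by (auto simp: code_eq_iff)
    then show ?thesis using uv by auto
  qed
  have 3: accepting if "valid_from 0" "sep_of 0 s" "tail_start p" "block_start b" "sep_of b s'"
    "last_sep s'"
    "sem Reach [s, p, b, p, 0]" for s p b s'
  proof -
    have "(((s, p), \<one>), ((b, p), \<one>)) \<in> conf\<^sup>*"
      using that(7) by (auto simp: code_zero_iff dest!: bspec[of _ _ \<one>])
    then show ?thesis using that unfolding accepting_def by blast
  qed
  show ?thesis unfolding path_rules_def sound_def
    by (auto simp del: sem.simps(13,4,5) intro: 1 2 3 sem_trans)
qed

lemma datalog_sound: "datalog rules w M \<subseteq> Sem"
proof (rule datalog_least)
  have "\<forall>r\<in>rules. sound r"
    using sound_lin sound_word sound_conc sound_rew sound_input sound_edge sound_path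
    unfolding rules_def by blast
  then show "datalog_closed rules w M Sem"
    unfolding datalog_closed_def sound_def by fastforce
qed

end

section \<open>Completeness: derivations along a triangulation\<close>

text \<open>\<open>W\<close> bounds the length of the words that occur in the derivation.\<close>

locale bkp_complete = bkp_run G S \<delta> X t k K L dig rep w
  for G (structure) and S \<delta> X t k K L dig rep w +
  fixes M W :: nat
  assumes M: "length w < M" "\<And>u. u \<in> Words \<Longrightarrow> length u \<le> W \<Longrightarrow> code u < M" and W: "L \<le> W"
begin

abbreviation "D \<equiv> datalog rules w M"

text \<open>The default \<open>0\<close> lies below \<open>M\<close>; closedness speaks only of
  assignments that are bounded at every variable.\<close>

definition asg :: "nat list \<Rightarrow> nat \<Rightarrow> nat" where
  "asg vs i = (if i < length vs then vs ! i else 0)"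

lemma asg_simps [simp]: "asg (v # vs) 0 = v" "asg (v # vs) (Suc i) = asg vs i"
  "asg (v # vs) (numeral n) = asg vs (pred_numeral n)"
  by (auto simp: asg_def numeral_eq_Suc)

lemma derive_rule:
  assumes "((p, xs), b) \<in> rules" "set vs \<subseteq> {..<M}" "\<forall>l\<in>set b. lit_holds w D (asg vs) l"
  shows "(p, map (asg vs) xs) \<in> D"
proof -
  have "asg vs x < M" for x using assms(2) M(1) nth_mem[of x vs] by (auto simp: asg_def subset_iff)
  then show ?thesis using datalog_closed[of rules w M] assms(1,3) unfolding datalog_closed_def
    by fastforce
qed

text \<open>Intermediate results never exceed the final one, and first arguments never exceed
  \<open>x\<close>, so the derivation stays below \<open>M\<close>.\<close>

lemma derive_Lin: "K * x + a < M \<Longrightarrow> x < M \<Longrightarrow> a \<le> K \<Longrightarrow> (Lin a, [x, K * x + a]) \<in> D"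
proof (induction x arbitrary: a)
  case 0
  then show ?case
  proof (induction a)
    case 0
    then show ?case
      using derive_rule[of "Lin 0" "[0, 1]" "[LZero 0, LZero 1]" "[0, 0]"]
        by (simp add: rules_def lin_rules_def)
  next
    case (Suc a)
    then show ?case
      using derive_rule[of "Lin (Suc a)" "[0, 2]" "[LAtom (Lin a) [0, 1], LSucc 1 2]" "[0, a, Suc a]"]
      by (simp add: rules_def lin_rules_def)
  qed
next
  case (Suc x)
  from Suc.prems show ?case
  proof (induction a)
    case 0
    have "(Lin K, [x, K * x + K]) \<in> D" using Suc.IH[of K] 0 by (simp add: add.commute)
    then show ?case
      using 0 derive_rule[of "Lin 0" "[2, 1]" "[LAtom (Lin K) [0, 1], LSucc 0 2]" "[x, K * x + K,
        Suc x]"]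
      by (simp add: rules_def lin_rules_def add.commute)
  next
    case (Suc a)
    then show ?case
      using derive_rule[of "Lin (Suc a)" "[0, 2]" "[LAtom (Lin a) [0, 1], LSucc 1 2]"
          "[Suc x, K * Suc x + a, K * Suc x + Suc a]"]
      by (simp add: rules_def lin_rules_def)
  qed
qed

lemma derive_digit:
  assumes "a \<in> letters S" "u \<in> Words" "length u < W"
  shows "(Lin (dig a), [code u, code (a # u)]) \<in> D" "code u < M" "code (a # u) < M"
  using assms derive_Lin[of "code u" "dig a"] M(2)[of u] M(2)[of "a # u"] dig_bounds[of a] by auto

lemma derive_Wrd: "u \<in> Words \<Longrightarrow> length u \<le> W \<Longrightarrow> (Wrd, [code u]) \<in> D"
proof (induction u)
  case Nil
  then show ?case
    using derive_rule[of Wrd "[0]" "[LZero 0]" "[0]"] M(1) by (simp add: rules_def word_rules_def)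
next
  case (Cons a u)
  then show ?case
    using derive_rule[of Wrd "[1]" "[LAtom Wrd [0], LAtom (Lin (dig a)) [0, 1]]" "[code u,
      code (a # u)]"]
      derive_digit[of a u] by (simp add: rules_def word_rules_def)
qed

lemma derive_Wd: "u \<in> Words \<Longrightarrow> length u \<le> L \<Longrightarrow> (Wd u, [code u]) \<in> D"
proof (induction u)
  case Nil
  then show ?case
    using derive_rule[of "Wd []" "[0]" "[LZero 0]" "[0]"] M(1) by (simp add: rules_def word_rules_def)
next
  case (Cons a u)
  have "((Wd (a # u), [1]), [LAtom (Wd u) [0], LAtom (Lin (dig a)) [0, 1]]) \<in> rules"
    using Cons.prems unfolding rules_def word_rules_def by (force simp: short_words_def)
  from derive_rule[OF this, of "[code u, code (a # u)]"] show ?case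
    using Cons derive_digit[of a u] W by simp
qed

lemma derive_Conc:
  "u \<in> Words \<Longrightarrow> v \<in> Words \<Longrightarrow> length u + length v \<le> W \<Longrightarrow> (Conc, [code u, code v, code (u @ v)]) \<in> D"
proof (induction u)
  case Nil
  then show ?case
    using derive_rule[of Conc "[0, 1, 1]" "[LZero 0, LAtom Wrd [1]]" "[0, code v]"] M(1) M(2)[of v]
      derive_Wrd[of v] by (simp add: rules_def conc_rules_def)
next
  case (Cons a u)
  then show ?case
    using derive_rule[of Conc "[3, 1, 4]"
        "[LAtom Conc [0, 1, 2], LAtom (Lin (dig a)) [0, 3], LAtom (Lin (dig a)) [2, 4]]"
        "[code u, code v, code (u @ v), code (a # u), code (a # (u @ v))]"]
      derive_digit[of a u] derive_digit[of a "u @ v"] M(2)[of v] by (simp add: rules_def conc_rules_def)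
qed

lemma derive_Rew:
  assumes "(u, v) \<in> shorten k" "length u \<le> W"
  shows "(Rew, [code u, code v]) \<in> D"
proof -
  obtain a b x y where uv: "u = a @ x @ b" "v = a @ y @ b" "a \<in> Words" "b \<in> Words"
    and xy: "(x, y) \<in> shortening k"
    using assms(1) unfolding shorten_def by blast
  have W': "x \<in> Words" "y \<in> Words" "length x \<le> L" "length y \<le> L" "length y < length x"
    using xy L by (auto simp: shortening_def)
  \<comment> \<open>A length bound on the left side suffices, since \<open>y\<close> is shorter than
    \<open>x\<close>.\<close>
  have "(Rew, [code (a @ x @ b), code (a @ y @ b)]) \<in> D" if "a \<in> Words" "length (a @ x @ b) \<le> W" for a
    using that
  proof (induction a)
    case Nil
    have "((Rew, [3, 4]), [LAtom (Wd x) [0], LAtom (Wd y) [1], LAtom Conc [0, 2, 3], LAtom Conc [1,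
      2, 4]]) \<in> rules"
      using xy unfolding rules_def rew_rules_def by force
    from derive_rule[OF this, of "[code x, code y, code b, code (x @ b), code (y @ b)]"] show ?case
      using Nil W' uv(4) W derive_Wd[of x] derive_Wd[of y] derive_Conc[of x b] derive_Conc[of y b]
        M(2)[of x] M(2)[of y] M(2)[of b] M(2)[of "x @ b"] M(2)[of "y @ b"] by simp
  next
    case (Cons c a)
    then show ?case
      using derive_rule[of Rew "[3, 4]" "[LAtom Rew [0, 1], LAtom (Lin (dig c)) [0, 3],
        LAtom (Lin (dig c)) [1, 4]]"
          "[code (a @ x @ b), code (a @ y @ b), 0, code (c # a @ x @ b), code (c # a @ y @ b)]"]
        derive_digit[of c "a @ x @ b"] derive_digit[of c "a @ y @ b"] W' uv(4) M(1)
      by (simp add: rules_def rew_rules_def)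
  qed
  then show ?thesis using uv assms(2) by simp
qed

lemma derive_Ones: "ones i \<Longrightarrow> i \<le> length w \<Longrightarrow> (Ones, [i]) \<in> D"
proof (induction "length w - i" arbitrary: i)
  case 0
  then show ?case
    using derive_rule[of Ones "[0]" "[LSym {None} 0]" "[i]"] M(1)
    by (simp add: rules_def input_rules_def sym_at_iff)
next
  case (Suc n)
  then have "(Ones, [Suc i]) \<in> D" "w ! i = One" "i < length w" by (auto simp: ones_def)
  then show ?case
    using derive_rule[of Ones "[0]" "[LSym one_sym 0, LSucc 0 1, LAtom Ones [1]]" "[i, Suc i]"] M(1)
    by (simp add: rules_def input_rules_def sym_at_iff)
qed

lemma derive_Last: "last_sep s \<Longrightarrow> (Last, [s]) \<in> D"
  using derive_rule[of Last "[0]" "[LSym sep_sym 0, LSucc 0 1, LAtom Ones [1]]" "[s, Suc s]"] M(1)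
    derive_Ones[of "Suc s"]
  by (simp add: rules_def input_rules_def sym_at_iff last_sep_def)

lemma derive_SepOf: "sep_of i s \<Longrightarrow> (SepOf, [i, s]) \<in> D"
proof (induction "s - i" arbitrary: i)
  case 0
  then have "i = s" "i < length w" "w ! i = Sep" by (auto simp: sep_of_def)
  then show ?case
    using derive_rule[of SepOf "[0, 0]" "[LSym sep_sym 0]" "[s]"] M(1)
    by (simp add: rules_def input_rules_def sym_at_iff)
next
  case (Suc n)
  then have "sep_of (Suc i) s" "i < s" "s < length w" "w ! i \<in> letter_syms" by (auto simp: sep_of_def)
  moreover from this obtain a where "a \<in> letters X" "w ! i = Letter a" by (auto simp: letter_syms_def)
  ultimately show ?case
    using Suc derive_rule[of SepOf "[0, 2]" "[LSym letter_sym 0, LSucc 0 1, LAtom SepOf [1,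
      2]]" "[i, Suc i, s]"] M(1)
    by (simp add: rules_def input_rules_def sym_at_def)
qed

lemma derive_Good: "valid_from i \<Longrightarrow> (Good, [i]) \<in> D"
proof -
  assume "valid_from i"
  then obtain s where "i \<le> s" "last_sep s" "\<forall>k. i \<le> k \<longrightarrow> k < s \<longrightarrow> w ! k \<in> insert Sep letter_syms"
    unfolding valid_from_def by blast
  then show ?thesis
  proof (induction "s - i" arbitrary: i)
    case 0
    then show ?case
      using derive_rule[of Good "[0]" "[LAtom Last [0]]" "[s]"] M(1) derive_Last[of s]
      by (simp add: rules_def input_rules_def last_sep_def)
  next
    case (Suc n)
    then have "(Good, [Suc i]) \<in> D" "i < s" "s < length w" "w ! i \<in> insert Sep letter_syms"
      by (auto simp: last_sep_def)
    then show ?case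
      using derive_rule[of Good "[0]" "[LSym (insert (Some Sep) letter_sym) 0, LSucc 0 1,
        LAtom Good [1]]" "[i, Suc i]"] M(1)
      by (simp add: rules_def input_rules_def sym_at_def letter_syms_def image_iff)
  qed
qed

lemma derive_Beg: "block_start i \<Longrightarrow> (Beg, [i]) \<in> D"
  using derive_rule[of Beg "[0]" "[LZero 0]" "[0]"] derive_rule[of Beg "[1]" "[LSym sep_sym 0,
    LSucc 0 1]" "[i - 1, i]"] M(1)
  by (auto simp: rules_def input_rules_def sym_at_iff block_start_def)

lemma derive_Mid: "inner i \<Longrightarrow> (Mid, [i]) \<in> D"
proof -
  assume "inner i"
  then obtain s s' where s: "sep_of i s" "sep_of (Suc s) s'" by (auto simp: inner_def)
  then have "i < M" "s < M" "Suc s < M" "s' < M" using M(1) by (auto simp: sep_of_def)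
  then show ?thesis
    using s derive_rule[of Mid "[0]" "[LAtom SepOf [0, 1], LSucc 1 2, LAtom SepOf [2, 3]]" "[i, s,
      Suc s, s']"]
      derive_SepOf by (simp add: rules_def input_rules_def)
qed

lemma derive_Tail: "tail_start p \<Longrightarrow> (Tail, [p]) \<in> D"
  using derive_rule[of Tail "[1]" "[LAtom Last [0], LSucc 0 1]" "[p - 1, p]"] M(1) derive_Last[of "p
    - 1"]
  by (auto simp: rules_def input_rules_def tail_start_def last_sep_def)

definition reach :: "nat \<times> nat \<Rightarrow> nat \<times> nat \<Rightarrow> 'a letter list \<Rightarrow> bool" where
  "reach v v' u \<longleftrightarrow> (Reach, [fst v, snd v, fst v', snd v', code u]) \<in> D"

text \<open>Letter edges keep the tail position without inspecting it, so its bound has to be handed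
  on from the source node.\<close>

lemma edge_bounds: "edge (i, p) g (j, q) \<Longrightarrow> p \<le> length w \<Longrightarrow> i \<le> length w \<and> j \<le> length w \<and> q \<le> length w"
  by (auto simp: edge_def sep_of_def tail_start_def last_sep_def)

lemma reach_edge:
  assumes "edge v g v'" "snd v \<le> length w"
  shows "\<exists>u\<in>Words. val u = g \<and> length u \<le> L \<and> reach v v' u"
proof -
  obtain i p j q where v: "v = (i, p)" "v' = (j, q)" by (metis prod.exhaust)
  have less: "i < M" "p < M" "j < M" "q < M"
    using edge_bounds[of i p g j q] assms M(1) by (auto simp: v)
  from assms(1) consider
    (letter) a where "a \<in> letters X" "i < length w" "w ! i = Letter a" "j = Suc i" "q =
      p" "inner i" "g = letter_val G a"
  | (loop) "i < length w" "w ! i = Sep" "inner i" "block_start j" "sep_of j i" "p < length w" "w ! p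
    = One"
      "q = Suc p" "g = \<one>"
  | (leave) "i < length w" "w ! i = Sep" "inner i" "sep_of (Suc i) j" "tail_start q" "g = \<one>"
  | (backward) a s where "a \<in> letters X" "j < length w" "w ! j = Letter a" "i = Suc j" "q =
    p" "sep_of j s"
      "last_sep s" "g = letter_val G (inv_letter a)"
    unfolding v edge_def by auto
  then show ?thesis
  proof cases
    case letter
    have "((Reach, [0, 2, 1, 2, 3]), [LSym {Some (Letter a)} 0, LSucc 0 1, LAtom Mid [0],
      LAtom (Wd (rep a)) [3]]) \<in> rules"
      using letter(1) unfolding rules_def edge_rules_def by blast
    from derive_rule[OF this, of "[i, j, p, code (rep a)]"]
    have "reach v v' (rep a)"
      using letter less rep[of a] W M(2)[of "rep a"] derive_Mid[of i] derive_Wd[of "rep a"]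
      by (simp add: reach_def v sym_at_iff)
    then show ?thesis using rep[of a] letter by blast
  next
    case loop
    have "reach v v' []"
      using derive_rule[of Reach "[0, 2, 1, 3, 4]" "[LSym sep_sym 0, LAtom Mid [0], LAtom Beg [1],
        LAtom SepOf [1, 0],
       LSym one_sym 2, LSucc 2 3, LZero 4]" "[i, j, p, q, 0]"] loop less
        derive_Mid[of i] derive_Beg[of j] derive_SepOf[of j i]
      by (simp add: reach_def v sym_at_iff rules_def edge_rules_def)
    then show ?thesis using loop by (intro bexI[of _ "[]"]) auto
  next
    case leave
    have "Suc i < M" using leave M(1) by simp
    then have "reach v v' []"
      using derive_rule[of Reach "[0, 2, 1, 3, 4]" "[LSym sep_sym 0, LAtom Mid [0], LSucc 0 5,
        LAtom SepOf [5, 1],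
       LAtom Tail [3], LZero 4]" "[i, j, p, q, 0, Suc i]"] leave less
        derive_Mid[of i] derive_Tail[of q] derive_SepOf[of "Suc i" j]
      by (simp add: reach_def v sym_at_iff rules_def edge_rules_def)
    then show ?thesis using leave by (intro bexI[of _ "[]"]) auto
  next
    case backward
    let ?r = "rep (inv_letter a)"
    have r: "?r \<in> Words" "length ?r \<le> L" "val ?r = g" using rep[of "inv_letter a"] backward by auto
    have "s < M" using backward M(1) by (simp add: last_sep_def)
    have "((Reach, [1, 2, 0, 2, 3]), [LSym {Some (Letter a)} 0, LSucc 0 1, LAtom SepOf [0, 4],
      LAtom Last [4],
       LAtom (Wd ?r) [3]]) \<in> rules"
      using backward(1) unfolding rules_def edge_rules_def by blast
    from derive_rule[OF this, of "[j, i, p, code ?r, s]"]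
    have "reach v v' ?r"
      using backward less r W M(2)[of ?r] derive_SepOf[of j s] derive_Last[of s] derive_Wd[of ?r] \<open>s
        < M\<close>
      by (simp add: reach_def v sym_at_iff)
    then show ?thesis using r by blast
  qed
qed

lemma reach_join:
  assumes "reach v1 v2 u" "reach v2 v3 u'" "u \<in> Words" "u' \<in> Words" "length u + length u' \<le> W"
    and "\<And>v. v \<in> {v1, v2, v3} \<Longrightarrow> fst v < M \<and> snd v < M"
  shows "reach v1 v3 (u @ u')"
  using derive_rule[of Reach "[0, 1, 4, 5, 8]" "[LAtom Reach [0, 1, 2, 3, 6], LAtom Reach [2, 3, 4,
    5, 7], LAtom Conc [6, 7, 8]]"
      "[fst v1, snd v1, fst v2, snd v2, fst v3, snd v3, code u, code u', code (u @ u')]"]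
    assms derive_Conc[of u u'] M(2)[of u] M(2)[of u'] M(2)[of "u @ u'"]
  by (simp add: reach_def rules_def path_rules_def)

text \<open>Rewriting never lengthens a word, so all intermediate codes stay below
  \<open>M\<close>.\<close>

lemma reach_shorten:
  assumes "(u, u') \<in> (shorten k)\<^sup>*" "reach v1 v2 u" "u \<in> Words" "length u \<le> W"
    and "\<And>v. v \<in> {v1, v2} \<Longrightarrow> fst v < M \<and> snd v < M"
  shows "reach v1 v2 u'"
  using assms(1)
proof (induction rule: rtrancl_induct)
  case (step y z)
  have y: "y \<in> Words" "length y \<le> W" using shorten_rtrancl[OF step(1) assms(3)] assms(4) by auto
  have z: "z \<in> Words" "length z \<le> W" using shorten_sound[OF step(2)] y by auto
  show ?case
    using derive_rule[of Reach "[0, 1, 2, 3, 5]" "[LAtom Reach [0, 1, 2, 3, 4], LAtom Rew [4, 5]]"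
        "[fst v1, snd v1, fst v2, snd v2, code y, code z]"]
      step(3) derive_Rew[OF step(2) y(2)] M(2)[OF y] M(2)[OF z] assms(5)
    by (simp add: reach_def rules_def path_rules_def)
qed (rule assms(2))

text \<open>The value of a chord has length at most \<open>B\<close>, so its shortened word has
  length at most \<open>t * (B + t + 1)\<close>; joining two such words is the worst that happens,
  whence the factor \<open>2\<close> in the bound by \<open>W\<close>. The chord that closes the
  path has trivial value and shrinks to the empty word.\<close>

lemma path_reach:
  assumes T: "((v0, \<one>), (v1, \<one>)) \<in> conf ^^ T" "T \<le> 2 ^ r"
    and v0: "fst v0 \<le> length w" "snd v0 \<le> length w"
    and B: "real B \<ge> 2 * real L + 2 * real r * \<delta>" "2 * (t * (B + t + 1)) \<le> W"
  shows "reach v0 v1 []"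
proof (cases "T = 0")
  case True
  then have "v1 = v0" using T(1) by simp
  then show ?thesis
    using derive_rule[of Reach "[0, 1, 0, 1, 2]" "[LZero 2]" "[fst v0, snd v0, 0]"] v0 M(1)
    by (simp add: reach_def rules_def path_rules_def)
next
  case False
  obtain f where f: "f 0 = (v0, \<one>)" "f T = (v1, \<one>)" "\<And>i. i < T \<Longrightarrow> (f i, f (Suc i)) \<in> conf"
    using T(1) unfolding relpow_fun_conv by auto
  define v where "v i = fst (f i)" for i
  \<comment> \<open>Continued by \<open>\<one>\<close> beyond the path, because the triangulation
    lemma speaks of a sequence indexed by all naturals.\<close>
  define p where "p i = (if i \<le> T then snd (f i) else \<one>)" for i
  have step: "\<exists>g. edge (v i) g (v (Suc i)) \<and> p (Suc i) = p i \<otimes> g \<and> g \<in> carrier G \<and> p i \<in> carrier G"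
    if i: "i < T" for i
    using f(3)[OF i] i edge_closed unfolding conf_def v_def p_def by auto
  have pc: "p i \<in> carrier G" for i
  proof (cases "i < T")
    case True
    then show ?thesis using step by blast
  next
    case ge: False
    then show ?thesis using f(2) by (cases "i = T") (auto simp: p_def)
  qed
  \<comment> \<open>Tail positions come first: by \<open>edge_bounds\<close> the bound on block
    positions depends on them.\<close>
  have snd_v: "i \<le> T \<Longrightarrow> snd (v i) \<le> length w" for i
  proof (induction i)
    case 0
    then show ?case using f(1) v0 by (simp add: v_def)
  next
    case (Suc i)
    then show ?case using step[of i] edge_bounds by (metis Suc_leD Suc_le_lessD prod.collapse)
  qed
  have fst_v: "fst (v i) \<le> length w" if "i \<le> T" for i
  proof (cases i)
    case 0
    then show ?thesis using f(1) v0 by (simp add: v_def)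
  next
    case (Suc j)
    then show ?thesis using step[of j] edge_bounds snd_v[of j] that
      by (metis Suc_leD Suc_le_lessD prod.collapse)
  qed
  have vM: "fst (v i) < M \<and> snd (v i) < M" if "i \<le> T" for i
    using snd_v[OF that] fst_v[OF that] M(1) by simp
  let ?C = "t * (B + t + 1)"
  have "0 < t" using t(1) \<delta> by (cases t) auto
  have LB: "L \<le> B" using B(1) \<delta> by (smt (verit) of_nat_0_le_iff mult_nonneg_nonneg of_nat_le_iff)
  have LC: "L \<le> ?C" using LB \<open>0 < t\<close> by (metis le_add1 le_trans add.assoc mult_le_mono1 Suc_leI
    nat_mult_1 One_nat_def)
  let ?P = "\<lambda>i j. j \<le> T \<longrightarrow> (\<exists>u\<in>Words. val u = inv (p i) \<otimes> p j \<and> length u \<le> ?C \<and> reach (v i) (v j) u)"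
  have "?P 0 T"
  proof (rule closed_path_induct[of p T "real L" r ?P])
    show "p 0 = \<one>" "p T = \<one>" using f(1,2) by (auto simp: p_def)
    show "0 < T" "T \<le> 2 ^ r" using False T(2) by auto
    fix i assume i: "i < T"
    obtain g where g: "edge (v i) g (v (Suc i))" "p (Suc i) = p i \<otimes> g" "g \<in> carrier G"
      using step[OF i] by blast
    obtain u where u: "u \<in> Words" "val u = g" "length u \<le> L" "reach (v i) (v (Suc i)) u"
      using reach_edge[OF g(1)] snd_v[of i] i by auto
    have "inv (p i) \<otimes> p (Suc i) = g" using g pc by (simp add: m_assoc[symmetric])
    then show "?P i (Suc i)" using u LC by (auto intro!: bexI[of _ u])
    show "d (p i) (p (Suc i)) \<le> real L" using dist_mult[OF pc[of i] g(3)] g(2) len_le[OF u(1)]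
      u(2,3) by simp
  next
    fix i m j
    assume ij: "i < m" "m < j" "j \<le> T" and dist: "d (p i) (p j) \<le> 2 * real L + 2 * real r * \<delta>"
      and "?P i m" "?P m j"
    then obtain u u' where u: "u \<in> Words" "val u = inv (p i) \<otimes> p m" "length u \<le> ?C" "reach (v i) (v
      m) u"
      and u': "u' \<in> Words" "val u' = inv (p m) \<otimes> p j" "length u' \<le> ?C" "reach (v m) (v j) u'"
      by auto
    have W': "length u + length u' \<le> W" using u(3) u'(3) B(2) by simp
    have r: "reach (v i) (v j) (u @ u')"
      by (rule reach_join[OF u(4) u'(4) u(1) u'(1) W']) (use vM ij in auto)
    have uu: "u @ u' \<in> Words" using u u' by simp
    \<comment> \<open>The joined word is shortened at once. Its value is a chord and hence short, so
      the local geodesic fits into \<open>?C\<close> again and the bound does not grow along the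
      recursion.\<close>
    obtain z where z: "(u @ u', z) \<in> (shorten k)\<^sup>*" "local_geodesic k z"
      using shorten_local_geodesic[OF uu] by blast
    have zW: "z \<in> Words" "val z = val (u @ u')" using shorten_rtrancl[OF z(1) uu] by auto
    have "reach (v i) (v j) z"
      by (rule reach_shorten[OF z(1) r uu]) (use W' vM ij in auto)
    moreover have val: "val z = inv (p i) \<otimes> p j"
    proof -
      have "val z = inv (p i) \<otimes> (p m \<otimes> (inv (p m) \<otimes> p j))"
        using zW(2) u u' pc by (simp add: val_append m_assoc)
      also have "p m \<otimes> (inv (p m) \<otimes> p j) = p j" using pc by (simp add: m_assoc[symmetric])
      finally show ?thesis .
    qed
    moreover have "len (val z) \<le> B"
      using dist B(1) unfolding val word_dist_def by linarith
    then have "length z \<le> ?C"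
      using local_geodesic_length[OF zW(1) z(2) t(1,2)] by (meson add_le_mono1 le_trans mult_le_mono2)
    ultimately show "?P i j" using zW by auto
  qed (use pc in auto)
  then obtain u where u: "u \<in> Words" "val u = \<one>" "length u \<le> ?C" "reach v0 v1 u"
    using f(1,2) by (auto simp: p_def v_def)
  obtain z where z: "(u, z) \<in> (shorten k)\<^sup>*" "local_geodesic k z"
    using shorten_local_geodesic[OF u(1)] by blast
  have "z = []"
    by (rule local_geodesic_trivial[OF _ z(2) _ t]) (use shorten_rtrancl[OF z(1) u(1)] u(2) in auto)
  moreover have "reach v0 v1 z"
    by (rule reach_shorten[OF z(1) u(4) u(1)])
      (use u(3) B(2) vM[of 0] vM[of T] f(1,2) in \<open>auto simp: v_def\<close>)
  ultimately show ?thesis by simp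
qed

lemma BKP_derivable:
  assumes "w \<in> BKP G X" "(length w + 2) ^ 2 \<le> 2 ^ r"
    and B: "real B \<ge> 2 * real L + 2 * real r * \<delta>" "2 * (t * (B + t + 1)) \<le> W"
  shows "(Goal, []) \<in> D"
proof -
  obtain s p b s' T where *: "valid_from 0" "sep_of 0 s" "tail_start p" "block_start b" "sep_of b s'"
    "last_sep s'" "T \<le> (length w + 2) ^ 2" "(((s, p), \<one>), ((b, p), \<one>)) \<in> conf ^^ T"
    using BKP_path[OF assms(1)] by metis
  have less: "s < length w" "p \<le> length w" "b < length w" "s' < length w"
    using *(2,3,5) by (auto simp: sep_of_def tail_start_def last_sep_def)
  have "T \<le> 2 ^ r" using *(7) assms(2) by (rule order_trans)
  then have "reach (s, p) (b, p) []"
    using less by (intro path_reach[OF *(8) _ _ _ B]) auto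
  then show ?thesis
    using derive_rule[of Goal "[]" "[LZero 0, LAtom Good [0], LAtom SepOf [0, 1], LAtom Tail [2],
      LAtom Beg [3],
       LAtom SepOf [3, 4], LAtom Last [4], LAtom Reach [1, 2, 3, 2, 0]]" "[0, s, p, b, s']"]
      less M(1) derive_Good[OF *(1)] derive_SepOf[OF *(2)] derive_Tail[OF *(3)] derive_Beg[OF *(4)]
      derive_SepOf[OF *(5)] derive_Last[OF *(6)]
    by (simp add: reach_def rules_def path_rules_def)
qed

end

section \<open>Choice of constants and conclusion\<close>

lemma power_two_between:
  assumes "1 \<le> (m::nat)"
  obtains r where "m \<le> 2 ^ r" "2 ^ r < 2 * m"
proof -
  define r where "r = (LEAST r. m \<le> 2 ^ r)"
  have r: "m \<le> 2 ^ r"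
    unfolding r_def by (rule LeastI[of _ m]) (simp add: less_imp_le)
  moreover have "2 ^ r < 2 * m"
  proof (cases r)
    case 0
    then show ?thesis using assms by simp
  next
    case (Suc r')
    then have "\<not> m \<le> 2 ^ r'" unfolding r_def by (metis lessI not_less_Least)
    then show ?thesis using Suc by simp
  qed
  ultimately show ?thesis using that by blast
qed

theorem corollary5p10:
  fixes G :: "('a, 'b) monoid_scheme" and X :: "'a set"
  assumes "hyperbolic_group G"
    and "finite_generating_set G X"
  shows "in_class_P (bkp_alphabet X) (BKP G X)"
proof -
  obtain S \<delta> where G: "group G" and S: "finite_generating_set G S" and \<delta>: "0 \<le> \<delta>"
    and hyp: "\<forall>x\<in>carrier G. \<forall>y\<in>carrier G. \<forall>z\<in>carrier G. \<forall>w\<in>carrier G.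
      gromov_product (word_dist G S) x y w \<ge>
        min (gromov_product (word_dist G S) x z w) (gromov_product (word_dist G S) z y w) - \<delta>"
    using assms(1) unfolding hyperbolic_group_def gromov_hyperbolic_def by blast
  interpret group G by (rule G)
  interpret hyperbolic G S \<delta> by unfold_locales (use S \<delta> hyp in auto)
  have X: "X \<subseteq> carrier G" "finite X" using assms(2) by (auto simp: finite_generating_set_def)
  have finX: "finite (letters X)" and finS: "finite (letters S)"
    using X(2) local.S(2) by (auto simp: letters_def)
  define t where "t = nat \<lceil>2 * \<delta> + 1\<rceil>"
  \<comment> \<open>Large enough for both requirements on the scale, \<open>2 * t\<close> and
    \<open>t * (t + 1)\<close>.\<close>
  define k where "k = t * (t + 3)"
  define K where "K = card (letters S)"
  define L where "L = k + (\<Sum>a\<in>letters X. len (letter_val G a))"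
  define \<delta>' where "\<delta>' = nat \<lceil>2 * \<delta>\<rceil>"
  \<comment> \<open>The word length bound will be \<open>\<alpha> + \<beta> * r\<close>: this is
    \<open>2 * (t * (B + t + 1))\<close> for \<open>B = 2 * L + \<delta>' * r\<close>, sorted by
    powers of \<open>r\<close>, plus \<open>L\<close> to make room for the constant words.\<close>
  define \<alpha> where "\<alpha> = 2 * t * (2 * L + t + 1) + L"
  define \<beta> where "\<beta> = 2 * t * \<delta>'"
  \<comment> \<open>Read off from \<open>(K + 1) ^ (\<alpha> + \<beta> * r) \<le> 2 ^ (K * \<alpha>)
    * (2 ^ r) ^ (K * \<beta>)\<close>, where \<open>2 ^ r\<close> is at most the cube of the input
    length plus two. The successor makes the exponent positive.\<close>
  define c where "c = Suc (K * \<alpha> + 3 * (K * \<beta>))"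
  have t: "2 * \<delta> + 1 \<le> real t" unfolding t_def by linarith
  have \<delta>': "2 * \<delta> \<le> real \<delta>'" unfolding \<delta>'_def by linarith
  have "\<exists>dig. bij_betw dig (letters S) {1..K}"
    by (rule finite_same_card_bij[OF finS]) (simp_all add: K_def)
  then obtain dig where dig: "bij_betw dig (letters S) {1..K}" by blast
  have "\<exists>u. u \<in> Words \<and> val u = letter_val G a \<and> length u = len (letter_val G a)"
    if "a \<in> letters X" for a
    using geodesic_exists[OF letter_val_closed[OF X(1) that]] by metis
  then obtain rep where rep: "\<And>a. a \<in> letters X \<Longrightarrow> rep a \<in> Words \<and> val (rep a) = letter_val G a \<and>
      length (rep a) = len (letter_val G a)" by metis
  have rep_L: "length (rep a) \<le> L" if "a \<in> letters X" for a
    using member_le_sum[OF that, of "\<lambda>a. len (letter_val G a)"] finX rep[OF that] by (simp add: L_def)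
  interpret bkp_rules G S \<delta> X t k K L dig rep
  proof unfold_locales
    show "2 * t \<le> k" "t * (t + 1) \<le> k" by (simp_all add: k_def add_mult_distrib2)
    show "k \<le> L" by (simp add: L_def)
  qed (use X t dig rep rep_L in blast)+
  obtain Rs where Rs: "set Rs = rules" using finite_list[OF finite_rules] by blast
  show ?thesis
  proof (rule datalog_in_class_P[of Rs 9 preds arity Goal c])
    show "finite (bkp_alphabet X)" using finX by (simp add: bkp_alphabet_def)
    show "BKP G X \<subseteq> lists (bkp_alphabet X)"
      by (auto simp: BKP_def bkp_encode_def bkp_alphabet_def in_lists_conv_set)
    fix w assume w: "w \<in> lists (bkp_alphabet X)"
    let ?n = "length w"
    let ?M = "?n + (?n + 2) ^ c"
    interpret bkp_run G S \<delta> X t k K L dig rep w by unfold_locales (use assms(2) in \<open>simp add: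
      finite_generating_set_def\<close>)
    have "w \<in> BKP G X" if "(Goal, []) \<in> datalog rules w ?M"
      using that datalog_sound[of ?M] accepting_BKP[OF w] by auto
    moreover have "(Goal, []) \<in> datalog rules w ?M" if BKP: "w \<in> BKP G X"
    proof -
      obtain r where r: "(?n + 2) ^ 2 \<le> 2 ^ r" "2 ^ r < 2 * (?n + 2) ^ 2"
        using power_two_between[of "(?n + 2) ^ 2"] by auto
      \<comment> \<open>The power of two is less than twice the square, and one more factor
        \<open>?n + 2\<close> absorbs the \<open>2\<close>.\<close>
      have r3: "2 ^ r \<le> (?n + 2) ^ 3"
      proof -
        have "2 * (?n + 2) ^ 2 \<le> (?n + 2) * (?n + 2) ^ 2" by (intro mult_le_mono1) simp
        then show ?thesis using r(2) by (simp add: power3_eq_cube power2_eq_square)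
      qed
      define W where "W = \<alpha> + \<beta> * r"
      have code_M: "code u < ?M" if u: "u \<in> Words" "length u \<le> W" for u
      proof -
        have "code u < (K + 1) ^ length u" by (rule code_less[OF u(1)])
        also have "\<dots> \<le> (K + 1) ^ W" using u(2) by (intro power_increasing) auto
        also have "\<dots> \<le> (2 ^ K) ^ W" by (intro power_mono) (auto simp: Suc_leI)
        also have "\<dots> = 2 ^ (K * \<alpha>) * (2 ^ r) ^ (K * \<beta>)"
          by (simp add: W_def power_add power_mult[symmetric] algebra_simps)
        also have "\<dots> \<le> (?n + 2) ^ (K * \<alpha>) * ((?n + 2) ^ 3) ^ (K * \<beta>)"
          using r3 by (intro mult_le_mono power_mono) auto
        also have "\<dots> = (?n + 2) ^ (K * \<alpha> + 3 * (K * \<beta>))"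
          by (simp add: power_add power_mult)
        also have "\<dots> \<le> (?n + 2) ^ c" unfolding c_def by (intro power_increasing) auto
        finally show ?thesis by simp
      qed
      have "?n < ?M" by simp
      interpret bkp_complete G S \<delta> X t k K L dig rep w ?M W
        by unfold_locales (use code_M \<open>?n < ?M\<close> in \<open>auto simp: W_def \<alpha>_def\<close>)
      have "real r * (2 * \<delta>) \<le> real r * real \<delta>'" using \<delta>' by (intro mult_left_mono) auto
      then have "2 * real L + 2 * real r * \<delta> \<le> real (2 * L + \<delta>' * r)" by (simp add: algebra_simps)
      moreover have "2 * (t * (2 * L + \<delta>' * r + t + 1)) \<le> W"
        by (simp add: W_def \<alpha>_def \<beta>_def algebra_simps)
      ultimately show ?thesis using BKP_derivable[OF BKP r(1)] by blast
    qed
    ultimately show "w \<in> BKP G X \<longleftrightarrow> (Goal, []) \<in> datalog (set Rs) w ?M" unfolding Rs by blast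
  qed (use rules_wf Rs finite_preds in \<open>auto simp: preds_def c_def\<close>)
qed

end
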